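(* Consider the CFD-SQO$_1$-eq-free method of the context, applied to problem (Q), with parameters $\rho\in(0,0.5)$ and $\tau_1\ge2$, and let $\{u_k=(x_k,y_k)\}$ be an infinite sequence it generates. Suppose: (1) there is $\eta>0$ with $\mathcal H_k^u\succeq\eta I_{n_1+n_2}$ for all $k$, and whenever a subsequence $\{u_k\}_{k\in K}$ is bounded, $\{\mathcal H_k^u\}_{k\in K}$ is bounded; (2) $f$ and $\theta$ are three times continuously differentiable in a neighborhood of the feasible set $\mathcal F_+$; the sequence $\{u_k\}$ is bounded, and every accumulation point $u_*=(x_*,y_* )$ of it satisfies: (a) the matrix $\mathcal B_{u_*}=\begin{pmatrix}E_{S_{u_*}}&F_{S_{u_*}}\\ C_{I_{x_*}}&0\\ 0&D_{J_{y_*}}\end{pmatrix}$ has full row rank; (b) with $(\mu_*,\alpha_*^x,\gamma_*^x,\alpha_*^y,\gamma_*^y)$ the unique KKT multiplier of (Q) at $u_*$, one has $z^\top\nabla^2\Phi(u_* )z>0$ for all $0\ne z\in\mathbb R^{n_1+n_2}$ with $\begin{pmatrix}E_{S_*^+}&F_{S_*^+}\\ C_{I_*^+}&0\\0&D_{J_*^+}\end{pmatrix}z=0$; (3) at least one of the following holds: either $\|(\mathcal H_k^u-\nabla^2\Phi(u_k))d_k^u\|=O(\|d_k^u\|^2)$; or $\|P_k(\mathcal H_k^u-\nabla^2\Phi(u_k))d_k^u\|=O(\|d_k^u\|^2)$ and strict complementarity holds: $(\alpha_*^x)_{I_*^l}>0$, $(\gamma_*^x)_{I_*^v}>0$, $(\alpha_*^y)_{J_*^s}>0$,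 $(\gamma_*^y)_{J_*^r}>0$, $(\mu_* )_{S_*}>0$. Then $\|u_{k+1}-u_*\|=O(\|u_k-u_*\|^2)$, i.e. the method is quadratically convergent.
   Context: **Problem (Q)** (no equality constraint). Minimize $\Phi(u)=\Phi(x,y):=f(x)+\theta(y)$ subject to $Ex+Fy-d\le 0$, $x\in\mathcal X:=\{x\in\mathbb R^{n_1}: l\le Cx\le v\}$, $y\in\mathcal Y:=\{y\in\mathbb R^{n_2}: s\le Dy\le r\}$, where $E\in\mathbb R^{m_2\times n_1}$, $F\in\mathbb R^{m_2\times n_2}$, $d\in\mathbb R^{m_2}$, $C\in\mathbb R^{l_1\times n_1}$, $D\in\mathbb R^{l_2\times n_2}$; $l,s$ have entries in $\mathbb R\cup\{-\infty\}$, $v,r$ have entries in $\mathbb R\cup\{+\infty\}$, $l<v$, $s<r$ componentwise; $f,\theta$ are at least continuously differentiable. Write $u=(x,y)$, $\|z\|_H^2=z^\top Hz$, and $\mathcal F_+=\{(x,y)\in\mathcal X\times\mathcal Y:Ex+Fy-d\le0\}$ (the feasible set). The multiplier of an infinite bound is $0$ by convention; $0\le p\perp q\ge 0$ means $p,q\ge0$, $p^\top q=0$. KKT conditions of (Q) at $u\in\mathcal F_+$ with multiplier $(\mu,\alpha^x,\gamma^x,\alpha^y,\gamma^y)$: $\nabla f(x)+E^\top\mu+C^\top(\gamma^x-\alpha^x)=0$, $\nabla\theta(y)+F^\top\mu+D^\top(\gamma^y-\alpha^y)=0$, $0\le\mu\perp(d-Ex-Fy)\ge0$, $0\le\alpha^x\perp(Cx-l)\ge0$,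 $0\le\gamma^x\perp(v-Cx)\ge0$, $0\le\alpha^y\perp(Dy-s)\ge0$, $0\le\gamma^y\perp(r-Dy)\ge0$. **CFD-SQO$_1$-eq-free method.** (This is the paper's PFD-SQO method with parameter $c=1$ applied to (Q), all terms from equality constraints being absent.) Parameters: $\rho,\sigma\in(0,1)$, $\tau_1>0$, $M,M_1>0$. Start from $u_0\in\mathcal F_+$. At iteration $k$, given $u_k=(x_k,y_k)\in\mathcal F_+$ and symmetric positive definite $H_k^x\in\mathbb R^{n_1\times n_1}$, $H_k^y\in\mathbb R^{n_2\times n_2}$, put $h_k=Ex_k+Fy_k-d$ and $\mathcal H_k^u=\mathrm{diag}(H_k^x,H_k^y)$. Step 1. $\tilde x_{k+1}$ is the minimizer of $\nabla f(x_k)^\top(x-x_k)+\frac12\|x-x_k\|^2_{H_k^x}$ s.t. $Ex+Fy_k-d\le\frac12h_k$, $l\le Cx\le v$, with KKT multipliers $\mu_k^x,\alpha_k^x,\gamma_k^x$ for $Ex+Fy_k-d\le\frac12h_k$, $Cx\ge l$, $Cx\le v$; $\tilde y_{k+1}$ is the minimizer of $\nabla\theta(y_k)^\top(y-y_k)+\frac12\|y-y_k\|^2_{H_k^y}$ s.t. $Ex_k+Fy-d\le\frac12h_k$, $s\le Dy\le r$, with KKT multipliers $\mu_k^y,\alpha_k^y,\gamma_k^y$ for $Ex_k+Fy-d\le\frac12h_k$, $Dy\ge s$, $Dy\le r$. Step 2. $d_k^u=(\tilde x_{k+1}-x_k,\tilde y_{k+1}-y_k)$. If $\min\{\|\mu_k^x\|,\|\mu_k^y\|\}\le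 M$ and $\|\mu_k^x-\mu_k^y\|\le M_1\|d_k^u\|^{\tau_1}$, go to Step 4; otherwise go to Step 3. Step 3. $(\tilde x_{k+1},\tilde y_{k+1})$ is the minimizer of $\nabla f(x_k)^\top(x-x_k)+\frac12\|x-x_k\|^2_{H_k^x}+\nabla\theta(y_k)^\top(y-y_k)+\frac12\|y-y_k\|^2_{H_k^y}$ s.t. $Ex+Fy-d\le0$, $x\in\mathcal X$, $y\in\mathcal Y$, with multiplier $\mu_k$ for $Ex+Fy-d\le0$ and $\alpha_k^x,\gamma_k^x,\alpha_k^y,\gamma_k^y$ for the bounds; set $\mu_k^x=\mu_k^y=\mu_k$; redefine $d_k^u=(\tilde x_{k+1}-x_k,\tilde y_{k+1}-y_k)$. Step 4. $t_k$ is the largest $t\in\{\sigma^i:i=0,1,2,\dots\}$ with $\Phi(u_k+td_k^u)\le\Phi(u_k)-\rho t\|d_k^u\|^2_{\mathcal H_k^u}$. Step 5. $u_{k+1}=u_k+t_kd_k^u$. If $u_{k+1}=u_k$, stop; otherwise choose new symmetric positive definite $H_{k+1}^x,H_{k+1}^y$ and continue. **Active sets.** For $u=(x,y)\in\mathcal F_+$: $I_x^l=\{i:(Cx)_i=l_i\}$, $I_x^v=\{i:(Cx)_i=v_i\}$, $I_x=I_x^l\cup I_x^v$, $J_y^s=\{j:(Dy)_j=s_j\}$, $J_y^r=\{j:(Dy)_j=r_j\}$, $J_y=J_y^s\cup J_y^r$, $S_u=\{i:(Ex+Fy-d)_i=0\}$. $Q_S$ is the submatrix (subvector) of rows with indices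 in $S$. At $u_*$: $I_*^l=I_{x_*}^l$, $I_*^v=I_{x_*}^v$, $J_*^s=J_{y_*}^s$, $J_*^r=J_{y_*}^r$, $S_*=S_{u_*}$; $I_*^+=\{i\in I_*^l:(\alpha_*^x)_i>0\}\cup\{i\in I_*^v:(\gamma_*^x)_i>0\}$, $J_*^+=\{j\in J_*^s:(\alpha_*^y)_j>0\}\cup\{j\in J_*^r:(\gamma_*^y)_j>0\}$, $S_*^+=\{i\in S_*:(\mu_* )_i>0\}$. **Projection matrix.** $I_k=I_{\tilde x_{k+1}}$, $J_k=J_{\tilde y_{k+1}}$; $S_k^+=\{i:(E\tilde x_{k+1}+F\tilde y_{k+1}-d)_i=0\}$ if $(\tilde x_{k+1},\tilde y_{k+1})$ comes from Step 3, and $S_k^+=\{i:(E\tilde x_{k+1}+Fy_k-d-\frac12h_k)_i=0\}\cap\{i:(Ex_k+F\tilde y_{k+1}-d-\frac12h_k)_i=0\}$ if it comes from Step 1. $\mathcal B_k=\begin{pmatrix}E_{S_k^+}&F_{S_k^+}\\ C_{I_k}&0\\0&D_{J_k}\end{pmatrix}$ and $P_k=I_{n_1+n_2}-\mathcal B_k^\top(\mathcal B_k\mathcal B_k^\top)^{-1}\mathcal B_k$ (well defined for all sufficiently large $k$ under the hypotheses). *)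

theory Defs
  imports "HOL-Analysis.Analysis" "HOL-Library.Landau_Symbols"
begin

section \<open>Smoothness\<close>

text \<open>Intended for open \<open>S\<close>. Differentiability at every point together with the recursion
  on the partial derivatives gives continuity of all derivatives up to order \<open>k\<close>.\<close>

primrec C_k_on :: "nat \<Rightarrow> ('a::euclidean_space \<Rightarrow> real) \<Rightarrow> 'a set \<Rightarrow> bool" where
  "C_k_on 0 f S \<longleftrightarrow> continuous_on S f"
| "C_k_on (Suc k) f S \<longleftrightarrow>
     (\<forall>x\<in>S. f differentiable at x) \<and>
     (\<forall>b\<in>Basis. C_k_on k (\<lambda>x. frechet_derivative f (at x) b) S)"

definition gradient :: "('a::euclidean_space \<Rightarrow> real) \<Rightarrow> 'a \<Rightarrow> 'a" where
  "gradient f x = (THE g. GDERIV f x :> g)"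

text \<open>The Hessian as a linear map, so that \<open>z \<bullet> hessian f x z\<close> is its quadratic form.\<close>

definition hessian :: "('a::euclidean_space \<Rightarrow> real) \<Rightarrow> 'a \<Rightarrow> 'a \<Rightarrow> 'a" where
  "hessian f x = frechet_derivative (gradient f) (at x)"


section \<open>Problem (Q)\<close>

text \<open>Minimize \<open>f x + \<theta> y\<close> subject to \<open>E x + F y - d \<le> 0\<close>, \<open>l \<le> C x \<le> v\<close>, \<open>s \<le> D y \<le> r\<close>.
  The bounds are extended reals, and \<open>u = (x, y)\<close> lives in the product space, whose norm and
  inner product are the Euclidean ones.\<close>

record ('n1::finite, 'n2::finite, 'm::finite, 'c::finite, 'e::finite) problem =
  objx :: "real ^ 'n1 \<Rightarrow> real"      (* f *)
  objy :: "real ^ 'n2 \<Rightarrow> real"      (* theta *)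
  matE :: "real ^ 'n1 ^ 'm"
  matF :: "real ^ 'n2 ^ 'm"
  vecd :: "real ^ 'm"
  matC :: "real ^ 'n1 ^ 'c"
  lowC :: "ereal ^ 'c"               (* l *)
  uppC :: "ereal ^ 'c"               (* v *)
  matD :: "real ^ 'n2 ^ 'e"
  lowD :: "ereal ^ 'e"               (* s *)
  uppD :: "ereal ^ 'e"               (* r *)

definition admissible_bounds :: "ereal ^ 'i \<Rightarrow> ereal ^ 'i \<Rightarrow> bool" where
  "admissible_bounds l v \<longleftrightarrow> (\<forall>i. l $ i \<noteq> \<infinity> \<and> v $ i \<noteq> -\<infinity> \<and> l $ i < v $ i)"

definition well_posed ::
  "('n1::finite, 'n2::finite, 'm::finite, 'c::finite, 'e::finite) problem \<Rightarrow> bool" where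
  "well_posed Q \<longleftrightarrow>
     admissible_bounds (lowC Q) (uppC Q) \<and> admissible_bounds (lowD Q) (uppD Q) \<and>
     C_k_on 1 (objx Q) UNIV \<and> C_k_on 1 (objy Q) UNIV"

definition \<Phi> ::
  "('n1::finite, 'n2::finite, 'm::finite, 'c::finite, 'e::finite) problem
    \<Rightarrow> (real ^ 'n1) \<times> (real ^ 'n2) \<Rightarrow> real" where
  "\<Phi> Q u = objx Q (fst u) + objy Q (snd u)"

definition bounded_by :: "real ^ 'n ^ 'i \<Rightarrow> ereal ^ 'i \<Rightarrow> ereal ^ 'i \<Rightarrow> (real ^ 'n) set" where
  "bounded_by C l v = {x. \<forall>i. l $ i \<le> ereal ((C *v x) $ i) \<and> ereal ((C *v x) $ i) \<le> v $ i}"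

definition setX ::
  "('n1::finite, 'n2::finite, 'm::finite, 'c::finite, 'e::finite) problem \<Rightarrow> (real ^ 'n1) set" where
  "setX Q = bounded_by (matC Q) (lowC Q) (uppC Q)"

definition setY ::
  "('n1::finite, 'n2::finite, 'm::finite, 'c::finite, 'e::finite) problem \<Rightarrow> (real ^ 'n2) set" where
  "setY Q = bounded_by (matD Q) (lowD Q) (uppD Q)"

definition resid ::
  "('n1::finite, 'n2::finite, 'm::finite, 'c::finite, 'e::finite) problem
    \<Rightarrow> real ^ 'n1 \<Rightarrow> real ^ 'n2 \<Rightarrow> real ^ 'm" where
  "resid Q x y = matE Q *v x + matF Q *v y - vecd Q"

definition feasible ::
  "('n1::finite, 'n2::finite, 'm::finite, 'c::finite, 'e::finite) problem
    \<Rightarrow> ((real ^ 'n1) \<times> (real ^ 'n2)) set" where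
  "feasible Q = {(x, y). x \<in> setX Q \<and> y \<in> setY Q \<and> resid Q x y \<le> 0}"

text \<open>\<open>0 \<le> p \<bottom> q \<ge> 0\<close>\<close>

definition complementary :: "real ^ 'i \<Rightarrow> real ^ 'i \<Rightarrow> bool" where
  "complementary p q \<longleftrightarrow> 0 \<le> p \<and> 0 \<le> q \<and> p \<bullet> q = 0"

text \<open>\<open>0 \<le> \<alpha> \<bottom> (C x - l) \<ge> 0\<close> and \<open>0 \<le> \<gamma> \<bottom> (v - C x) \<ge> 0\<close>, where the multiplier of an infinite
  bound is \<open>0\<close>; hence the value of \<open>real_of_ereal\<close> at an infinite bound is irrelevant.\<close>

definition box_complementary ::
  "real ^ 'n ^ 'i \<Rightarrow> ereal ^ 'i \<Rightarrow> ereal ^ 'i \<Rightarrow> real ^ 'n \<Rightarrow> real ^ 'i \<Rightarrow> real ^ 'i \<Rightarrow> bool" where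
  "box_complementary C l v x \<alpha> \<gamma> \<longleftrightarrow>
     x \<in> bounded_by C l v \<and> 0 \<le> \<alpha> \<and> 0 \<le> \<gamma> \<and>
     (\<forall>i. l $ i = -\<infinity> \<longrightarrow> \<alpha> $ i = 0) \<and> (\<forall>i. v $ i = \<infinity> \<longrightarrow> \<gamma> $ i = 0) \<and>
     (\<Sum>i\<in>UNIV. \<alpha> $ i * ((C *v x) $ i - real_of_ereal (l $ i))) = 0 \<and>
     (\<Sum>i\<in>UNIV. \<gamma> $ i * (real_of_ereal (v $ i) - (C *v x) $ i)) = 0"

definition KKT ::
  "('n1::finite, 'n2::finite, 'm::finite, 'c::finite, 'e::finite) problem
    \<Rightarrow> (real ^ 'n1) \<times> (real ^ 'n2) \<Rightarrow> real ^ 'm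
    \<Rightarrow> real ^ 'c \<Rightarrow> real ^ 'c \<Rightarrow> real ^ 'e \<Rightarrow> real ^ 'e \<Rightarrow> bool" where
  "KKT Q u \<mu> \<alpha>x \<gamma>x \<alpha>y \<gamma>y \<longleftrightarrow>
     gradient (objx Q) (fst u) + transpose (matE Q) *v \<mu> + transpose (matC Q) *v (\<gamma>x - \<alpha>x) = 0 \<and>
     gradient (objy Q) (snd u) + transpose (matF Q) *v \<mu> + transpose (matD Q) *v (\<gamma>y - \<alpha>y) = 0 \<and>
     complementary \<mu> (- resid Q (fst u) (snd u)) \<and>
     box_complementary (matC Q) (lowC Q) (uppC Q) (fst u) \<alpha>x \<gamma>x \<and>
     box_complementary (matD Q) (lowD Q) (uppD Q) (snd u) \<alpha>y \<gamma>y"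


section \<open>Active sets and the matrix of active gradients\<close>

definition act_low :: "real ^ 'n ^ 'i \<Rightarrow> ereal ^ 'i \<Rightarrow> real ^ 'n \<Rightarrow> 'i set" where
  "act_low C l x = {i. ereal ((C *v x) $ i) = l $ i}"

definition act_upp :: "real ^ 'n ^ 'i \<Rightarrow> ereal ^ 'i \<Rightarrow> real ^ 'n \<Rightarrow> 'i set" where
  "act_upp C v x = {i. ereal ((C *v x) $ i) = v $ i}"

definition actI ::
  "('n1::finite, 'n2::finite, 'm::finite, 'c::finite, 'e::finite) problem \<Rightarrow> real ^ 'n1 \<Rightarrow> 'c set" where
  "actI Q x = act_low (matC Q) (lowC Q) x \<union> act_upp (matC Q) (uppC Q) x"

definition actJ ::
  "('n1::finite, 'n2::finite, 'm::finite, 'c::finite, 'e::finite) problem \<Rightarrow> real ^ 'n2 \<Rightarrow> 'e set" where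
  "actJ Q y = act_low (matD Q) (lowD Q) y \<union> act_upp (matD Q) (uppD Q) y"

definition actS ::
  "('n1::finite, 'n2::finite, 'm::finite, 'c::finite, 'e::finite) problem
    \<Rightarrow> (real ^ 'n1) \<times> (real ^ 'n2) \<Rightarrow> 'm set" where
  "actS Q u = {i. resid Q (fst u) (snd u) $ i = 0}"

text \<open>Rows of the block matrix with block rows \<open>(E, F)\<close>, \<open>(C, 0)\<close>, \<open>(0, D)\<close>. A row selection
  \<open>R :: ('m + 'c + 'e) set\<close> is written \<open>S <+> (I <+> J)\<close>. The submatrix \<open>B\<close> of the rows in \<open>R\<close>
  is represented by the maps \<open>z \<mapsto> B z\<close> and \<open>w \<mapsto> B\<^sup>T w\<close>, where the space of vectors
  indexed by \<open>R\<close> is identified with \<open>supported R\<close>.\<close>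

fun brow ::
  "('n1::finite, 'n2::finite, 'm::finite, 'c::finite, 'e::finite) problem
    \<Rightarrow> 'm + 'c + 'e \<Rightarrow> (real ^ 'n1) \<times> (real ^ 'n2)" where
  "brow Q (Inl i) = (matE Q $ i, matF Q $ i)"
| "brow Q (Inr (Inl i)) = (matC Q $ i, 0)"
| "brow Q (Inr (Inr j)) = (0, matD Q $ j)"

definition full_row_rank ::
  "('n1::finite, 'n2::finite, 'm::finite, 'c::finite, 'e::finite) problem
    \<Rightarrow> ('m + 'c + 'e) set \<Rightarrow> bool" where
  "full_row_rank Q R \<longleftrightarrow> dim (brow Q ` R) = card R"

definition supported :: "'i set \<Rightarrow> (real ^ 'i) set" where
  "supported R = {w. \<forall>i. i \<notin> R \<longrightarrow> w $ i = 0}"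

definition Bmul ::
  "('n1::finite, 'n2::finite, 'm::finite, 'c::finite, 'e::finite) problem
    \<Rightarrow> ('m + 'c + 'e) set \<Rightarrow> (real ^ 'n1) \<times> (real ^ 'n2) \<Rightarrow> real ^ ('m + 'c + 'e)" where
  "Bmul Q R z = (\<chi> i. if i \<in> R then brow Q i \<bullet> z else 0)"

definition BTmul ::
  "('n1::finite, 'n2::finite, 'm::finite, 'c::finite, 'e::finite) problem
    \<Rightarrow> ('m + 'c + 'e) set \<Rightarrow> real ^ ('m + 'c + 'e) \<Rightarrow> (real ^ 'n1) \<times> (real ^ 'n2)" where
  "BTmul Q R w = (\<Sum>i\<in>R. w $ i *\<^sub>R brow Q i)"

text \<open>\<open>I - B\<^sup>T (B B\<^sup>T)\<^sup>-\<^sup>1 B\<close>; meaningful only if \<open>B B\<^sup>T\<close> is invertible.\<close>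

definition proj ::
  "('n1::finite, 'n2::finite, 'm::finite, 'c::finite, 'e::finite) problem
    \<Rightarrow> ('m + 'c + 'e) set \<Rightarrow> (real ^ 'n1) \<times> (real ^ 'n2) \<Rightarrow> (real ^ 'n1) \<times> (real ^ 'n2)" where
  "proj Q R z =
     z - BTmul Q R (the_inv_into (supported R) (\<lambda>w. Bmul Q R (BTmul Q R w)) (Bmul Q R z))"

definition active_rows ::
  "('n1::finite, 'n2::finite, 'm::finite, 'c::finite, 'e::finite) problem
    \<Rightarrow> (real ^ 'n1) \<times> (real ^ 'n2) \<Rightarrow> ('m + 'c + 'e) set" where
  "active_rows Q u = actS Q u <+> (actI Q (fst u) <+> actJ Q (snd u))"

text \<open>The row selection \<open>S\<^sub>*\<^sup>+, I\<^sub>*\<^sup>+, J\<^sub>*\<^sup>+\<close> of active constraints with a positive multiplier.\<close>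

definition strongly_active_rows ::
  "('n1::finite, 'n2::finite, 'm::finite, 'c::finite, 'e::finite) problem
    \<Rightarrow> (real ^ 'n1) \<times> (real ^ 'n2) \<Rightarrow> real ^ 'm
    \<Rightarrow> real ^ 'c \<Rightarrow> real ^ 'c \<Rightarrow> real ^ 'e \<Rightarrow> real ^ 'e \<Rightarrow> ('m + 'c + 'e) set" where
  "strongly_active_rows Q u \<mu> \<alpha>x \<gamma>x \<alpha>y \<gamma>y =
     {i \<in> actS Q u. 0 < \<mu> $ i} <+>
     (({i \<in> act_low (matC Q) (lowC Q) (fst u). 0 < \<alpha>x $ i} \<union>
       {i \<in> act_upp (matC Q) (uppC Q) (fst u). 0 < \<gamma>x $ i}) <+>
      ({j \<in> act_low (matD Q) (lowD Q) (snd u). 0 < \<alpha>y $ j} \<union>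
       {j \<in> act_upp (matD Q) (uppD Q) (snd u). 0 < \<gamma>y $ j}))"

definition second_order_condition ::
  "('n1::finite, 'n2::finite, 'm::finite, 'c::finite, 'e::finite) problem
    \<Rightarrow> (real ^ 'n1) \<times> (real ^ 'n2) \<Rightarrow> real ^ 'm
    \<Rightarrow> real ^ 'c \<Rightarrow> real ^ 'c \<Rightarrow> real ^ 'e \<Rightarrow> real ^ 'e \<Rightarrow> bool" where
  "second_order_condition Q u \<mu> \<alpha>x \<gamma>x \<alpha>y \<gamma>y \<longleftrightarrow>
     (\<forall>z. z \<noteq> 0 \<and> Bmul Q (strongly_active_rows Q u \<mu> \<alpha>x \<gamma>x \<alpha>y \<gamma>y) z = 0
        \<longrightarrow> 0 < z \<bullet> hessian (\<Phi> Q) u z)"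

definition strict_complementarity ::
  "('n1::finite, 'n2::finite, 'm::finite, 'c::finite, 'e::finite) problem
    \<Rightarrow> (real ^ 'n1) \<times> (real ^ 'n2) \<Rightarrow> real ^ 'm
    \<Rightarrow> real ^ 'c \<Rightarrow> real ^ 'c \<Rightarrow> real ^ 'e \<Rightarrow> real ^ 'e \<Rightarrow> bool" where
  "strict_complementarity Q u \<mu> \<alpha>x \<gamma>x \<alpha>y \<gamma>y \<longleftrightarrow>
     (\<forall>i \<in> act_low (matC Q) (lowC Q) (fst u). 0 < \<alpha>x $ i) \<and>
     (\<forall>i \<in> act_upp (matC Q) (uppC Q) (fst u). 0 < \<gamma>x $ i) \<and>
     (\<forall>j \<in> act_low (matD Q) (lowD Q) (snd u). 0 < \<alpha>y $ j) \<and>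
     (\<forall>j \<in> act_upp (matD Q) (uppD Q) (snd u). 0 < \<gamma>y $ j) \<and>
     (\<forall>i \<in> actS Q u. 0 < \<mu> $ i)"


section \<open>The CFD-SQO method without equality constraints, parameter \<open>c = 1\<close>\<close>

definition sym_pos_def :: "real ^ 'n ^ 'n \<Rightarrow> bool" where
  "sym_pos_def H \<longleftrightarrow> transpose H = H \<and> (\<forall>z. z \<noteq> 0 \<longrightarrow> 0 < z \<bullet> (H *v z))"

definition block_diag ::
  "real ^ 'n1 ^ 'n1 \<Rightarrow> real ^ 'n2 ^ 'n2 \<Rightarrow> (real ^ 'n1) \<times> (real ^ 'n2) \<Rightarrow> (real ^ 'n1) \<times> (real ^ 'n2)"
  where
  "block_diag A B z = (A *v fst z, B *v snd z)"

definition quad_model :: "real ^ 'n \<Rightarrow> real ^ 'n ^ 'n \<Rightarrow> real ^ 'n \<Rightarrow> real ^ 'n \<Rightarrow> real" where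
  "quad_model g H x0 x = g \<bullet> (x - x0) + 1 / 2 * ((x - x0) \<bullet> (H *v (x - x0)))"

text \<open>One of the two subproblems of Step 1: \<open>x\<close> minimizes the quadratic model at \<open>x0\<close> subject to
  \<open>A x + c \<le> b\<close>, \<open>l \<le> C x \<le> v\<close>, with KKT multipliers \<open>\<mu>, \<alpha>, \<gamma>\<close>.\<close>

definition block_qp ::
  "real ^ 'n \<Rightarrow> real ^ 'n ^ 'n \<Rightarrow> real ^ 'n \<Rightarrow> real ^ 'n ^ 'm \<Rightarrow> real ^ 'm \<Rightarrow> real ^ 'm
    \<Rightarrow> real ^ 'n ^ 'i \<Rightarrow> ereal ^ 'i \<Rightarrow> ereal ^ 'i
    \<Rightarrow> real ^ 'n \<Rightarrow> real ^ 'm \<Rightarrow> real ^ 'i \<Rightarrow> real ^ 'i \<Rightarrow> bool" where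
  "block_qp g H x0 A c b C l v x \<mu> \<alpha> \<gamma> \<longleftrightarrow>
     is_arg_min (quad_model g H x0) (\<lambda>x. A *v x + c \<le> b \<and> x \<in> bounded_by C l v) x \<and>
     g + H *v (x - x0) + transpose A *v \<mu> + transpose C *v (\<gamma> - \<alpha>) = 0 \<and>
     complementary \<mu> (b - (A *v x + c)) \<and>
     box_complementary C l v x \<alpha> \<gamma>"

definition step1_x ::
  "('n1::finite, 'n2::finite, 'm::finite, 'c::finite, 'e::finite) problem
    \<Rightarrow> (real ^ 'n1) \<times> (real ^ 'n2) \<Rightarrow> real ^ 'n1 ^ 'n1
    \<Rightarrow> real ^ 'n1 \<Rightarrow> real ^ 'm \<Rightarrow> real ^ 'c \<Rightarrow> real ^ 'c \<Rightarrow> bool" where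
  "step1_x Q u Hx xt \<mu> \<alpha> \<gamma> \<longleftrightarrow>
     block_qp (gradient (objx Q) (fst u)) Hx (fst u)
       (matE Q) (matF Q *v snd u - vecd Q) ((1 / 2) *\<^sub>R resid Q (fst u) (snd u))
       (matC Q) (lowC Q) (uppC Q) xt \<mu> \<alpha> \<gamma>"

definition step1_y ::
  "('n1::finite, 'n2::finite, 'm::finite, 'c::finite, 'e::finite) problem
    \<Rightarrow> (real ^ 'n1) \<times> (real ^ 'n2) \<Rightarrow> real ^ 'n2 ^ 'n2
    \<Rightarrow> real ^ 'n2 \<Rightarrow> real ^ 'm \<Rightarrow> real ^ 'e \<Rightarrow> real ^ 'e \<Rightarrow> bool" where
  "step1_y Q u Hy yt \<mu> \<alpha> \<gamma> \<longleftrightarrow>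
     block_qp (gradient (objy Q) (snd u)) Hy (snd u)
       (matF Q) (matE Q *v fst u - vecd Q) ((1 / 2) *\<^sub>R resid Q (fst u) (snd u))
       (matD Q) (lowD Q) (uppD Q) yt \<mu> \<alpha> \<gamma>"

definition step3 ::
  "('n1::finite, 'n2::finite, 'm::finite, 'c::finite, 'e::finite) problem
    \<Rightarrow> (real ^ 'n1) \<times> (real ^ 'n2) \<Rightarrow> real ^ 'n1 ^ 'n1 \<Rightarrow> real ^ 'n2 ^ 'n2
    \<Rightarrow> (real ^ 'n1) \<times> (real ^ 'n2) \<Rightarrow> real ^ 'm
    \<Rightarrow> real ^ 'c \<Rightarrow> real ^ 'c \<Rightarrow> real ^ 'e \<Rightarrow> real ^ 'e \<Rightarrow> bool" where
  "step3 Q u Hx Hy ut \<mu> \<alpha>x \<gamma>x \<alpha>y \<gamma>y \<longleftrightarrow>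
     is_arg_min
       (\<lambda>w. quad_model (gradient (objx Q) (fst u)) Hx (fst u) (fst w)
          + quad_model (gradient (objy Q) (snd u)) Hy (snd u) (snd w))
       (\<lambda>w. w \<in> feasible Q) ut \<and>
     gradient (objx Q) (fst u) + Hx *v (fst ut - fst u)
       + transpose (matE Q) *v \<mu> + transpose (matC Q) *v (\<gamma>x - \<alpha>x) = 0 \<and>
     gradient (objy Q) (snd u) + Hy *v (snd ut - snd u)
       + transpose (matF Q) *v \<mu> + transpose (matD Q) *v (\<gamma>y - \<alpha>y) = 0 \<and>
     complementary \<mu> (- resid Q (fst ut) (snd ut)) \<and>
     box_complementary (matC Q) (lowC Q) (uppC Q) (fst ut) \<alpha>x \<gamma>x \<and>
     box_complementary (matD Q) (lowD Q) (uppD Q) (snd ut) \<alpha>y \<gamma>y"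

text \<open>Which step the final trial point of an iteration comes from.\<close>

datatype origin = Step1 | Step3

text \<open>Steps 1 to 3 at \<open>u\<close>, resulting in the trial point \<open>ut\<close>. Multipliers of the subproblems
  need not be unique; any choice may be the one used in the test of Step 2.\<close>

definition trial_point ::
  "('n1::finite, 'n2::finite, 'm::finite, 'c::finite, 'e::finite) problem
    \<Rightarrow> real \<Rightarrow> real \<Rightarrow> real \<Rightarrow> (real ^ 'n1) \<times> (real ^ 'n2) \<Rightarrow> real ^ 'n1 ^ 'n1 \<Rightarrow> real ^ 'n2 ^ 'n2
    \<Rightarrow> origin \<Rightarrow> (real ^ 'n1) \<times> (real ^ 'n2) \<Rightarrow> bool" where
  "trial_point Q \<tau>1 M M1 u Hx Hy orig ut \<longleftrightarrow>
     (\<exists>xt yt \<mu>x \<alpha>x \<gamma>x \<mu>y \<alpha>y \<gamma>y.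
        step1_x Q u Hx xt \<mu>x \<alpha>x \<gamma>x \<and> step1_y Q u Hy yt \<mu>y \<alpha>y \<gamma>y \<and>
        (if min (norm \<mu>x) (norm \<mu>y) \<le> M \<and> norm (\<mu>x - \<mu>y) \<le> M1 * norm ((xt, yt) - u) powr \<tau>1
         then orig = Step1 \<and> ut = (xt, yt)
         else orig = Step3 \<and> (\<exists>\<mu> \<alpha>x' \<gamma>x' \<alpha>y' \<gamma>y'. step3 Q u Hx Hy ut \<mu> \<alpha>x' \<gamma>x' \<alpha>y' \<gamma>y')))"

definition armijo_steps ::
  "('n1::finite, 'n2::finite, 'm::finite, 'c::finite, 'e::finite) problem
    \<Rightarrow> real \<Rightarrow> real \<Rightarrow> (real ^ 'n1) \<times> (real ^ 'n2) \<Rightarrow> real ^ 'n1 ^ 'n1 \<Rightarrow> real ^ 'n2 ^ 'n2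
    \<Rightarrow> (real ^ 'n1) \<times> (real ^ 'n2) \<Rightarrow> real set" where
  "armijo_steps Q \<rho> \<sigma> u Hx Hy du =
     {t \<in> range (\<lambda>i::nat. \<sigma> ^ i).
        \<Phi> Q (u + t *\<^sub>R du) \<le> \<Phi> Q u - \<rho> * t * (du \<bullet> block_diag Hx Hy du)}"

text \<open>An infinite run: \<open>ut k\<close> is the trial point of iteration \<open>k\<close> and \<open>orig k\<close> its origin. The
  method stops as soon as \<open>u (Suc k) = u k\<close>, so this never happens in an infinite run.\<close>

definition generates ::
  "('n1::finite, 'n2::finite, 'm::finite, 'c::finite, 'e::finite) problem
    \<Rightarrow> real \<Rightarrow> real \<Rightarrow> real \<Rightarrow> real \<Rightarrow> real
    \<Rightarrow> (nat \<Rightarrow> (real ^ 'n1) \<times> (real ^ 'n2)) \<Rightarrow> (nat \<Rightarrow> real ^ 'n1 ^ 'n1) \<Rightarrow> (nat \<Rightarrow> real ^ 'n2 ^ 'n2)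
    \<Rightarrow> (nat \<Rightarrow> origin) \<Rightarrow> (nat \<Rightarrow> (real ^ 'n1) \<times> (real ^ 'n2)) \<Rightarrow> bool" where
  "generates Q \<rho> \<sigma> \<tau>1 M M1 u Hx Hy orig ut \<longleftrightarrow>
     u 0 \<in> feasible Q \<and>
     (\<forall>k. sym_pos_def (Hx k) \<and> sym_pos_def (Hy k) \<and>
          trial_point Q \<tau>1 M M1 (u k) (Hx k) (Hy k) (orig k) (ut k) \<and>
          (\<exists>t \<in> armijo_steps Q \<rho> \<sigma> (u k) (Hx k) (Hy k) (ut k - u k).
             (\<forall>t' \<in> armijo_steps Q \<rho> \<sigma> (u k) (Hx k) (Hy k) (ut k - u k). t' \<le> t) \<and>
             u (Suc k) = u k + t *\<^sub>R (ut k - u k)) \<and>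
          u (Suc k) \<noteq> u k)"

text \<open>The rows of the matrix defining the projection \<open>P\<^sub>k\<close>, in terms of the iterate \<open>u\<close> and the
  trial point \<open>ut\<close>.\<close>

definition trial_actS ::
  "('n1::finite, 'n2::finite, 'm::finite, 'c::finite, 'e::finite) problem
    \<Rightarrow> origin \<Rightarrow> (real ^ 'n1) \<times> (real ^ 'n2) \<Rightarrow> (real ^ 'n1) \<times> (real ^ 'n2) \<Rightarrow> 'm set" where
  "trial_actS Q orig u ut =
     (case orig of
        Step1 \<Rightarrow> {i. (resid Q (fst ut) (snd u) - (1 / 2) *\<^sub>R resid Q (fst u) (snd u)) $ i = 0} \<inter>
                 {i. (resid Q (fst u) (snd ut) - (1 / 2) *\<^sub>R resid Q (fst u) (snd u)) $ i = 0}
      | Step3 \<Rightarrow> {i. resid Q (fst ut) (snd ut) $ i = 0})"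

definition trial_rows ::
  "('n1::finite, 'n2::finite, 'm::finite, 'c::finite, 'e::finite) problem
    \<Rightarrow> origin \<Rightarrow> (real ^ 'n1) \<times> (real ^ 'n2) \<Rightarrow> (real ^ 'n1) \<times> (real ^ 'n2) \<Rightarrow> ('m + 'c + 'e) set" where
  "trial_rows Q orig u ut = trial_actS Q orig u ut <+> (actI Q (fst ut) <+> actJ Q (snd ut))"

definition accumulation_point :: "(nat \<Rightarrow> 'a::topological_space) \<Rightarrow> 'a \<Rightarrow> bool" where
  "accumulation_point u p \<longleftrightarrow> (\<exists>r. strict_mono r \<and> (u \<circ> r) \<longlonglongrightarrow> p)"

end

theory Submission
  imports Defs
begin

text \<open>All constraints are rows \<open>lo i \<le> b i \<bullet> z \<le> up i\<close> with signed multipliers \<open>w\<close>: \<open>w i > 0\<close> forces the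
  upper and \<open>w i < 0\<close> the lower bound to be active. At every iteration there is such a \<open>w\<close> at the trial
  point with \<open>\<nabla>\<Phi>(u) + H d + B\<^sup>T w = O(\<parallel>d\<parallel>\<^sup>2)\<close>. For Step 3 it is exact; for Step 1 one takes the componentwise
  minimum of the two multipliers, and the test of Step 2 with \<open>\<tau>1 \<ge> 2\<close> bounds the error.

  The line search gives \<open>d \<rightarrow> 0\<close>. Full row rank makes the multipliers converge along convergent
  subsequences, so accumulation points are KKT points. Full row rank and the second order condition
  give a local error bound \<open>\<parallel>z - p\<parallel> \<le> C \<parallel>\<nabla>\<Phi>(z) + B\<^sup>T w\<parallel>\<close> at such a point \<open>p\<close>. Applied at the trial points
  it first yields convergence of the whole sequence. The Hessian condition says
  \<open>(H - \<nabla>\<^sup>2\<Phi>(u)) d = B\<^sup>T \<nu> + O(\<parallel>d\<parallel>\<^sup>2)\<close>, where \<open>\<nu> = O(\<parallel>d\<parallel>)\<close> vanishes off the strongly active rows (\<open>\<nu> = 0\<close> in the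
  first alternative), so that \<open>w + s \<nu>\<close> for \<open>0 \<le> s \<le> 1\<close> is again an admissible multiplier. With \<open>s = 1/2\<close> this
  shows that the unit step is accepted, and with \<open>s = 1\<close> the residual at the trial point is
  \<open>O(\<parallel>d\<parallel>\<^sup>2)\<close>, whence the error bound gives quadratic convergence.\<close>

section \<open>Second order smoothness\<close>

lemma C_k_on_Suc_imp: "C_k_on (Suc k) f S \<Longrightarrow> C_k_on k f S"
proof (induction k arbitrary: f)
  case 0
  then show ?case
    by (auto intro!: continuous_at_imp_continuous_on differentiable_imp_continuous_within)
next
  case (Suc k)
  from Suc.prems have 1: "\<forall>x\<in>S. f differentiable at x"
    and 2: "\<And>b. b \<in> Basis \<Longrightarrow> C_k_on (Suc k) (\<lambda>x. frechet_derivative f (at x) b) S"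
    by (simp_all only: C_k_on.simps(2)) blast+
  show ?case
    unfolding C_k_on.simps(2)[of k f] using 1 Suc.IH[OF 2] by blast
qed

lemma frechet_derivative_basis_expansion:
  fixes f :: "'a::euclidean_space \<Rightarrow> 'b::real_normed_vector"
  assumes "f differentiable at x"
  shows "frechet_derivative f (at x) h = (\<Sum>b\<in>Basis. (h \<bullet> b) *\<^sub>R frechet_derivative f (at x) b)"
proof -
  interpret linear "frechet_derivative f (at x)"
    by (rule linear_frechet_derivative[OF assms])
  have "frechet_derivative f (at x) h = frechet_derivative f (at x) (\<Sum>b\<in>Basis. (h \<bullet> b) *\<^sub>R b)"
    by (simp add: euclidean_representation)
  also have "\<dots> = (\<Sum>b\<in>Basis. (h \<bullet> b) *\<^sub>R frechet_derivative f (at x) b)"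
    by (simp only: sum scaleR)
  finally show ?thesis .
qed

lemma gradient_eq:
  fixes f :: "'a::euclidean_space \<Rightarrow> real"
  assumes "(f has_derivative (\<lambda>h. g \<bullet> h)) (at x)"
  shows "gradient f x = g"
  unfolding gradient_def gderiv_def
proof (rule the_equality)
  show "(f has_derivative (\<lambda>h. h \<bullet> g)) (at x)"
    using assms by (simp add: inner_commute)
  fix g' assume "(f has_derivative (\<lambda>h. h \<bullet> g')) (at x)"
  from has_derivative_unique[OF this assms] have "\<And>h. h \<bullet> g' = h \<bullet> g"
    by (simp add: fun_eq_iff inner_commute)
  then show "g' = g" by (subst vector_eq_rdot[symmetric]) (auto simp: inner_commute)
qed

lemma
  fixes f :: "'a::euclidean_space \<Rightarrow> real"
  assumes "f differentiable at x"
  shows gradient_expansion: "gradient f x = (\<Sum>b\<in>Basis. frechet_derivative f (at x) b *\<^sub>R b)"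
    and has_derivative_gradient: "(f has_derivative (\<lambda>h. gradient f x \<bullet> h)) (at x)"
proof -
  let ?g = "\<Sum>b\<in>Basis. frechet_derivative f (at x) b *\<^sub>R b"
  have "frechet_derivative f (at x) = (\<lambda>h. ?g \<bullet> h)"
  proof
    fix h show "frechet_derivative f (at x) h = ?g \<bullet> h"
      by (subst frechet_derivative_basis_expansion[OF assms])
        (simp add: inner_sum_left inner_commute[of h] mult.commute)
  qed
  then have D: "(f has_derivative (\<lambda>h. ?g \<bullet> h)) (at x)"
    using assms by (simp add: frechet_derivative_works)
  show "gradient f x = ?g" by (rule gradient_eq[OF D])
  with D show "(f has_derivative (\<lambda>h. gradient f x \<bullet> h)) (at x)" by simp
qed

text \<open>Continuous partial derivatives are bounded on a compact ball, and the mean value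
  inequality turns the resulting bound on the derivative into a Lipschitz bound. The radius is
  quantified by \<open>eventually\<close> along \<open>at_right 0\<close>, so that such statements
  for finitely many functions can be intersected.\<close>

lemma C1_locally_Lipschitz:
  fixes q :: "'a::euclidean_space \<Rightarrow> real"
  assumes "C_k_on 1 q U" "open U" "p \<in> U"
  shows "\<exists>L. eventually (\<lambda>r. \<forall>x\<in>cball p r.
      (\<forall>h. \<bar>frechet_derivative q (at x) h\<bar> \<le> L * norm h) \<and>
      (\<forall>z\<in>cball p r. \<bar>q z - q x\<bar> \<le> L * norm (z - x))) (at_right 0)"
proof -
  obtain r where r: "r > 0" "cball p r \<subseteq> U"
    using assms(2,3) open_contains_cball by blast
  have diff: "\<And>x. x \<in> U \<Longrightarrow> q differentiable at x"
    and cont: "\<And>b. b \<in> Basis \<Longrightarrow> continuous_on U (\<lambda>x. frechet_derivative q (at x) b)"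
    using assms(1) by auto
  have "\<exists>B. \<forall>x\<in>cball p r. \<bar>frechet_derivative q (at x) b\<bar> \<le> B" if "b \<in> Basis" for b
  proof -
    have "compact ((\<lambda>x. frechet_derivative q (at x) b) ` cball p r)"
      by (intro compact_continuous_image continuous_on_subset[OF cont[OF that] r(2)]) simp
    from compact_imp_bounded[OF this] show ?thesis
      by (auto simp: bounded_iff)
  qed
  then obtain B where B: "\<And>b x. b \<in> Basis \<Longrightarrow> x \<in> cball p r \<Longrightarrow>
      \<bar>frechet_derivative q (at x) b\<bar> \<le> B b" by metis
  define L where "L = (\<Sum>b\<in>Basis. B b)"
  have bd: "\<bar>frechet_derivative q (at x) h\<bar> \<le> L * norm h" if x: "x \<in> cball p r" for x h
  proof -
    have "\<bar>frechet_derivative q (at x) h\<bar> \<le> (\<Sum>b\<in>Basis. \<bar>(h \<bullet> b) *\<^sub>R frechet_derivative q (at x) b\<bar>)"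
      by (subst frechet_derivative_basis_expansion[OF diff]) (use x r(2) in \<open>auto intro: sum_abs\<close>)
    also have "\<dots> \<le> (\<Sum>b\<in>Basis. norm h * B b)"
    proof (rule sum_mono)
      fix b :: 'a assume b: "b \<in> Basis"
      show "\<bar>(h \<bullet> b) *\<^sub>R frechet_derivative q (at x) b\<bar> \<le> norm h * B b"
        using B[OF b x] Basis_le_norm[OF b, of h] by (simp add: abs_mult mult_mono)
    qed
    also have "\<dots> = L * norm h" by (simp add: L_def sum_distrib_left mult.commute)
    finally show ?thesis .
  qed
  have lip: "\<bar>q z - q x\<bar> \<le> L * norm (z - x)" if "x \<in> cball p r" "z \<in> cball p r" for x z
  proof -
    have "norm (q z - q x) \<le> L * norm (z - x)"
    proof (rule differentiable_bound[OF convex_cball])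
      fix y assume y: "y \<in> cball p r"
      show "(q has_derivative frechet_derivative q (at y)) (at y within cball p r)"
        using diff y r(2) by (meson frechet_derivative_works has_derivative_at_withinI subsetD)
      show "onorm (frechet_derivative q (at y)) \<le> L"
        by (rule onorm_le) (use bd[OF y] in \<open>simp\<close>)
    qed (use that in auto)
    then show ?thesis by simp
  qed
  have "eventually (\<lambda>s. s < r) (at_right (0::real))"
    using r(1) eventually_at_right_field by blast
  then show ?thesis
    by (intro exI[of _ L], elim eventually_mono) (use bd lip in force)
qed

text \<open>Each partial derivative is locally Lipschitz by \<open>C1_locally_Lipschitz\<close>,
  hence so is the derivative, and this bounds the remainder of the linearisation quadratically. The
  base point \<open>x\<close> varies as well, because later expansions are taken at the iterates and
  not at their limit.\<close>

lemma C2_Taylor: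
  fixes g :: "'a::euclidean_space \<Rightarrow> real"
  assumes "C_k_on 2 g U" "open U" "p \<in> U"
  shows "\<exists>L. eventually (\<lambda>r. \<forall>x\<in>cball p r.
      (\<forall>h. \<bar>frechet_derivative g (at x) h\<bar> \<le> L * norm h) \<and>
      (\<forall>z\<in>cball p r. \<bar>g z - g x - frechet_derivative g (at x) (z - x)\<bar> \<le> L * (norm (z - x))\<^sup>2)) (at_right 0)"
proof -
  have C1: "C_k_on 1 g U"
    using C_k_on_Suc_imp[of 1 g U] assms(1) by (simp add: numeral_2_eq_2)
  have diff: "\<And>x. x \<in> U \<Longrightarrow> g differentiable at x"
    and pC1: "\<And>b. b \<in> Basis \<Longrightarrow> C_k_on 1 (\<lambda>x. frechet_derivative g (at x) b) U"
    using assms(1) by (auto simp: numeral_2_eq_2)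
  obtain L0 where L0: "eventually (\<lambda>r. \<forall>x\<in>cball p r.
      (\<forall>h. \<bar>frechet_derivative g (at x) h\<bar> \<le> L0 * norm h)) (at_right 0)"
    using C1_locally_Lipschitz[OF C1 assms(2,3)] by (smt (verit, best) eventually_mono)
  let ?P = "\<lambda>b L. eventually (\<lambda>r. \<forall>x\<in>cball p r. \<forall>z\<in>cball p r.
      \<bar>frechet_derivative g (at z) b - frechet_derivative g (at x) b\<bar> \<le> L * norm (z - x)) (at_right 0)"
  have "\<forall>b\<in>Basis. \<exists>L. ?P b L"
    using C1_locally_Lipschitz[OF pC1 assms(2,3)] by (fast elim: eventually_mono)
  from bchoice[OF this] obtain B where B: "\<forall>b\<in>Basis. ?P b (B b)" ..
  define K where "K = (\<Sum>b\<in>Basis. \<bar>B b\<bar>)"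
  define L where "L = max L0 K"
  have K0: "K \<ge> 0" by (simp add: K_def sum_nonneg)
  have "eventually (\<lambda>r. \<forall>b\<in>Basis. \<forall>x\<in>cball p r. \<forall>z\<in>cball p r.
      \<bar>frechet_derivative g (at z) b - frechet_derivative g (at x) b\<bar> \<le> B b * norm (z - x)) (at_right 0)"
    using B by (subst eventually_ball_finite_distrib) simp_all
  moreover obtain r0 where r0: "r0 > 0" "cball p r0 \<subseteq> U"
    using assms(2,3) open_contains_cball by blast
  moreover have "eventually (\<lambda>s. s < r0) (at_right (0::real))"
    using r0(1) eventually_at_right_field by blast
  ultimately have "eventually (\<lambda>r. (\<forall>b\<in>Basis. \<forall>x\<in>cball p r. \<forall>z\<in>cball p r.
      \<bar>frechet_derivative g (at z) b - frechet_derivative g (at x) b\<bar> \<le> B b * norm (z - x)) \<and> r < r0 \<and>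
      (\<forall>x\<in>cball p r. (\<forall>h. \<bar>frechet_derivative g (at x) h\<bar> \<le> L0 * norm h))) (at_right 0)"
    using L0 by (simp add: eventually_conj_iff)
  then show ?thesis
  proof (intro exI[of _ L], elim eventually_mono, intro ballI conjI allI, goal_cases)
    case (1 r x h)
    then have "\<bar>frechet_derivative g (at x) h\<bar> \<le> L0 * norm h" by blast
    also have "\<dots> \<le> L * norm h" by (simp add: L_def mult_right_mono)
    finally show ?case .
  next
    case (2 r x z)
    have x2: "x \<in> cball p r" using 2 by blast
    have xU: "y \<in> U" if "y \<in> cball p r" for y using 2 that r0(2) by auto
    have ineq: "\<bar>frechet_derivative g (at y) h - frechet_derivative g (at x) h\<bar> \<le> K * norm (y - x) * norm h"
      if y: "y \<in> cball p r" for y h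
    proof -
      have "frechet_derivative g (at y) h - frechet_derivative g (at x) h =
        (\<Sum>b\<in>Basis. (h \<bullet> b) *\<^sub>R (frechet_derivative g (at y) b - frechet_derivative g (at x) b))"
        using frechet_derivative_basis_expansion[OF diff[OF xU[OF y]], of h]
          frechet_derivative_basis_expansion[OF diff[OF xU[OF x2]], of h]
        by (simp add: sum_subtractf sum.distrib algebra_simps)
      also have "\<bar>\<dots>\<bar> \<le> (\<Sum>b\<in>Basis. \<bar>(h \<bullet> b) *\<^sub>R (frechet_derivative g (at y) b - frechet_derivative g (at x) b)\<bar>)"
        by (rule sum_abs)
      also have "\<dots> \<le> (\<Sum>b\<in>Basis. norm h * (\<bar>B b\<bar> * norm (y - x)))"
      proof (rule sum_mono)
        fix b :: 'a assume b: "b \<in> Basis"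
        have "\<bar>frechet_derivative g (at y) b - frechet_derivative g (at x) b\<bar> \<le> B b * norm (y - x)"
          using 2 b y by blast
        also have "\<dots> \<le> \<bar>B b\<bar> * norm (y - x)" by (simp add: mult_right_mono)
        finally show "\<bar>(h \<bullet> b) *\<^sub>R (frechet_derivative g (at y) b - frechet_derivative g (at x) b)\<bar>
            \<le> norm h * (\<bar>B b\<bar> * norm (y - x))"
          using Basis_le_norm[OF b, of h] by (simp add: abs_mult mult_mono)
      qed
      also have "\<dots> = K * norm (y - x) * norm h"
        by (simp add: K_def sum_distrib_left sum_distrib_right mult_ac)
      finally show ?thesis .
    qed
    \<comment> \<open>The mean value inequality is applied to \<open>g\<close> minus its
      linearisation at \<open>x\<close>, whose derivative at \<open>y\<close> is the difference
      bounded in \<open>ineq\<close>.\<close>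
    let ?\<phi> = "\<lambda>y. g y - frechet_derivative g (at x) (y - x)"
    have seg: "closed_segment x z \<subseteq> cball p r"
      using 2 by (intro closed_segment_subset) auto
    have lin: "bounded_linear (frechet_derivative g (at x))"
      using diff[OF xU[OF x2]] frechet_derivative_works has_derivative_bounded_linear by blast
    have "norm (?\<phi> z - ?\<phi> x) \<le> (K * norm (z - x)) * norm (z - x)"
    proof (rule differentiable_bound[OF convex_closed_segment[of x z]])
      fix y assume y: "y \<in> closed_segment x z"
      show "(?\<phi> has_derivative (\<lambda>h. frechet_derivative g (at y) h - frechet_derivative g (at x) h))
          (at y within closed_segment x z)"
      proof (rule has_derivative_diff)
        show "(g has_derivative frechet_derivative g (at y)) (at y within closed_segment x z)"
          using diff xU y seg by (meson frechet_derivative_works has_derivative_at_withinI subsetD)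
        show "((\<lambda>y. frechet_derivative g (at x) (y - x)) has_derivative frechet_derivative g (at x)) (at y within closed_segment x z)"
          by (rule bounded_linear.has_derivative[OF lin]) (auto intro!: derivative_eq_intros)
      qed
      show "onorm (\<lambda>h. frechet_derivative g (at y) h - frechet_derivative g (at x) h) \<le> K * norm (z - x)"
      proof (rule onorm_le)
        fix h
        have "norm (frechet_derivative g (at y) h - frechet_derivative g (at x) h) \<le> K * norm (y - x) * norm h"
          using ineq[of y h] y seg by auto
        also have "\<dots> \<le> K * norm (z - x) * norm h"
          using K0 segment_bound(1)[OF y] by (simp add: mult_left_mono mult_right_mono)
        finally show "norm (frechet_derivative g (at y) h - frechet_derivative g (at x) h) \<le> K * norm (z - x) * norm h" .
      qed
    qed auto
    then have "\<bar>g z - g x - frechet_derivative g (at x) (z - x)\<bar> \<le> K * (norm (z - x))\<^sup>2"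
      using linear_simps(3)[OF lin] by (simp add: power2_eq_square algebra_simps)
    also have "\<dots> \<le> L * (norm (z - x))\<^sup>2" by (simp add: L_def mult_right_mono)
    finally show ?case .
  qed
qed

text \<open>The part of the smoothness assumption that the convergence proof uses, with
  \<open>G\<close> a gradient and \<open>A\<close> its Hessian. One constant serves all base points
  near \<open>p\<close>, and keeping all small radii lets two such statements be combined for a pair
  of maps.\<close>

definition second_order_at :: "('a::real_normed_vector \<Rightarrow> 'a) \<Rightarrow> ('a \<Rightarrow> 'a \<Rightarrow> 'a) \<Rightarrow> 'a \<Rightarrow> bool" where
  "second_order_at G A p \<longleftrightarrow> (\<exists>L. eventually (\<lambda>r. \<forall>x\<in>cball p r.
      (G has_derivative A x) (at x) \<and>
      (\<forall>h. norm (A x h) \<le> L * norm h) \<and>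
      (\<forall>z\<in>cball p r. norm (G z - G x - A x (z - x)) \<le> L * (norm (z - x))\<^sup>2)) (at_right 0))"

text \<open>The components of the gradient are partial derivatives, to which
  \<open>C2_Taylor\<close> applies; the sum of their constants serves for the whole vector.\<close>

lemma second_order_at_gradient:
  fixes f :: "'a::euclidean_space \<Rightarrow> real"
  assumes f: "C_k_on 3 f U" and U: "open U" "p \<in> U"
  shows "second_order_at (gradient f) (hessian f) p"
proof -
  let ?q = "\<lambda>b x. frechet_derivative f (at x) b"
  have diff: "\<And>x. x \<in> U \<Longrightarrow> f differentiable at x"
    and C2: "\<And>b. b \<in> Basis \<Longrightarrow> C_k_on 2 (?q b) U"
    using f by (auto simp: numeral_3_eq_3 numeral_2_eq_2)
  have qdiff: "\<And>b x. b \<in> Basis \<Longrightarrow> x \<in> U \<Longrightarrow> ?q b differentiable at x"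
    using C2 by (auto simp: numeral_2_eq_2)
  have G: "gradient f x = (\<Sum>b\<in>Basis. ?q b x *\<^sub>R b)" if "x \<in> U" for x
    by (rule gradient_expansion[OF diff[OF that]])
  let ?A = "\<lambda>x h. \<Sum>b\<in>Basis. frechet_derivative (?q b) (at x) h *\<^sub>R b"
  have D: "(gradient f has_derivative ?A x) (at x)" if x: "x \<in> U" for x
  proof (rule has_derivative_transform_within_open[OF _ U(1) x])
    show "((\<lambda>x. \<Sum>b\<in>Basis. ?q b x *\<^sub>R b) has_derivative ?A x) (at x)"
      by (intro has_derivative_sum has_derivative_scaleR_left)
        (use qdiff x in \<open>simp add: frechet_derivative_works\<close>)
  qed (simp add: G)
  have A: "hessian f x = ?A x" if "x \<in> U" for x
    unfolding hessian_def using frechet_derivative_at[OF D[OF that]] by simp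
  let ?P = "\<lambda>b L. eventually (\<lambda>r. \<forall>x\<in>cball p r.
      (\<forall>h. \<bar>frechet_derivative (?q b) (at x) h\<bar> \<le> L * norm h) \<and>
      (\<forall>z\<in>cball p r. \<bar>?q b z - ?q b x - frechet_derivative (?q b) (at x) (z - x)\<bar> \<le> L * (norm (z - x))\<^sup>2)) (at_right 0)"
  have "\<forall>b\<in>Basis. \<exists>L. ?P b L"
    using C2_Taylor[OF C2 U] by blast
  from bchoice[OF this] obtain L where L: "\<forall>b\<in>Basis. ?P b (L b)" ..
  have "eventually (\<lambda>r. \<forall>b\<in>Basis. \<forall>x\<in>cball p r.
      (\<forall>h. \<bar>frechet_derivative (?q b) (at x) h\<bar> \<le> L b * norm h) \<and>
      (\<forall>z\<in>cball p r. \<bar>?q b z - ?q b x - frechet_derivative (?q b) (at x) (z - x)\<bar> \<le> L b * (norm (z - x))\<^sup>2)) (at_right 0)"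
    using L by (subst eventually_ball_finite_distrib) simp_all
  moreover obtain r0 where r0: "r0 > 0" "cball p r0 \<subseteq> U"
    using U open_contains_cball by blast
  moreover have "eventually (\<lambda>s. s < r0) (at_right (0::real))"
    using r0(1) eventually_at_right_field by blast
  ultimately have ev: "eventually (\<lambda>r. (\<forall>b\<in>Basis. \<forall>x\<in>cball p r.
      (\<forall>h. \<bar>frechet_derivative (?q b) (at x) h\<bar> \<le> L b * norm h) \<and>
      (\<forall>z\<in>cball p r. \<bar>?q b z - ?q b x - frechet_derivative (?q b) (at x) (z - x)\<bar> \<le> L b * (norm (z - x))\<^sup>2)) \<and>
      r < r0) (at_right 0)"
    by (simp add: eventually_conj_iff)
  have sumb: "norm (\<Sum>b\<in>Basis. c b *\<^sub>R b) \<le> sum L Basis * e"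
    if "\<And>b. b \<in> Basis \<Longrightarrow> \<bar>c b\<bar> \<le> L b * e" for c and e :: real
  proof -
    have "norm (\<Sum>b\<in>Basis. c b *\<^sub>R (b::'a)) \<le> (\<Sum>b\<in>Basis. norm (c b *\<^sub>R b))"
      by (rule norm_sum)
    also have "\<dots> \<le> (\<Sum>b\<in>Basis. L b * e)" using that by (intro sum_mono) simp
    finally show ?thesis by (simp add: sum_distrib_right)
  qed
  show ?thesis
    unfolding second_order_at_def using ev
  proof (intro exI[of _ "sum L Basis"], elim eventually_mono, intro ballI conjI allI, goal_cases)
    case (1 r x)
    then have x: "x \<in> U" using r0(2) by auto
    show ?case unfolding A[OF x] by (rule D[OF x])
  next
    case (2 r x h)
    then have x: "x \<in> U" using r0(2) by auto
    show ?case unfolding A[OF x] by (rule sumb) (use 2 in blast)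
  next
    case (3 r x z)
    then have x: "x \<in> U" "z \<in> U" using r0(2) by auto
    have "gradient f z - gradient f x - hessian f x (z - x) =
       (\<Sum>b\<in>Basis. (?q b z - ?q b x - frechet_derivative (?q b) (at x) (z - x)) *\<^sub>R b)"
      unfolding A[OF x(1)] G[OF x(1)] G[OF x(2)]
      by (simp add: sum_subtractf sum.distrib algebra_simps)
    also have "norm \<dots> \<le> sum L Basis * (norm (z - x))\<^sup>2"
      by (rule sumb) (use 3 in blast)
    finally show ?case .
  qed
qed

lemma second_order_atD:
  assumes "second_order_at G A p"
  obtains r L where "0 < r" "0 < L"
    "\<And>x. x \<in> cball p r \<Longrightarrow> (G has_derivative A x) (at x)"
    "\<And>x z. x \<in> cball p r \<Longrightarrow> z \<in> cball p r \<Longrightarrow> norm (G z - G x) \<le> L * norm (z - x)"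
    "\<And>x z. x \<in> cball p r \<Longrightarrow> z \<in> cball p r \<Longrightarrow> norm (G z - G x - A x (z - x)) \<le> L * (norm (z - x))\<^sup>2"
proof -
  obtain L where "eventually (\<lambda>r. \<forall>x\<in>cball p r.
      (G has_derivative A x) (at x) \<and> (\<forall>h. norm (A x h) \<le> L * norm h) \<and>
      (\<forall>z\<in>cball p r. norm (G z - G x - A x (z - x)) \<le> L * (norm (z - x))\<^sup>2)) (at_right 0)"
    using assms unfolding second_order_at_def by blast
  then obtain s where s: "s > 0" and ev: "\<And>r x. 0 < r \<Longrightarrow> r < s \<Longrightarrow> x \<in> cball p r \<Longrightarrow>
      (G has_derivative A x) (at x) \<and> (\<forall>h. norm (A x h) \<le> L * norm h) \<and>
      (\<forall>z\<in>cball p r. norm (G z - G x - A x (z - x)) \<le> L * (norm (z - x))\<^sup>2)"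
    unfolding eventually_at_right_field by blast
  \<comment> \<open>A radius of at most 1/2 keeps any two points of the ball within distance 1. The
    quadratic remainder is then also linear in the distance, and together with the bound on
    \<open>A\<close> it gives a Lipschitz constant.\<close>
  define r where "r = min (1/2) (s / 2)"
  define K where "K = 2 * \<bar>L\<bar> + 1"
  have r: "0 < r" "r < s" "r \<le> 1/2" using s by (auto simp: r_def)
  have K: "K > 0" "L \<le> K" by (auto simp: K_def)
  show ?thesis
  proof (rule that[of r K])
    fix x z assume x: "x \<in> cball p r" and z: "z \<in> cball p r"
    note E = ev[OF r(1,2) x]
    show "norm (G z - G x - A x (z - x)) \<le> K * (norm (z - x))\<^sup>2"
      using E z K(2) by (meson mult_right_mono order_trans zero_le_power2)
    have "dist x z \<le> dist x p + dist p z" by (rule dist_triangle)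
    then have n1: "norm (z - x) \<le> 1"
      using x z r(3) by (simp add: dist_commute dist_norm norm_minus_commute)
    have "norm (G z - G x) \<le> norm (G z - G x - A x (z - x)) + norm (A x (z - x))"
      using norm_triangle_sub by (metis add.commute)
    also have "\<dots> \<le> \<bar>L\<bar> * norm (z - x) + \<bar>L\<bar> * norm (z - x)"
    proof (rule add_mono)
      have "norm (G z - G x - A x (z - x)) \<le> L * (norm (z - x))\<^sup>2" using E z by blast
      also have "\<dots> \<le> \<bar>L\<bar> * (norm (z - x))\<^sup>2" by (simp add: mult_right_mono)
      also have "\<dots> \<le> \<bar>L\<bar> * norm (z - x)"
        using n1 by (intro mult_left_mono) (auto simp: power2_eq_square mult_left_le)
      finally show "norm (G z - G x - A x (z - x)) \<le> \<bar>L\<bar> * norm (z - x)" .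
      have "norm (A x (z - x)) \<le> L * norm (z - x)" using E by blast
      also have "\<dots> \<le> \<bar>L\<bar> * norm (z - x)" by (simp add: mult_right_mono)
      finally show "norm (A x (z - x)) \<le> \<bar>L\<bar> * norm (z - x)" .
    qed
    also have "\<dots> \<le> K * norm (z - x)" by (simp add: K_def algebra_simps)
    finally show "norm (G z - G x) \<le> K * norm (z - x)" .
  next
    fix x assume "x \<in> cball p r"
    then show "(G has_derivative A x) (at x)" using ev[OF r(1,2)] by blast
  qed (use r K in auto)
qed

lemma second_order_at_derivative:
  assumes "second_order_at G A p"
  shows "(G has_derivative A p) (at p)"
proof (rule second_order_atD[OF assms])
  fix r L :: real
  assume "0 < r" and *: "\<And>x. x \<in> cball p r \<Longrightarrow> (G has_derivative A x) (at x)"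
  then show ?thesis by (intro *) simp
qed

lemma second_order_at_Lipschitz:
  assumes "second_order_at G A p"
  shows "\<exists>r L. 0 < r \<and> 0 < L \<and> (\<forall>x\<in>cball p r. \<forall>z\<in>cball p r. norm (G z - G x) \<le> L * norm (z - x))"
proof (rule second_order_atD[OF assms])
  fix r L :: real
  assume "0 < r" "0 < L"
    "\<And>x z. x \<in> cball p r \<Longrightarrow> z \<in> cball p r \<Longrightarrow> norm (G z - G x) \<le> L * norm (z - x)"
  then show ?thesis by (intro exI[of _ r] exI[of _ L]) simp
qed

lemma second_order_at_bound:
  assumes "second_order_at G A p"
  shows "\<exists>L. eventually (\<lambda>x. \<forall>h. norm (A x h) \<le> L * norm h) (nhds p)"
proof -
  obtain L where "eventually (\<lambda>r. \<forall>x\<in>cball p r. (G has_derivative A x) (at x) \<and>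
      (\<forall>h. norm (A x h) \<le> L * norm h) \<and>
      (\<forall>z\<in>cball p r. norm (G z - G x - A x (z - x)) \<le> L * (norm (z - x))\<^sup>2)) (at_right 0)"
    using assms unfolding second_order_at_def by blast
  then obtain s where s: "s > 0" "\<And>r x. 0 < r \<Longrightarrow> r < s \<Longrightarrow> x \<in> cball p r \<Longrightarrow> \<forall>h. norm (A x h) \<le> L * norm h"
    unfolding eventually_at_right_field by blast
  have "\<forall>h. norm (A x h) \<le> L * norm h" if "dist x p < s / 2" for x
    using s(2)[of "s / 2" x] s(1) that by (simp add: dist_commute)
  then have "eventually (\<lambda>x. \<forall>h. norm (A x h) \<le> L * norm h) (nhds p)"
    unfolding eventually_nhds_metric using s(1) by (intro exI[of _ "s / 2"]) simp
  then show ?thesis by blast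
qed

section \<open>Upper bounds for the objective along a segment\<close>

text \<open>The mean value theorem on the unit interval, applied to \<open>\<Phi>\<close> minus its
  linear part and minus \<open>s\<^sup>2 / 2 * a\<close>. The number \<open>a\<close> is free: 0
  gives the estimate for a Lipschitz gradient, \<open>h \<bullet> A x h\<close> the one with a cubic
  remainder.\<close>

lemma line_expansion_bound:
  fixes \<Phi> :: "'a::euclidean_space \<Rightarrow> real"
  assumes "\<And>x. (\<Phi> has_derivative (\<lambda>h. G x \<bullet> h)) (at x)"
    and "\<And>s. 0 \<le> s \<Longrightarrow> s \<le> 1 \<Longrightarrow> (G (x + s *\<^sub>R h) - G x) \<bullet> h - s * a \<le> K"
  shows "\<Phi> (x + h) \<le> \<Phi> x + G x \<bullet> h + a / 2 + K"
proof -
  let ?\<phi> = "\<lambda>s. \<Phi> (x + s *\<^sub>R h) - s * (G x \<bullet> h) - s\<^sup>2 / 2 * a"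
  have "(?\<phi> has_real_derivative ((G (x + s *\<^sub>R h) - G x) \<bullet> h - s * a)) (at s)" for s
  proof -
    have "((\<lambda>s. \<Phi> (x + s *\<^sub>R h)) has_derivative (\<lambda>t. G (x + s *\<^sub>R h) \<bullet> (t *\<^sub>R h))) (at s)"
      by (rule has_derivative_compose[OF _ assms(1)]) (auto intro!: derivative_eq_intros)
    then have "((\<lambda>s. \<Phi> (x + s *\<^sub>R h)) has_real_derivative (G (x + s *\<^sub>R h) \<bullet> h)) (at s)"
      by (simp add: has_field_derivative_def mult.commute mult_commute_abs)
    then show ?thesis
      by (auto intro!: derivative_eq_intros simp: inner_diff_left)
  qed
  from MVT2[of 0 1 ?\<phi>, OF _ this] obtain s where
    "0 < s" "s < 1" "?\<phi> 1 - ?\<phi> 0 = (G (x + s *\<^sub>R h) - G x) \<bullet> h - s * a"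
    by auto
  with assms(2)[of s] show ?thesis by simp
qed

lemma Lipschitz_descent:
  fixes \<Phi> :: "'a::euclidean_space \<Rightarrow> real"
  assumes "\<And>x. (\<Phi> has_derivative (\<lambda>h. G x \<bullet> h)) (at x)"
    and L: "L > 0" "\<And>x z. x \<in> S \<Longrightarrow> z \<in> S \<Longrightarrow> norm (G z - G x) \<le> L * norm (z - x)"
    and S: "convex S" "x \<in> S" "x + h \<in> S"
  shows "\<Phi> (x + h) \<le> \<Phi> x + G x \<bullet> h + L * (norm h)\<^sup>2"
proof -
  have "(G (x + s *\<^sub>R h) - G x) \<bullet> h - s * 0 \<le> L * (norm h)\<^sup>2" if s: "0 \<le> s" "s \<le> 1" for s
  proof -
    have "x + s *\<^sub>R h = (1 - s) *\<^sub>R x + s *\<^sub>R (x + h)" by (simp add: algebra_simps)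
    then have "x + s *\<^sub>R h \<in> S" using S s convexD_alt[of S x "x + h" s] by simp
    from L(2)[OF S(2) this] have "norm (G (x + s *\<^sub>R h) - G x) \<le> L * (s * norm h)" using s by simp
    also have "\<dots> \<le> L * norm h" using s L by (simp add: mult_left_le_one_le)
    finally have "norm (G (x + s *\<^sub>R h) - G x) * norm h \<le> L * norm h * norm h" by (rule mult_right_mono) simp
    then show ?thesis
      using norm_cauchy_schwarz[of "G (x + s *\<^sub>R h) - G x" h] by (simp add: power2_eq_square)
  qed
  from line_expansion_bound[of \<Phi> G x h 0, OF assms(1) this] show ?thesis by simp
qed

lemma quadratic_expansion_bound:
  fixes \<Phi> :: "'a::euclidean_space \<Rightarrow> real"
  assumes "\<And>x. (\<Phi> has_derivative (\<lambda>h. G x \<bullet> h)) (at x)"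
    and L: "L > 0" "\<And>x z. x \<in> S \<Longrightarrow> z \<in> S \<Longrightarrow> norm (G z - G x - A x (z - x)) \<le> L * (norm (z - x))\<^sup>2"
    and S: "convex S" "x \<in> S" "x + h \<in> S" and A: "linear (A x)"
  shows "\<Phi> (x + h) \<le> \<Phi> x + G x \<bullet> h + h \<bullet> A x h / 2 + L * (norm h) ^ 3"
proof -
  have "(G (x + s *\<^sub>R h) - G x) \<bullet> h - s * (h \<bullet> A x h) \<le> L * (norm h) ^ 3" if s: "0 \<le> s" "s \<le> 1" for s
  proof -
    have "x + s *\<^sub>R h = (1 - s) *\<^sub>R x + s *\<^sub>R (x + h)" by (simp add: algebra_simps)
    then have "x + s *\<^sub>R h \<in> S" using S s convexD_alt[of S x "x + h" s] by simp
    from L(2)[OF S(2) this] have "norm (G (x + s *\<^sub>R h) - G x - s *\<^sub>R A x h) \<le> L * (s\<^sup>2 * (norm h)\<^sup>2)"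
      using s by (simp add: linear_cmul[OF A] power_mult_distrib)
    also have "\<dots> \<le> L * (norm h)\<^sup>2" using s L by (simp add: mult_left_le_one_le power_le_one)
    finally have "norm (G (x + s *\<^sub>R h) - G x - s *\<^sub>R A x h) * norm h \<le> L * (norm h)\<^sup>2 * norm h"
      by (rule mult_right_mono) simp
    moreover have "(G (x + s *\<^sub>R h) - G x - s *\<^sub>R A x h) \<bullet> h
        = (G (x + s *\<^sub>R h) - G x) \<bullet> h - s * (h \<bullet> A x h)"
      by (simp add: inner_diff_left inner_commute[of h])
    ultimately show ?thesis
      using norm_cauchy_schwarz[of "G (x + s *\<^sub>R h) - G x - s *\<^sub>R A x h" h]
      by (simp add: power2_eq_square power3_eq_cube mult.assoc)
  qed
  from line_expansion_bound[of \<Phi> G x h, OF assms(1) this] show ?thesis by simp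
qed

section \<open>Polyhedra with signed multipliers\<close>

locale polyhedron =
  fixes b :: "'r::finite \<Rightarrow> 'a::euclidean_space" and lo up :: "'r \<Rightarrow> ereal"
begin

definition feas :: "'a set" where
  "feas = {z. \<forall>i. lo i \<le> ereal (b i \<bullet> z) \<and> ereal (b i \<bullet> z) \<le> up i}"

definition act :: "'a \<Rightarrow> 'r set" where
  "act z = {i. ereal (b i \<bullet> z) = lo i \<or> ereal (b i \<bullet> z) = up i}"

text \<open>The sign of \<open>w $ i\<close> selects the bound, so one number replaces the two
  multipliers of a two-sided constraint. A real number never equals an infinite bound, so an
  infinite bound never receives a nonzero multiplier.\<close>

definition mult :: "'a \<Rightarrow> real ^ 'r \<Rightarrow> bool" where
  "mult z w \<longleftrightarrow> (\<forall>i. (0 < w $ i \<longrightarrow> ereal (b i \<bullet> z) = up i) \<and> (w $ i < 0 \<longrightarrow> ereal (b i \<bullet> z) = lo i))"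

definition BT :: "real ^ 'r \<Rightarrow> 'a" where
  "BT w = (\<Sum>i\<in>UNIV. w $ i *\<^sub>R b i)"

text \<open>Linear independence of the active rows as a family, which also rules out repeated
  rows.\<close>

definition licq :: "'a \<Rightarrow> bool" where
  "licq p \<longleftrightarrow> (\<forall>w\<in>supported (act p). BT w = 0 \<longrightarrow> w = 0)"

text \<open>The second order condition, with the nonzero entries of the signed multiplier in place
  of the strongly active rows.\<close>

definition curvature :: "('a \<Rightarrow> 'a) \<Rightarrow> real ^ 'r \<Rightarrow> bool" where
  "curvature A w \<longleftrightarrow> (\<forall>z. z \<noteq> 0 \<longrightarrow> (\<forall>i. w $ i \<noteq> 0 \<longrightarrow> b i \<bullet> z = 0) \<longrightarrow> 0 < z \<bullet> A z)"

lemma tendsto_row: "(X \<longlongrightarrow> p) F \<Longrightarrow> ((\<lambda>k. ereal (b i \<bullet> X k)) \<longlongrightarrow> ereal (b i \<bullet> p)) F"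
  by (intro tendsto_intros)

lemma closed_feas: "closed feas"
proof (unfold closed_sequential_limits, intro allI impI)
  fix X p assume X: "(\<forall>n::nat. X n \<in> feas) \<and> X \<longlonglongrightarrow> p"
  show "p \<in> feas"
    unfolding feas_def
  proof (intro CollectI allI conjI)
    fix i
    have T: "(\<lambda>k. ereal (b i \<bullet> X k)) \<longlonglongrightarrow> ereal (b i \<bullet> p)"
      using X tendsto_row by blast
    show "lo i \<le> ereal (b i \<bullet> p)"
      by (rule tendsto_lowerbound[OF T]) (use X in \<open>auto simp: feas_def\<close>)
    show "ereal (b i \<bullet> p) \<le> up i"
      by (rule tendsto_upperbound[OF T]) (use X in \<open>auto simp: feas_def\<close>)
  qed
qed

text \<open>Rows that are inactive at \<open>p\<close> stay inactive nearby by continuity, and there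
  are finitely many of them.\<close>

lemma eventually_act: "eventually (\<lambda>z. act z \<subseteq> act p) (nhds p)"
proof -
  have "eventually (\<lambda>z. i \<in> act z \<longrightarrow> i \<in> act p) (nhds p)" for i
  proof (cases "i \<in> act p")
    case False
    have T: "((\<lambda>z. ereal (b i \<bullet> z)) \<longlongrightarrow> ereal (b i \<bullet> p)) (nhds p)"
      by (intro tendsto_row filterlim_ident)
    have "eventually (\<lambda>z. ereal (b i \<bullet> z) \<noteq> lo i) (nhds p)"
      "eventually (\<lambda>z. ereal (b i \<bullet> z) \<noteq> up i) (nhds p)"
      using False by (auto intro!: tendsto_imp_eventually_ne[OF T] simp: act_def)
    then show ?thesis by eventually_elim (auto simp: act_def)
  qed auto
  then have "eventually (\<lambda>z. \<forall>i. i \<in> act z \<longrightarrow> i \<in> act p) (nhds p)"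
    by (intro eventually_all_finite) auto
  then show ?thesis by eventually_elim auto
qed

lemma mult_supported: "mult z w \<Longrightarrow> w \<in> supported (act z)"
  unfolding mult_def supported_def act_def by simp (metis linorder_less_linear)

text \<open>A positive entry puts \<open>z\<close> at an upper bound that \<open>x\<close> cannot
  exceed, a negative one at a lower bound. Summed over the rows, this places \<open>BT w\<close> in
  the normal cone of the polyhedron at a feasible \<open>z\<close>.\<close>

lemma mult_normal:
  assumes "mult z w" "x \<in> feas"
  shows "w $ i * (b i \<bullet> (x - z)) \<le> 0"
proof -
  consider "w $ i = 0" | "w $ i > 0" | "w $ i < 0" by linarith
  then show ?thesis
  proof cases
    case 2
    then have "ereal (b i \<bullet> x) \<le> ereal (b i \<bullet> z)"
      using assms by (auto simp: mult_def feas_def)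
    with 2 show ?thesis by (simp add: inner_diff_right mult_nonneg_nonpos)
  next
    case 3
    then have "ereal (b i \<bullet> z) \<le> ereal (b i \<bullet> x)"
      using assms by (auto simp: mult_def feas_def)
    with 3 show ?thesis by (simp add: inner_diff_right mult_nonpos_nonneg)
  qed simp
qed

lemma linear_BT: "linear BT"
  by (rule linearI) (simp_all add: BT_def algebra_simps sum.distrib scaleR_sum_right)

lemmas BT_add = linear_add[OF linear_BT]
lemmas BT_diff = linear_diff[OF linear_BT]
lemmas BT_scale = linear_cmul[OF linear_BT]

lemma inner_BT: "BT w \<bullet> z = (\<Sum>i\<in>UNIV. w $ i * (b i \<bullet> z))"
  by (simp add: BT_def inner_sum_left)

lemma mult_normal_sum: "mult z w \<Longrightarrow> x \<in> feas \<Longrightarrow> BT w \<bullet> (x - z) \<le> 0"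
  unfolding inner_BT by (intro sum_nonpos mult_normal)

lemma subspace_supported: "subspace (supported (S :: 'r set))"
  unfolding subspace_def supported_def by auto

section \<open>Stability of multipliers under linear independence\<close>

text \<open>An injective linear map on a finite-dimensional subspace is bounded below. This makes
  independence quantitative: multipliers are controlled by their images.\<close>

lemma licq_bound:
  assumes "licq p"
  shows "\<exists>e>0. \<forall>w\<in>supported (act p). e * norm w \<le> norm (BT w)"
  using injective_imp_isometric[OF closed_subspace[OF subspace_supported] subspace_supported
      linear_conv_bounded_linear[THEN iffD1, OF linear_BT]] assms
  unfolding licq_def by blast

text \<open>A nonzero entry of the limit has the sign of all late entries of the sequence, so the
  same bound is active at every late \<open>X k\<close> and by continuity at
  \<open>p\<close>.\<close>

lemma mult_limit:
  assumes "X \<longlonglongrightarrow> p" "w \<longlonglongrightarrow> w'" "\<And>k::nat. mult (X k) (w k)"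
  shows "mult p w'"
  unfolding mult_def
proof (intro allI conjI impI)
  fix i
  have wi: "(\<lambda>k. w k $ i) \<longlonglongrightarrow> w' $ i" by (intro tendsto_intros assms)
  {
    assume "0 < w' $ i"
    with wi have "eventually (\<lambda>k. 0 < w k $ i) sequentially" by (simp add: order_tendstoD)
    then have "eventually (\<lambda>k. ereal (b i \<bullet> X k) = up i) sequentially"
      by eventually_elim (use assms(3) in \<open>auto simp: mult_def\<close>)
    from LIMSEQ_unique[OF tendsto_eventually[OF this] tendsto_row[OF assms(1)]]
    show "ereal (b i \<bullet> p) = up i" by simp
  next
    assume "w' $ i < 0"
    with wi have "eventually (\<lambda>k. w k $ i < 0) sequentially" by (simp add: order_tendstoD)
    then have "eventually (\<lambda>k. ereal (b i \<bullet> X k) = lo i) sequentially"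
      by eventually_elim (use assms(3) in \<open>auto simp: mult_def\<close>)
    from LIMSEQ_unique[OF tendsto_eventually[OF this] tendsto_row[OF assms(1)]]
    show "ereal (b i \<bullet> p) = lo i" by simp
  }
qed

lemma multiplier_convergence:
  assumes licq: "licq p" and X: "X \<longlonglongrightarrow> p" and m: "\<And>k::nat. mult (X k) (w k)"
    and g: "g \<longlonglongrightarrow> q" and r: "(\<lambda>k. g k + BT (w k)) \<longlonglongrightarrow> 0"
  shows "\<exists>w'. w \<longlonglongrightarrow> w' \<and> mult p w' \<and> q + BT w' = 0"
proof -
  let ?V = "supported (act p)"
  obtain e where e: "e > 0" "\<And>w. w \<in> ?V \<Longrightarrow> e * norm w \<le> norm (BT w)"
    using licq_bound[OF licq] by blast
  have B: "(\<lambda>k. BT (w k)) \<longlonglongrightarrow> - q" using tendsto_diff[OF r g] by simp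
  have ev: "eventually (\<lambda>k. w k \<in> ?V) sequentially"
  proof -
    have "eventually (\<lambda>k. act (X k) \<subseteq> act p) sequentially"
      by (rule eventually_compose_filterlim[OF eventually_act X])
    then show ?thesis
    proof eventually_elim
      case (elim k)
      then show ?case using mult_supported[OF m[of k]] by (auto simp: supported_def)
    qed
  qed
  \<comment> \<open>The image of a subspace is closed, so the limit \<open>- q\<close> of
    \<open>BT (w k)\<close> has a preimage \<open>w'\<close> in that subspace. The lower bound
    \<open>e\<close> then carries convergence of the images over to the multipliers.\<close>
  have "closed (BT ` ?V)"
    by (intro closed_subspace linear_subspace_image linear_BT subspace_supported)
  moreover have "eventually (\<lambda>k. BT (w k) \<in> BT ` ?V) sequentially"
    using ev by eventually_elim simp
  ultimately have "- q \<in> BT ` ?V"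
    by (rule Lim_in_closed_set[OF _ _ trivial_limit_sequentially B])
  then obtain w' where w': "w' \<in> ?V" "BT w' = - q" by auto
  have "(\<lambda>k. norm (w k - w')) \<longlonglongrightarrow> 0"
  proof (rule tendsto_sandwich[where f = "\<lambda>_. 0" and h = "\<lambda>k. norm (BT (w k) + q) / e"])
    show "eventually (\<lambda>k. norm (w k - w') \<le> norm (BT (w k) + q) / e) sequentially"
      using ev
    proof eventually_elim
      case (elim k)
      have "e * norm (w k - w') \<le> norm (BT (w k - w'))"
        by (rule e(2)) (use elim w' in \<open>simp add: subspace_diff[OF subspace_supported]\<close>)
      then show ?case using e(1) w' by (simp add: BT_diff field_simps)
    qed
    have "(\<lambda>k. norm (BT (w k) + q) / e) \<longlonglongrightarrow> norm (- q + q) / e"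
      by (intro tendsto_intros B) (use e in auto)
    then show "(\<lambda>k. norm (BT (w k) + q) / e) \<longlonglongrightarrow> 0" by simp
  qed auto
  then have lim: "w \<longlonglongrightarrow> w'" by (simp add: tendsto_norm_zero_iff LIM_zero_cancel)
  show ?thesis
    using lim mult_limit[OF X lim m] w' by auto
qed

section \<open>Local error bound from curvature\<close>

text \<open>The quadratic form attains a positive minimum on the compact unit sphere of the kernel,
  and scaling extends the bound. For a trivial kernel the sphere is empty and any positive constant
  serves.\<close>

lemma coercive_on_kernel:
  assumes A: "linear A" and pos: "curvature A w"
  shows "\<exists>c>0. \<forall>z. (\<forall>i. w $ i \<noteq> 0 \<longrightarrow> b i \<bullet> z = 0) \<longrightarrow> c * (norm z)\<^sup>2 \<le> z \<bullet> A z"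
proof -
  define K where "K = sphere 0 1 \<inter> (\<Inter>i\<in>{i. w $ i \<noteq> 0}. {z. b i \<bullet> z = 0})"
  have "compact K"
    unfolding K_def by (intro compact_Int_closed closed_INT ballI closed_hyperplane) auto
  have main: "\<exists>c>0. \<forall>z\<in>K. c \<le> z \<bullet> A z"
  proof (cases "K = {}")
    case False
    have "continuous_on K (\<lambda>z. z \<bullet> A z)"
      by (intro continuous_intros linear_continuous_on linear_conv_bounded_linear[THEN iffD1] A)
    from continuous_attains_inf[OF \<open>compact K\<close> False this]
    obtain x where "x \<in> K" "\<And>z. z \<in> K \<Longrightarrow> x \<bullet> A x \<le> z \<bullet> A z" by blast
    moreover have "0 < x \<bullet> A x"
      using pos[unfolded curvature_def, rule_format, of x] \<open>x \<in> K\<close> by (fastforce simp: K_def)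
    ultimately show ?thesis by blast
  qed (auto intro: exI[of _ 1])
  then obtain c where c: "c > 0" "\<And>z. z \<in> K \<Longrightarrow> c \<le> z \<bullet> A z" by blast
  have "c * (norm z)\<^sup>2 \<le> z \<bullet> A z" if z: "\<forall>i. w $ i \<noteq> 0 \<longrightarrow> b i \<bullet> z = 0" for z
  proof (cases "z = 0")
    case False
    have "(1 / norm z) *\<^sub>R z \<in> K"
      using z False by (auto simp: K_def)
    from c(2)[OF this] show ?thesis
      using False by (simp add: linear_cmul[OF A] field_simps power2_eq_square)
  qed (simp add: linear_0[OF A])
  with c(1) show ?thesis by blast
qed

text \<open>The number \<open>m\<close> is the margin within which perturbations of \<open>w\<close>
  keep the signs of its nonzero entries.\<close>

lemma nonzero_entries_bound:
  fixes w :: "real ^ 'r"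
  shows "\<exists>m>0. \<forall>i. w $ i \<noteq> 0 \<longrightarrow> m \<le> \<bar>w $ i\<bar>"
proof -
  let ?S = "insert 1 ((\<lambda>i. \<bar>w $ i\<bar>) ` {i. w $ i \<noteq> 0})"
  have "Min ?S > 0" by (subst Min_gr_iff) auto
  moreover have "\<forall>i. w $ i \<noteq> 0 \<longrightarrow> Min ?S \<le> \<bar>w $ i\<bar>" by (auto intro!: Min_le)
  ultimately show ?thesis by blast
qed

text \<open>A small residual forces \<open>w\<close> close to \<open>w'\<close>, so every row with
  nonzero \<open>w'\<close> is tight at \<open>z\<close> on the same side as at \<open>p\<close>.
  Hence \<open>z - p\<close> lies in the kernel on which \<open>A\<close> is coercive. When the
  residual is tested with \<open>z - p\<close>, the multiplier terms have a favourable sign, and one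
  factor of the distance cancels.\<close>

lemma error_bound:
  assumes p: "p \<in> feas" and licq: "licq p" and w': "mult p w'" "G p + BT w' = 0"
    and pos: "curvature A w'" and G: "(G has_derivative A) (at p)"
  shows "\<exists>C>0. \<exists>\<delta>>0. \<forall>z\<in>feas. \<forall>w. mult z w \<longrightarrow> norm (z - p) < \<delta> \<longrightarrow> norm (G z + BT w) < \<delta>
            \<longrightarrow> norm (z - p) \<le> C * norm (G z + BT w)"
proof -
  obtain e where e: "e > 0" "\<And>w. w \<in> supported (act p) \<Longrightarrow> e * norm w \<le> norm (BT w)"
    using licq_bound[OF licq] by blast
  obtain c where c: "c > 0" "\<And>z. \<forall>i. w' $ i \<noteq> 0 \<longrightarrow> b i \<bullet> z = 0 \<Longrightarrow> c * (norm z)\<^sup>2 \<le> z \<bullet> A z"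
    using coercive_on_kernel[OF has_derivative_linear[OF G] pos] by blast
  obtain m where m: "m > 0" "\<And>i. w' $ i \<noteq> 0 \<Longrightarrow> m \<le> \<bar>w' $ i\<bar>"
    using nonzero_entries_bound by blast
  have c2: "c / 2 > 0" using c by simp
  obtain \<delta>1 where \<delta>1: "\<delta>1 > 0" "\<And>z. norm (z - p) < \<delta>1 \<Longrightarrow> norm (G z - G p - A (z - p)) \<le> c / 2 * norm (z - p)"
    using G c2 unfolding has_derivative_at_alt by blast
  have em: "e * m / 2 > 0" using e m by simp
  obtain \<delta>2 where \<delta>2: "\<delta>2 > 0" "\<And>z. norm (z - p) < \<delta>2 \<Longrightarrow> norm (G z - G p) < e * m / 2"
    using has_derivative_continuous[OF G] em unfolding continuous_at_eps_delta dist_norm by blast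
  obtain \<delta>3 where \<delta>3: "\<delta>3 > 0" "\<And>z. norm (z - p) < \<delta>3 \<Longrightarrow> act z \<subseteq> act p"
    using eventually_act[of p] unfolding eventually_nhds_metric dist_norm by blast
  \<comment> \<open>The entries \<open>\<delta>2\<close> and \<open>e * m / 2\<close> each
    contribute half of the bound \<open>e * m\<close> on \<open>e * norm (w - w')\<close>. The other
    two give the Taylor estimate and the inclusion of active sets.\<close>
  define \<delta> where "\<delta> = Min {\<delta>1, \<delta>2, \<delta>3, e * m / 2}"
  have \<delta>: "\<delta> > 0" "\<delta> \<le> \<delta>1" "\<delta> \<le> \<delta>2" "\<delta> \<le> \<delta>3" "\<delta> \<le> e * m / 2"
    using \<delta>1 \<delta>2 \<delta>3 em by (auto simp: \<delta>_def)
  have "norm (z - p) \<le> 2 / c * norm (G z + BT w)"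
    if z: "z \<in> feas" "mult z w" "norm (z - p) < \<delta>" "norm (G z + BT w) < \<delta>" for z w
  proof -
    have supp: "w - w' \<in> supported (act p)"
      using mult_supported[OF z(2)] mult_supported[OF w'(1)] \<delta>3(2)[of z] z(3) \<delta>(4)
      by (auto simp: supported_def)
    have eq: "BT (w - w') = (G z + BT w) - (G z - G p)"
      using w'(2) by (simp add: BT_diff algebra_simps add_eq_0_iff)
    have "e * norm (w - w') \<le> norm (BT (w - w'))" by (rule e(2)[OF supp])
    also have "\<dots> \<le> norm (G z + BT w) + norm (G z - G p)"
      unfolding eq by (rule norm_triangle_ineq4)
    also have "\<dots> < e * m / 2 + e * m / 2"
      using z \<delta> \<delta>2(2)[of z] by (intro add_strict_mono) auto
    finally have wm: "norm (w - w') < m" using e(1) by simp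
    have "b i \<bullet> (z - p) = 0" if i: "w' $ i \<noteq> 0" for i
    proof -
      have "\<bar>w $ i - w' $ i\<bar> < \<bar>w' $ i\<bar>"
        using component_le_norm_cart[of "w - w'" i] wm m(2)[OF i] by simp
      then have "(w $ i > 0 \<and> w' $ i > 0) \<or> (w $ i < 0 \<and> w' $ i < 0)" by linarith
      then have "ereal (b i \<bullet> z) = ereal (b i \<bullet> p)"
        using z(2) w'(1) unfolding mult_def by metis
      then show ?thesis by (simp add: inner_diff_right)
    qed
    then have co: "c * (norm (z - p))\<^sup>2 \<le> (z - p) \<bullet> A (z - p)" by (intro c(2)) auto
    have "\<bar>(G z - G p - A (z - p)) \<bullet> (z - p)\<bar> \<le> norm (G z - G p - A (z - p)) * norm (z - p)"
      by (rule Cauchy_Schwarz_ineq2)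
    also have "\<dots> \<le> c / 2 * norm (z - p) * norm (z - p)"
      using \<delta>1(2)[of z] z \<delta> by (intro mult_right_mono) auto
    also have "(G z - G p - A (z - p)) \<bullet> (z - p) = (G z - G p) \<bullet> (z - p) - (z - p) \<bullet> A (z - p)"
      by (simp only: inner_diff_left[of _ "A (z - p)"] inner_commute[of "A (z - p)"])
    finally have tay: "(G z - G p) \<bullet> (z - p) \<ge> c / 2 * (norm (z - p))\<^sup>2"
      using co by (simp add: power2_eq_square abs_if split: if_splits)
    \<comment> \<open>Monotonicity of the normal cone: the multiplier at each of the two points is
      tested with the other point, which is feasible.\<close>
    have "BT w \<bullet> (p - z) \<le> 0" "BT w' \<bullet> (z - p) \<le> 0"
      using mult_normal_sum z w' p by blast+
    moreover have "(G z + BT w) \<bullet> (z - p) - (G z - G p) \<bullet> (z - p) = - (BT w \<bullet> (p - z)) - BT w' \<bullet> (z - p)"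
    proof -
      have "G p = - BT w'" using w'(2) by (simp add: eq_neg_iff_add_eq_0)
      then show ?thesis by (simp add: inner_simps)
    qed
    ultimately have "(G z - G p) \<bullet> (z - p) \<le> (G z + BT w) \<bullet> (z - p)" by linarith
    also have "\<dots> \<le> norm (G z + BT w) * norm (z - p)" by (rule norm_cauchy_schwarz)
    finally have "c / 2 * norm (z - p) * norm (z - p) \<le> norm (G z + BT w) * norm (z - p)"
      using tay by (simp add: power2_eq_square)
    then have "c / 2 * norm (z - p) \<le> norm (G z + BT w)"
      by (cases "z = p") auto
    then show ?thesis using c by (simp add: field_simps)
  qed
  moreover have "2 / c > 0" using c by simp
  ultimately show ?thesis using \<delta>(1) by blast
qed

end

section \<open>Descent runs\<close>

text \<open>Both kinds of trial step enter only through a multiplier \<open>w k\<close> at the trial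
  point with a residual of second order, so the block structure disappears from the convergence
  argument. \<open>armijo_max\<close> says that the step length before the accepted one,
  \<open>t k / \<sigma>\<close>, was rejected.\<close>

locale descent_run = polyhedron b lo up
  for b :: "'r::finite \<Rightarrow> 'a::euclidean_space" and lo up +
  fixes \<Phi> :: "'a \<Rightarrow> real" and G :: "'a \<Rightarrow> 'a" and A :: "'a \<Rightarrow> 'a \<Rightarrow> 'a"
    and \<rho> \<sigma> \<eta> \<beta> c :: real
    and u ut :: "nat \<Rightarrow> 'a" and t :: "nat \<Rightarrow> real" and H :: "nat \<Rightarrow> 'a \<Rightarrow> 'a" and w :: "nat \<Rightarrow> real ^ 'r"
  assumes gradient: "\<And>x. (\<Phi> has_derivative (\<lambda>h. G x \<bullet> h)) (at x)"
    and smooth: "\<And>p. p \<in> feas \<Longrightarrow> second_order_at G A p"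
    and params: "0 < \<rho>" "\<rho> < 1 / 2" "0 < \<sigma>" "0 < \<eta>" "0 < \<beta>" "0 < c"
    and feas_u: "\<And>k. u k \<in> feas" and feas_ut: "\<And>k. ut k \<in> feas"
    and descent: "\<And>k. G (u k) \<bullet> (ut k - u k) + (ut k - u k) \<bullet> H k (ut k - u k) \<le> 0"
    and H_lower: "\<And>k z. \<eta> * (z \<bullet> z) \<le> z \<bullet> H k z"
    and H_upper: "\<And>k z. norm (H k z) \<le> \<beta> * norm z"
    and step: "\<And>k. u (Suc k) = u k + t k *\<^sub>R (ut k - u k)"
    and t_range: "\<And>k. 0 < t k" "\<And>k. t k \<le> 1"
    and armijo: "\<And>k. \<Phi> (u (Suc k)) \<le> \<Phi> (u k) - \<rho> * t k * ((ut k - u k) \<bullet> H k (ut k - u k))"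
    and armijo_max: "\<And>k. t k \<noteq> 1 \<Longrightarrow>
      \<Phi> (u k + (t k / \<sigma>) *\<^sub>R (ut k - u k)) > \<Phi> (u k) - \<rho> * (t k / \<sigma>) * ((ut k - u k) \<bullet> H k (ut k - u k))"
    and unit_step: "\<And>k. \<Phi> (ut k) \<le> \<Phi> (u k) - \<rho> * ((ut k - u k) \<bullet> H k (ut k - u k)) \<Longrightarrow> t k = 1"
    and mult_w: "\<And>k. mult (ut k) (w k)"
    and residual: "\<And>k. norm (ut k - u k) \<le> 1 \<Longrightarrow>
      norm (G (u k) + H k (ut k - u k) + BT (w k)) \<le> c * (norm (ut k - u k))\<^sup>2"
    and u_bounded: "bounded (range u)"
    and regular: "\<And>p. accumulation_point u p \<Longrightarrow> licq p"
    and second_order: "\<And>p w. accumulation_point u p \<Longrightarrow> mult p w \<Longrightarrow> G p + BT w = 0 \<Longrightarrow> curvature (A p) w"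
begin

section \<open>Directions tending to zero\<close>

definition d :: "nat \<Rightarrow> 'a" where "d k = ut k - u k"

lemma d_H_lower: "\<eta> * (norm (d k))\<^sup>2 \<le> d k \<bullet> H k (d k)"
  using H_lower[of "d k" k] by (simp add: dot_square_norm)

lemma accumulation_feas: "accumulation_point u p \<Longrightarrow> p \<in> feas"
  unfolding accumulation_point_def
  by (elim exE conjE, rule closed_sequentially[OF closed_feas]) (auto simp: feas_u)

lemma isCont_\<Phi>: "isCont \<Phi> x"
  using gradient has_derivative_continuous by blast

text \<open>The objective values decrease and are bounded because the iterates are, so their
  differences tend to zero. By the line search test each difference is at least
  \<open>\<rho> * \<eta>\<close> times the quantity in question.\<close>

lemma step_decrease_tendsto: "(\<lambda>k. t k * (norm (d k))\<^sup>2) \<longlonglongrightarrow> 0"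
proof -
  have nn: "0 \<le> \<rho> * \<eta> * (t k * (norm (d k))\<^sup>2)" for k
    using params t_range[of k] by simp
  have dec: "\<rho> * \<eta> * (t k * (norm (d k))\<^sup>2) \<le> \<Phi> (u k) - \<Phi> (u (Suc k))" for k
  proof -
    have "\<rho> * t k * (\<eta> * (norm (d k))\<^sup>2) \<le> \<rho> * t k * (d k \<bullet> H k (d k))"
      using params t_range[of k] d_H_lower by (intro mult_left_mono) auto
    with armijo[of k] show ?thesis by (simp add: d_def mult_ac)
  qed
  have "compact (closure (range u))" using u_bounded by (simp add: compact_closure)
  then have "compact (\<Phi> ` closure (range u))"
    by (intro compact_continuous_image continuous_at_imp_continuous_on ballI isCont_\<Phi>)
  then obtain B where B: "\<And>x. x \<in> closure (range u) \<Longrightarrow> \<bar>\<Phi> x\<bar> \<le> B"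
    using compact_imp_bounded[of "\<Phi> ` closure (range u)"] by (auto simp: bounded_iff)
  have "Bseq (\<lambda>k. \<Phi> (u k))"
    by (rule BseqI'[of _ B]) (use B closure_subset[of "range u"] in auto)
  moreover have "decseq (\<lambda>k. \<Phi> (u k))"
    by (rule decseq_SucI) (use order_trans[OF nn dec] in simp)
  ultimately obtain a where a: "(\<lambda>k. \<Phi> (u k)) \<longlonglongrightarrow> a"
    using Bseq_monoseq_convergent[of "\<lambda>k. \<Phi> (u k)"] by (auto simp: convergent_def decseq_imp_monoseq)
  have "(\<lambda>k. \<Phi> (u k) - \<Phi> (u (Suc k))) \<longlonglongrightarrow> 0"
    using tendsto_diff[OF a LIMSEQ_Suc[OF a]] by simp
  then have "(\<lambda>k. \<rho> * \<eta> * (t k * (norm (d k))\<^sup>2)) \<longlonglongrightarrow> 0"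
    by (rule tendsto_sandwich[rotated 3]) (use nn dec in auto)
  from tendsto_mult_left[OF this, of "1 / (\<rho> * \<eta>)"] show ?thesis
    using params by (simp add: field_simps)
qed

lemma d_bound: "\<eta> * norm (d k) \<le> norm (G (u k))"
proof -
  have "\<eta> * (norm (d k))\<^sup>2 \<le> - (G (u k) \<bullet> d k)"
    using descent[of k] d_H_lower[of k] by (simp add: d_def)
  also have "\<dots> \<le> norm (G (u k)) * norm (d k)"
    using Cauchy_Schwarz_ineq2[of "G (u k)" "d k"] by linarith
  finally have "\<eta> * norm (d k) * norm (d k) \<le> norm (G (u k)) * norm (d k)"
    by (simp add: power2_eq_square)
  then show ?thesis by (cases "d k = 0") auto
qed

lemma ex_convergent_subsequence:
  assumes "strict_mono (r :: nat \<Rightarrow> nat)"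
  shows "\<exists>s p. strict_mono s \<and> (\<lambda>k. u (r (s k))) \<longlonglongrightarrow> p \<and> accumulation_point u p"
proof -
  have "compact (closure (range u))" using u_bounded by (simp add: compact_closure)
  moreover have "\<forall>k. (u \<circ> r) k \<in> closure (range u)" using closure_subset[of "range u"] by auto
  ultimately obtain p s where s: "strict_mono (s :: nat \<Rightarrow> nat)" "((u \<circ> r) \<circ> s) \<longlonglongrightarrow> p"
    unfolding compact_def by blast
  moreover have "accumulation_point u p"
    unfolding accumulation_point_def
    by (rule exI[of _ "r \<circ> s"]) (use s assms in \<open>simp add: strict_mono_o o_assoc\<close>)
  ultimately show ?thesis by (auto simp: o_def)
qed

text \<open>If the directions stayed away from zero along a subsequence, the step lengths would tend
  to zero there, which a locally Lipschitz gradient does not allow.\<close>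

lemma d_tendsto_0: "d \<longlonglongrightarrow> 0"
proof (rule ccontr)
  assume "\<not> d \<longlonglongrightarrow> 0"
  then obtain \<epsilon> where \<epsilon>: "\<epsilon> > 0" "\<forall>N. \<exists>k\<ge>N. \<epsilon> \<le> norm (d k)"
    unfolding LIMSEQ_iff by (auto simp: not_less)
  then have "infinite {k. \<epsilon> \<le> norm (d k)}"
    by (simp add: infinite_nat_iff_unbounded_le)
  from infinite_enumerate[OF this]
  obtain r :: "nat \<Rightarrow> nat" where r: "strict_mono r" "\<And>k. \<epsilon> \<le> norm (d (r k))"
    by auto
  obtain s p where s: "strict_mono s" and lim: "(\<lambda>k. u (r (s k))) \<longlonglongrightarrow> p" and p: "accumulation_point u p"
    using ex_convergent_subsequence[OF r(1)] by blast
  define q where "q = (\<lambda>k. r (s k))"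
  have q: "strict_mono q" using r s by (auto simp: q_def strict_mono_def)
  have lim: "(\<lambda>k. u (q k)) \<longlonglongrightarrow> p" using lim by (simp add: q_def)
  have dq: "\<epsilon> \<le> norm (d (q k))" for k using r(2) by (simp add: q_def)
  obtain r0 L where r0: "0 < r0" "0 < L" and
    Lip: "\<And>x z. x \<in> cball p r0 \<Longrightarrow> z \<in> cball p r0 \<Longrightarrow> norm (G z - G x) \<le> L * norm (z - x)"
    using second_order_at_Lipschitz[OF smooth[OF accumulation_feas[OF p]]] by blast
  \<comment> \<open>Near \<open>p\<close> the Lipschitz estimate bounds the gradient, and
    \<open>d_bound\<close> turns this into a bound on the directions.\<close>
  define B where "B = (norm (G p) + L * r0) / \<eta>"
  have B0: "B > 0" using params r0 by (auto simp: B_def intro!: divide_pos_pos add_nonneg_pos)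
  have dB: "norm (d (q k)) \<le> B" if k: "u (q k) \<in> cball p r0" for k
  proof -
    have "norm (G (u (q k))) \<le> norm (G p) + norm (G (u (q k)) - G p)"
      by (rule norm_triangle_sub)
    also have "\<dots> \<le> norm (G p) + L * norm (u (q k) - p)"
      using Lip[of p "u (q k)"] k r0 by simp
    also have "\<dots> \<le> norm (G p) + L * r0"
      using k r0 by (simp add: dist_norm norm_minus_commute)
    finally show ?thesis
      using d_bound[of "q k"] params by (simp add: B_def field_simps)
  qed
  have "(\<lambda>k. t (q k) * (norm (d (q k)))\<^sup>2) \<longlonglongrightarrow> 0"
    using LIMSEQ_subseq_LIMSEQ[OF step_decrease_tendsto q] by (simp add: o_def)
  from tendsto_mult_left[OF this, of "1 / \<epsilon>\<^sup>2"]
  have "(\<lambda>k. 1 / \<epsilon>\<^sup>2 * (t (q k) * (norm (d (q k)))\<^sup>2)) \<longlonglongrightarrow> 0" by simp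
  then have t0: "(\<lambda>k. t (q k)) \<longlonglongrightarrow> 0"
  proof (rule tendsto_sandwich[rotated 3])
    have "t (q k) \<le> 1 / \<epsilon>\<^sup>2 * (t (q k) * (norm (d (q k)))\<^sup>2)" for k
    proof -
      have "\<epsilon>\<^sup>2 * t (q k) \<le> (norm (d (q k)))\<^sup>2 * t (q k)"
        using dq[of k] \<epsilon>(1) t_range(1)[of "q k"] by (intro mult_right_mono power_mono) auto
      then show ?thesis using \<epsilon>(1) by (simp add: field_simps)
    qed
    then show "eventually (\<lambda>k. t (q k) \<le> 1 / \<epsilon>\<^sup>2 * (t (q k) * (norm (d (q k)))\<^sup>2)) sequentially" by simp
    show "eventually (\<lambda>k. 0 \<le> t (q k)) sequentially" using t_range(1) by (simp add: less_imp_le)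
  qed simp
  \<comment> \<open>The first bound excludes a unit step, so that \<open>t (q k) / \<sigma>\<close>
    was rejected. The second keeps the rejected point in the ball, and the third makes the rejected
    step so short that it would have passed the test.\<close>
  define \<kappa> where "\<kappa> = Min {1, \<sigma> * r0 / (2 * B), \<sigma> * (1 - \<rho>) * \<eta> / L}"
  have "\<kappa> > 0" using params r0 B0 by (auto simp: \<kappa>_def)
  then have "eventually (\<lambda>k. t (q k) < \<kappa>) sequentially"
    using order_tendstoD(2)[OF t0] by blast
  moreover have "eventually (\<lambda>k. dist (u (q k)) p < r0 / 2) sequentially"
    using lim r0 by (intro tendstoD) auto
  ultimately have "eventually (\<lambda>k. False) sequentially"
  proof eventually_elim
    case (elim k)
    let ?k = "q k" let ?\<tau> = "t ?k / \<sigma>"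
    have t1: "t ?k \<noteq> 1" using elim(1) by (auto simp: \<kappa>_def)
    have \<tau>0: "?\<tau> > 0" using t_range params by simp
    have u: "u ?k \<in> cball p r0" using elim(2) r0 by (auto simp: dist_commute)
    have "?\<tau> * norm (d ?k) \<le> r0 / 2"
    proof -
      have "?\<tau> \<le> r0 / (2 * B)" using elim(1) params by (auto simp: \<kappa>_def field_simps)
      then have "?\<tau> * norm (d ?k) \<le> r0 / (2 * B) * B"
        using dB[OF u] B0 r0 by (intro mult_mono) auto
      then show ?thesis using B0 by simp
    qed
    moreover have "dist p (u ?k + ?\<tau> *\<^sub>R d ?k) \<le> dist p (u ?k) + ?\<tau> * norm (d ?k)"
      using t_range(1)[of ?k] params(3) norm_triangle_ineq4[of "p - u ?k" "?\<tau> *\<^sub>R d ?k"] by (simp add: dist_norm diff_diff_eq)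
    ultimately have u': "u ?k + ?\<tau> *\<^sub>R d ?k \<in> cball p r0"
      using elim(2) unfolding mem_cball dist_commute[of _ p] by linarith
    have "\<Phi> (u ?k + ?\<tau> *\<^sub>R d ?k) \<le> \<Phi> (u ?k) + G (u ?k) \<bullet> (?\<tau> *\<^sub>R d ?k) + L * (norm (?\<tau> *\<^sub>R d ?k))\<^sup>2"
      by (rule Lipschitz_descent[OF gradient r0(2) Lip convex_cball u u'])
    moreover have "\<Phi> (u ?k + ?\<tau> *\<^sub>R d ?k) > \<Phi> (u ?k) - \<rho> * ?\<tau> * (d ?k \<bullet> H ?k (d ?k))"
      using armijo_max[OF t1] by (simp add: d_def)
    moreover have "?\<tau> * (G (u ?k) \<bullet> d ?k) \<le> ?\<tau> * - (d ?k \<bullet> H ?k (d ?k))"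
      using descent[of ?k] \<tau>0 by (intro mult_left_mono) (auto simp: d_def)
    ultimately have "?\<tau> * ((1 - \<rho>) * (d ?k \<bullet> H ?k (d ?k))) < ?\<tau> * (?\<tau> * L * (norm (d ?k))\<^sup>2)"
      by (simp add: power_mult_distrib power2_eq_square algebra_simps)
    then have "(1 - \<rho>) * (d ?k \<bullet> H ?k (d ?k)) < ?\<tau> * L * (norm (d ?k))\<^sup>2"
      using \<tau>0 by (simp only: mult_less_cancel_left_pos)
    moreover have "(1 - \<rho>) * (\<eta> * (norm (d ?k))\<^sup>2) \<le> (1 - \<rho>) * (d ?k \<bullet> H ?k (d ?k))"
      using d_H_lower params by (intro mult_left_mono) auto
    ultimately have "(1 - \<rho>) * \<eta> * (norm (d ?k))\<^sup>2 < ?\<tau> * L * (norm (d ?k))\<^sup>2" by simp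
    then have "(1 - \<rho>) * \<eta> < ?\<tau> * L" by (rule mult_right_less_imp_less) simp
    moreover have "?\<tau> * L < (1 - \<rho>) * \<eta>"
      using elim(1) params r0 by (auto simp: \<kappa>_def field_simps)
    ultimately show False by simp
  qed
  then show False by simp
qed

section \<open>Convergence of the whole sequence and of the multipliers\<close>

lemma residual_tendsto: "(\<lambda>k. G (u k) + H k (d k) + BT (w k)) \<longlonglongrightarrow> 0"
proof (rule Lim_null_comparison)
  have "eventually (\<lambda>k. norm (d k) < 1) sequentially"
    using tendstoD[OF d_tendsto_0, of 1] by simp
  then show "eventually (\<lambda>k. norm (G (u k) + H k (d k) + BT (w k)) \<le> c * (norm (d k))\<^sup>2) sequentially"
    by eventually_elim (use residual in \<open>simp add: d_def\<close>)
  have "(\<lambda>k. c * (norm (d k))\<^sup>2) \<longlonglongrightarrow> c * (norm (0::'a))\<^sup>2"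
    by (intro tendsto_intros d_tendsto_0)
  then show "(\<lambda>k. c * (norm (d k))\<^sup>2) \<longlonglongrightarrow> 0" by simp
qed

lemma H_d_tendsto: "(\<lambda>k. H k (d k)) \<longlonglongrightarrow> 0"
proof (rule Lim_null_comparison)
  show "eventually (\<lambda>k. norm (H k (d k)) \<le> \<beta> * norm (d k)) sequentially"
    using H_upper by simp
  have "(\<lambda>k. \<beta> * norm (d k)) \<longlonglongrightarrow> \<beta> * norm (0::'a)"
    by (intro tendsto_intros d_tendsto_0)
  then show "(\<lambda>k. \<beta> * norm (d k)) \<longlonglongrightarrow> 0" by simp
qed

lemma isCont_G: "p \<in> feas \<Longrightarrow> isCont G p"
  by (rule has_derivative_continuous[OF second_order_at_derivative[OF smooth]])

text \<open>Because the directions vanish, the trial points share the limit of the iterates and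
  \<open>H k (d k)\<close> drops out, so \<open>multiplier_convergence\<close> applies at the trial
  points.\<close>

lemma subsequence_multipliers:
  assumes q: "strict_mono q" and lim: "(\<lambda>k. u (q k)) \<longlonglongrightarrow> p"
  shows "\<exists>w'. (\<lambda>k. w (q k)) \<longlonglongrightarrow> w' \<and> mult p w' \<and> G p + BT w' = 0"
proof -
  have acc: "accumulation_point u p"
    unfolding accumulation_point_def using q lim by (auto simp: o_def)
  have dq: "(\<lambda>k. d (q k)) \<longlonglongrightarrow> 0"
    using LIMSEQ_subseq_LIMSEQ[OF d_tendsto_0 q] by (simp add: o_def)
  have Hq: "(\<lambda>k. H (q k) (d (q k))) \<longlonglongrightarrow> 0"
    using LIMSEQ_subseq_LIMSEQ[OF H_d_tendsto q] by (simp add: o_def)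
  show ?thesis
  proof (rule multiplier_convergence)
    show "licq p" by (rule regular[OF acc])
    show "(\<lambda>k. ut (q k)) \<longlonglongrightarrow> p" using tendsto_add[OF lim dq] by (simp add: d_def)
    show "mult (ut (q k)) (w (q k))" for k by (rule mult_w)
    show "(\<lambda>k. G (u (q k)) + H (q k) (d (q k))) \<longlonglongrightarrow> G p"
      using tendsto_add[OF isCont_tendsto_compose[OF isCont_G[OF accumulation_feas[OF acc]] lim] Hq] by simp
    show "(\<lambda>k. G (u (q k)) + H (q k) (d (q k)) + BT (w (q k))) \<longlonglongrightarrow> 0"
      using LIMSEQ_subseq_LIMSEQ[OF residual_tendsto q] by (simp add: o_def)
  qed
qed

lemma accumulation_error_bound:
  assumes "accumulation_point u p"
  shows "\<exists>C>0. \<exists>\<delta>>0. \<forall>z\<in>feas. \<forall>w. mult z w \<longrightarrow> norm (z - p) < \<delta> \<longrightarrow> norm (G z + BT w) < \<delta>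
            \<longrightarrow> norm (z - p) \<le> C * norm (G z + BT w)"
proof -
  obtain q where "strict_mono q" "(\<lambda>k. u (q k)) \<longlonglongrightarrow> p"
    using assms by (auto simp: accumulation_point_def o_def)
  from subsequence_multipliers[OF this] obtain w' where w': "mult p w'" "G p + BT w' = 0" by blast
  have p: "p \<in> feas" by (rule accumulation_feas[OF assms])
  show ?thesis
    by (rule error_bound[where A = "A p", OF p regular[OF assms] w' second_order[OF assms w']
          second_order_at_derivative[OF smooth[OF p]]])
qed

text \<open>Near an accumulation point the error bound, applied to the trial points, is of order
  \<open>norm (d k)\<close>; as the directions tend to zero, the iterates cannot leave again.\<close>

lemma u_convergent: "\<exists>p. u \<longlonglongrightarrow> p \<and> accumulation_point u p"
proof -
  obtain s p where s: "strict_mono s" and lim: "(\<lambda>k. u (s k)) \<longlonglongrightarrow> p" and p: "accumulation_point u p"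
    using ex_convergent_subsequence[OF strict_mono_id] by auto
  obtain C \<delta> where C: "C > 0" "\<delta> > 0" and EB: "\<And>z w. z \<in> feas \<Longrightarrow> mult z w \<Longrightarrow> norm (z - p) < \<delta> \<Longrightarrow>
      norm (G z + BT w) < \<delta> \<Longrightarrow> norm (z - p) \<le> C * norm (G z + BT w)"
    using accumulation_error_bound[OF p] by blast
  obtain r0 L where r0: "0 < r0" "0 < L" and
    Lip: "\<And>x z. x \<in> cball p r0 \<Longrightarrow> z \<in> cball p r0 \<Longrightarrow> norm (G z - G x) \<le> L * norm (z - x)"
    using second_order_at_Lipschitz[OF smooth[OF accumulation_feas[OF p]]] by blast
  \<comment> \<open>Collects the change of the gradient, the term \<open>H k (d k)\<close> and the
    subproblem residual: stationarity at the trial point fails by at most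
    \<open>K * norm (d k)\<close>.\<close>
  define K where "K = L + \<beta> + c"
  have K: "K > 0" using r0 params by (simp add: K_def)
  \<comment> \<open>Halved because the trial point may be up to \<open>2 * \<epsilon>\<close> away
    from \<open>p\<close> when the iterate is within \<open>\<epsilon>\<close>.\<close>
  define \<epsilon> where "\<epsilon> = min \<delta> r0 / 2"
  have \<epsilon>: "\<epsilon> > 0" "2 * \<epsilon> \<le> \<delta>" "2 * \<epsilon> \<le> r0" using C r0 by (auto simp: \<epsilon>_def)
  \<comment> \<open>The entry 1 admits the residual estimate, \<open>\<epsilon>\<close> controls the
    trial point, \<open>\<delta> / K\<close> admits the error bound, and the last entry returns the
    next iterate to the ball.\<close>
  define \<kappa> where "\<kappa> = Min {1, \<epsilon>, \<delta> / K, \<epsilon> / (C * K + 1)}"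
  have CK: "C * K + 1 > 0" using C K by (simp add: add_pos_pos)
  have "\<kappa> > 0" using \<epsilon> C K CK by (auto simp: \<kappa>_def)
  then have "eventually (\<lambda>k. norm (d k) < \<kappa>) sequentially"
    using tendstoD[OF d_tendsto_0, of \<kappa>] by simp
  then obtain N where N: "\<And>k. k \<ge> N \<Longrightarrow> norm (d k) < \<kappa>"
    unfolding eventually_sequentially by blast
  have next_close: "norm (u (Suc k) - p) \<le> (C * K + 1) * norm (d k)"
    and next_ball: "norm (u (Suc k) - p) < \<epsilon>" if k: "k \<ge> N" "norm (u k - p) < \<epsilon>" for k
  proof -
    have dk: "norm (d k) < 1" "norm (d k) < \<epsilon>" "K * norm (d k) < \<delta>" "(C * K + 1) * norm (d k) < \<epsilon>"
      using N[OF k(1)] K CK by (auto simp: \<kappa>_def field_simps)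
    have "norm (ut k - p) \<le> norm (u k - p) + norm (d k)"
      using norm_triangle_ineq[of "u k - p" "d k"] by (simp add: d_def)
    then have ut: "norm (ut k - p) < 2 * \<epsilon>" using k dk by simp
    have "norm (G (ut k) + BT (w k)) = norm ((G (ut k) - G (u k)) - H k (d k) + (G (u k) + H k (d k) + BT (w k)))"
      by (simp add: algebra_simps)
    also have "\<dots> \<le> norm (G (ut k) - G (u k)) + norm (H k (d k)) + norm (G (u k) + H k (d k) + BT (w k))"
      by (meson add_right_mono norm_triangle_ineq norm_triangle_ineq4 order_trans)
    also have "\<dots> \<le> L * norm (d k) + \<beta> * norm (d k) + c * norm (d k)"
    proof (intro add_mono H_upper)
      show "norm (G (ut k) - G (u k)) \<le> L * norm (d k)"
        unfolding d_def using ut k \<epsilon> by (intro Lip) (auto simp: dist_norm norm_minus_commute)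
      have "norm (G (u k) + H k (d k) + BT (w k)) \<le> c * (norm (d k))\<^sup>2"
        using residual[of k] dk by (simp add: d_def)
      also have "\<dots> \<le> c * norm (d k)"
        using dk params by (intro mult_left_mono) (auto simp: power2_eq_square mult_left_le)
      finally show "norm (G (u k) + H k (d k) + BT (w k)) \<le> c * norm (d k)" .
    qed
    finally have e: "norm (G (ut k) + BT (w k)) \<le> K * norm (d k)" by (simp add: K_def algebra_simps)
    have "norm (ut k - p) \<le> C * norm (G (ut k) + BT (w k))"
      by (rule EB[OF feas_ut mult_w]) (use ut \<epsilon> e dk in auto)
    also have "\<dots> \<le> C * (K * norm (d k))" using e C by (intro mult_left_mono) auto
    finally have 1: "norm (ut k - p) \<le> C * (K * norm (d k))" .
    \<comment> \<open>A shortened step misses the trial point by at most \<open>norm (d k)\<close>,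
      which accounts for the summand 1 in the constant.\<close>
    have "u (Suc k) - p = (ut k - p) - (1 - t k) *\<^sub>R d k"
      using step[of k] by (simp add: d_def algebra_simps)
    then have "norm (u (Suc k) - p) \<le> norm (ut k - p) + norm ((1 - t k) *\<^sub>R d k)"
      by (metis norm_triangle_ineq4)
    also have "norm ((1 - t k) *\<^sub>R d k) \<le> norm (d k)"
      using t_range[of k] by (simp add: mult_left_le_one_le)
    finally show "norm (u (Suc k) - p) \<le> (C * K + 1) * norm (d k)"
      using 1 by (simp add: algebra_simps)
    then show "norm (u (Suc k) - p) < \<epsilon>" using dk by simp
  qed
  have "eventually (\<lambda>k. dist (u (s k)) p < \<epsilon>) sequentially" by (rule tendstoD[OF lim \<epsilon>(1)])
  then obtain j where "j \<ge> N" "dist (u (s j)) p < \<epsilon>"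
    unfolding eventually_sequentially by (metis nle_le)
  then obtain k0 where k0: "k0 \<ge> N" "norm (u k0 - p) < \<epsilon>"
    using seq_suble[OF s, of j] by (auto simp: dist_norm intro: order_trans)
  have ball: "norm (u k - p) < \<epsilon>" if "k \<ge> k0" for k
    using that by (induction k rule: dec_induct) (use k0 next_ball in auto)
  have "(\<lambda>k. u (Suc k) - p) \<longlonglongrightarrow> 0"
  proof (rule Lim_null_comparison)
    show "eventually (\<lambda>k. norm (u (Suc k) - p) \<le> (C * K + 1) * norm (d k)) sequentially"
      unfolding eventually_sequentially using next_close ball k0 by (meson order_trans)
    have "(\<lambda>k. (C * K + 1) * norm (d k)) \<longlonglongrightarrow> (C * K + 1) * norm (0::'a)"
      by (intro tendsto_intros d_tendsto_0)
    then show "(\<lambda>k. (C * K + 1) * norm (d k)) \<longlonglongrightarrow> 0" by simp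
  qed
  then have "u \<longlonglongrightarrow> p" by (rule LIMSEQ_imp_Suc[OF LIM_zero_cancel])
  with p show ?thesis by blast
qed

lemma w_convergent:
  assumes "u \<longlonglongrightarrow> p"
  shows "\<exists>w'. w \<longlonglongrightarrow> w' \<and> mult p w' \<and> G p + BT w' = 0"
  using subsequence_multipliers[OF strict_mono_id] assms by simp

section \<open>Unit steps and the quadratic rate\<close>

text \<open>The vectors \<open>\<nu> k\<close> represent the part of the Hessian error in the span
  of the strongly active rows. Being small and supported where \<open>w'\<close> is nonzero, they
  can be absorbed into the multipliers: half of \<open>\<nu> k\<close> in the unit step test, all of
  it in the residual at the new point.\<close>

lemma quadratic_convergence:
  assumes lim: "u \<longlonglongrightarrow> p" and w': "w \<longlonglongrightarrow> w'"
    and \<nu>: "eventually (\<lambda>k. norm (H k (d k) - A (u k) (d k) - BT (\<nu> k)) \<le> e * (norm (d k))\<^sup>2 \<and>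
          norm (\<nu> k) \<le> e * norm (d k) \<and> (\<forall>i. \<nu> k $ i \<noteq> 0 \<longrightarrow> w' $ i \<noteq> 0)) sequentially"
  shows "(\<lambda>k. norm (u (Suc k) - p)) \<in> O(\<lambda>k. (norm (u k - p))\<^sup>2)"
proof -
  have p: "accumulation_point u p"
    unfolding accumulation_point_def using lim by (intro exI[of _ id]) (simp add: strict_mono_id)
  have pf: "p \<in> feas" by (rule accumulation_feas[OF p])
  obtain C \<delta> where C: "C > 0" "\<delta> > 0" and EB: "\<And>z w. z \<in> feas \<Longrightarrow> mult z w \<Longrightarrow> norm (z - p) < \<delta> \<Longrightarrow>
      norm (G z + BT w) < \<delta> \<Longrightarrow> norm (z - p) \<le> C * norm (G z + BT w)"
    using accumulation_error_bound[OF p] by blast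
  obtain r L where r: "0 < r" "0 < L" and
    dG: "\<And>x. x \<in> cball p r \<Longrightarrow> (G has_derivative A x) (at x)" and
    Tay: "\<And>x z. x \<in> cball p r \<Longrightarrow> z \<in> cball p r \<Longrightarrow> norm (G z - G x - A x (z - x)) \<le> L * (norm (z - x))\<^sup>2"
    by (rule second_order_atD[OF smooth[OF pf]]) blast
  obtain m where m: "m > 0" "\<And>i. w' $ i \<noteq> 0 \<Longrightarrow> m \<le> \<bar>w' $ i\<bar>"
    using nonzero_entries_bound by blast
  have ut_lim: "ut \<longlonglongrightarrow> p" using tendsto_add[OF lim d_tendsto_0] by (simp add: d_def)
  define K where "K = L + c + \<bar>e\<bar>"
  have K: "K > 0" using r params by (simp add: K_def)
  have \<nu>0: "\<nu> \<longlonglongrightarrow> 0"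
  proof (rule Lim_null_comparison)
    show "eventually (\<lambda>k. norm (\<nu> k) \<le> e * norm (d k)) sequentially"
      using \<nu> by eventually_elim simp
    have "(\<lambda>k. e * norm (d k)) \<longlonglongrightarrow> e * norm (0::'a)"
      by (intro tendsto_intros d_tendsto_0)
    then show "(\<lambda>k. e * norm (d k)) \<longlonglongrightarrow> 0" by simp
  qed
  \<comment> \<open>Where \<open>\<nu> k\<close> is nonzero, \<open>w'\<close> has modulus at least
    \<open>m\<close>, while \<open>w k - w'\<close> and \<open>\<nu> k\<close> are both below
    \<open>m / 2\<close>; the shift therefore preserves the sign of \<open>w k\<close>.\<close>
  have ev_mult: "eventually (\<lambda>k. \<forall>s. 0 \<le> s \<and> s \<le> 1 \<longrightarrow> mult (ut k) (w k + s *\<^sub>R \<nu> k)) sequentially"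
  proof -
    have "eventually (\<lambda>k. dist (w k) w' < m / 2) sequentially" using m by (intro tendstoD[OF w']) auto
    moreover have "eventually (\<lambda>k. dist (\<nu> k) 0 < m / 2) sequentially" using m by (intro tendstoD[OF \<nu>0]) auto
    ultimately show ?thesis
      using \<nu>
    proof eventually_elim
      case (elim k)
      show ?case
      proof (intro allI impI)
        fix s :: real assume s: "0 \<le> s \<and> s \<le> 1"
        have "(0 < (w k + s *\<^sub>R \<nu> k) $ i \<longrightarrow> 0 < w k $ i) \<and> ((w k + s *\<^sub>R \<nu> k) $ i < 0 \<longrightarrow> w k $ i < 0)" for i
        proof (cases "w' $ i = 0")
          case True
          then have "\<nu> k $ i = 0" using elim(3) by blast
          then show ?thesis by simp
        next
          case False
          have "\<bar>w k $ i - w' $ i\<bar> < m / 2"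
            using component_le_norm_cart[of "w k - w'" i] elim(1) by (simp add: dist_norm)
          moreover have "\<bar>\<nu> k $ i\<bar> < m / 2"
            using component_le_norm_cart[of "\<nu> k" i] elim(2) by (simp add: dist_norm)
          moreover have "\<bar>s * \<nu> k $ i\<bar> \<le> \<bar>\<nu> k $ i\<bar>"
            using s by (simp add: abs_mult mult_left_le_one_le)
          moreover have "(w k + s *\<^sub>R \<nu> k) $ i = w k $ i + s * \<nu> k $ i" by simp
          moreover have "m \<le> w' $ i \<or> w' $ i \<le> - m" using m(2)[OF False] by linarith
          ultimately have "(0 < w k $ i \<and> 0 < (w k + s *\<^sub>R \<nu> k) $ i) \<or> (w k $ i < 0 \<and> (w k + s *\<^sub>R \<nu> k) $ i < 0)"
            by linarith
          then show ?thesis by auto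
        qed
        then show "mult (ut k) (w k + s *\<^sub>R \<nu> k)"
          using mult_w[of k] unfolding mult_def by blast
      qed
    qed
  qed
  \<comment> \<open>The entries serve the residual estimate, the unit step test, where
    \<open>\<rho> < 1 / 2\<close> leaves a positive margin, and the smallness that the error bound
    requires.\<close>
  define \<kappa> where "\<kappa> = Min {1, (1 / 2 - \<rho>) * \<eta> / K, \<delta> / K}"
  have "\<kappa> > 0" using params K C by (auto simp: \<kappa>_def)
  then have ev_d: "eventually (\<lambda>k. norm (d k) < \<kappa>) sequentially"
    using tendstoD[OF d_tendsto_0, of \<kappa>] by simp
  \<comment> \<open>The last entry makes \<open>C * K * norm (ut k - p)\<close> at most 1/4; it
    later absorbs the term quadratic in the new error.\<close>
  define \<delta>' where "\<delta>' = Min {r, \<delta>, 1 / (4 * C * K)}"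
  have \<delta>'0: "\<delta>' > 0" using r C K by (auto simp: \<delta>'_def)
  have "eventually (\<lambda>k. norm (u (Suc k) - p) \<le> 4 * C * K * (norm (u k - p))\<^sup>2) sequentially"
    using \<nu> ev_mult ev_d tendstoD[OF lim \<delta>'0] tendstoD[OF ut_lim \<delta>'0]
  proof eventually_elim
    case (elim k)
    note \<nu>k = elim(1)
    have dk: "norm (d k) \<le> 1" "K * norm (d k) \<le> (1 / 2 - \<rho>) * \<eta>" "K * norm (d k) < \<delta>"
      using elim(3) K by (auto simp: \<kappa>_def field_simps)
    have uk: "u k \<in> cball p r" and utk: "ut k \<in> cball p r"
      using elim by (auto simp: \<delta>'_def dist_commute)
    have res: "norm (G (u k) + H k (d k) + BT (w k)) \<le> c * (norm (d k))\<^sup>2"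
      using residual[of k] dk by (simp add: d_def)
    have utk_eq: "u k + d k = ut k" by (simp add: d_def)
    have "\<Phi> (u k + d k) \<le> \<Phi> (u k) + G (u k) \<bullet> d k + d k \<bullet> A (u k) (d k) / 2 + L * (norm (d k)) ^ 3"
    proof (rule quadratic_expansion_bound[where S = "cball p r"])
      show "u k + d k \<in> cball p r" using utk utk_eq by simp
      show "linear (A (u k))" by (rule has_derivative_linear[OF dG[OF uk]])
    qed (fact gradient r(2) Tay convex_cball uk)+
    then have "\<Phi> (ut k) \<le> \<Phi> (u k) + G (u k) \<bullet> d k + d k \<bullet> A (u k) (d k) / 2 + L * (norm (d k)) ^ 3"
      by (simp only: utk_eq)
    moreover have "G (u k) \<bullet> d k + d k \<bullet> A (u k) (d k) / 2 \<le> - (d k \<bullet> H k (d k)) / 2 + (c + \<bar>e\<bar>) * (norm (d k)) ^ 3"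
    proof -
      let ?R1 = "G (u k) + H k (d k) + BT (w k)" and ?R2 = "H k (d k) - A (u k) (d k) - BT (\<nu> k)"
      \<comment> \<open>Substituting for \<open>G (u k)\<close> and for half of
        \<open>A (u k) (d k)\<close> leaves half of \<open>- (d k \<bullet> H k (d k))\<close>, two
        remainders of third order, and the multiplier shifted by half of
        \<open>\<nu> k\<close>.\<close>
      have "G (u k) \<bullet> d k + d k \<bullet> A (u k) (d k) / 2 =
          - (d k \<bullet> H k (d k)) / 2 + ?R1 \<bullet> d k - (?R2 \<bullet> d k) / 2 - BT (w k + (1/2) *\<^sub>R \<nu> k) \<bullet> d k"
        by (simp add: inner_diff_left inner_add_left BT_add BT_scale inner_commute[of "d k"] field_simps)
      moreover have "?R1 \<bullet> d k \<le> c * (norm (d k)) ^ 3"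
        using norm_cauchy_schwarz[of ?R1 "d k"] mult_right_mono[OF res, of "norm (d k)"]
        by (simp add: power2_eq_square power3_eq_cube mult.assoc)
      moreover have "- (?R2 \<bullet> d k) \<le> \<bar>e\<bar> * (norm (d k)) ^ 3"
      proof -
        have "norm ?R2 \<le> \<bar>e\<bar> * (norm (d k))\<^sup>2"
          using \<nu>k by (meson abs_ge_self mult_right_mono order_trans zero_le_power2)
        then show ?thesis
          using Cauchy_Schwarz_ineq2[of ?R2 "d k"] mult_right_mono[of "norm ?R2" "\<bar>e\<bar> * (norm (d k))\<^sup>2" "norm (d k)"]
          by (simp add: power2_eq_square power3_eq_cube mult.assoc)
      qed
      moreover have "0 \<le> \<bar>e\<bar> * (norm (d k)) ^ 3" by simp
      \<comment> \<open>As \<open>u k\<close> is feasible, the normal cone inequality at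
        \<open>ut k\<close> fixes the sign of this term, which can then be dropped.\<close>
      moreover have "BT (w k + (1/2) *\<^sub>R \<nu> k) \<bullet> d k \<ge> 0"
        using mult_normal_sum[OF elim(2)[rule_format, of "1/2"] feas_u[of k]]
        by (simp add: d_def inner_diff_right)
      ultimately show ?thesis unfolding distrib_right by linarith
    qed
    moreover have "K * (norm (d k)) ^ 3 \<le> (1 / 2 - \<rho>) * (d k \<bullet> H k (d k))"
    proof -
      have "K * norm (d k) * (norm (d k))\<^sup>2 \<le> (1 / 2 - \<rho>) * \<eta> * (norm (d k))\<^sup>2"
        using dk by (intro mult_right_mono) auto
      also have "\<dots> \<le> (1 / 2 - \<rho>) * (d k \<bullet> H k (d k))"
        using d_H_lower[of k] params by (simp add: mult.assoc)
      finally show ?thesis by (simp add: power2_eq_square power3_eq_cube mult.assoc)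
    qed
    ultimately have "\<Phi> (ut k) \<le> \<Phi> (u k) - \<rho> * (d k \<bullet> H k (d k))"
      by (simp add: K_def algebra_simps)
    then have "t k = 1" by (intro unit_step) (simp add: d_def)
    then have next_eq: "u (Suc k) = ut k" using step[of k] by simp
    have mw: "mult (ut k) (w k + \<nu> k)" using elim(2)[rule_format, of 1] by simp
    \<comment> \<open>With \<open>\<nu> k\<close> added to the multiplier, stationarity at the new
      point splits into a Taylor remainder, the subproblem residual and the remaining Hessian error,
      all of second order.\<close>
    have "norm (G (ut k) + BT (w k + \<nu> k)) = norm ((G (ut k) - G (u k) - A (u k) (d k))
        + (G (u k) + H k (d k) + BT (w k)) - (H k (d k) - A (u k) (d k) - BT (\<nu> k)))"
      by (simp add: BT_add algebra_simps)
    also have "\<dots> \<le> norm (G (ut k) - G (u k) - A (u k) (d k)) + norm (G (u k) + H k (d k) + BT (w k))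
        + norm (H k (d k) - A (u k) (d k) - BT (\<nu> k))"
      by (meson add_right_mono norm_triangle_ineq norm_triangle_ineq4 order_trans)
    also have "\<dots> \<le> L * (norm (d k))\<^sup>2 + c * (norm (d k))\<^sup>2 + \<bar>e\<bar> * (norm (d k))\<^sup>2"
    proof (intro add_mono res)
      show "norm (G (ut k) - G (u k) - A (u k) (d k)) \<le> L * (norm (d k))\<^sup>2"
        using Tay[OF uk utk] by (simp add: d_def)
      show "norm (H k (d k) - A (u k) (d k) - BT (\<nu> k)) \<le> \<bar>e\<bar> * (norm (d k))\<^sup>2"
        using \<nu>k by (meson abs_ge_self mult_right_mono order_trans zero_le_power2)
    qed
    finally have err: "norm (G (ut k) + BT (w k + \<nu> k)) \<le> K * (norm (d k))\<^sup>2"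
      by (simp add: K_def algebra_simps)
    have "K * (norm (d k))\<^sup>2 \<le> K * norm (d k)"
      using dk K by (intro mult_left_mono) (auto simp: power2_eq_square mult_left_le)
    with err dk have err': "norm (G (ut k) + BT (w k + \<nu> k)) < \<delta>" by simp
    let ?x = "norm (u k - p)" and ?y = "norm (ut k - p)"
    have y\<delta>: "?y < \<delta>" "?y \<le> 1 / (4 * C * K)" using elim by (auto simp: \<delta>'_def dist_norm)
    have "?y \<le> C * norm (G (ut k) + BT (w k + \<nu> k))"
      by (rule EB[OF feas_ut mw y\<delta>(1) err'])
    also have "\<dots> \<le> C * (K * (norm (d k))\<^sup>2)" using err C by (intro mult_left_mono) auto
    also have "\<dots> \<le> C * (K * (2 * ?y\<^sup>2 + 2 * ?x\<^sup>2))"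
    proof -
      have "norm (d k) \<le> ?y + ?x"
        using norm_triangle_ineq4[of "ut k - p" "u k - p"] by (simp add: d_def)
      then have "(norm (d k))\<^sup>2 \<le> (?y + ?x)\<^sup>2" by (intro power_mono) auto
      also have "\<dots> \<le> 2 * ?y\<^sup>2 + 2 * ?x\<^sup>2"
        using zero_le_power2[of "?y - ?x"] by (simp add: power2_eq_square algebra_simps)
      finally show ?thesis using C K by (intro mult_left_mono) auto
    qed
    also have "\<dots> = 2 * (C * K * ?y) * ?y + 2 * C * K * ?x\<^sup>2"
      by (simp add: power2_eq_square algebra_simps)
    \<comment> \<open>Half of the new error is moved to the left, which doubles the constant
      \<open>2 * C * K\<close>.\<close>
    also have "2 * (C * K * ?y) * ?y \<le> (1 / 2) * ?y"
    proof (rule mult_right_mono)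
      show "2 * (C * K * ?y) \<le> 1 / 2" using y\<delta>(2) C K by (simp add: field_simps)
    qed simp
    finally show "norm (u (Suc k) - p) \<le> 4 * C * K * ?x\<^sup>2" unfolding next_eq by simp
  qed
  then show ?thesis by (intro bigoI[of _ "4 * C * K"]) simp
qed

end

section \<open>Problem (Q) in row form\<close>

lemma transpose_mult_eq: "transpose A *v w = (\<Sum>i\<in>UNIV. w $ i *\<^sub>R A $ i)"
  for A :: "real ^ 'n ^ 'm"
  by (simp add: matrix_mult_sum column_transpose row_def scalar_mult_eq_scaleR)

lemma inner_transpose_mult: "(transpose A *v w) \<bullet> z = w \<bullet> (A *v z)"
  for A :: "real ^ 'n ^ 'm"
  by (metis dot_lmul_matrix transpose_matrix_vector)

section \<open>Rows, bounds and signed multipliers of problem (Q)\<close>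

text \<open>The coupling constraint is one-sided; its infinite lower bound is what makes its signed
  multiplier nonnegative.\<close>

definition row_low ::
  "('n1::finite, 'n2::finite, 'm::finite, 'c::finite, 'e::finite) problem \<Rightarrow> 'm + 'c + 'e \<Rightarrow> ereal" where
  "row_low Q i = (case i of Inl _ \<Rightarrow> - \<infinity> | Inr (Inl j) \<Rightarrow> lowC Q $ j | Inr (Inr j) \<Rightarrow> lowD Q $ j)"

definition row_upp ::
  "('n1::finite, 'n2::finite, 'm::finite, 'c::finite, 'e::finite) problem \<Rightarrow> 'm + 'c + 'e \<Rightarrow> ereal" where
  "row_upp Q i = (case i of Inl j \<Rightarrow> ereal (vecd Q $ j) | Inr (Inl j) \<Rightarrow> uppC Q $ j | Inr (Inr j) \<Rightarrow> uppD Q $ j)"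

text \<open>The two box arguments are signed, namely differences of upper and lower multipliers such
  as \<open>\<gamma>x - \<alpha>x\<close>.\<close>

definition row_mult :: "real ^ 'm \<Rightarrow> real ^ 'c \<Rightarrow> real ^ 'e \<Rightarrow> real ^ ('m + 'c + 'e)" where
  "row_mult \<mu> a b = (\<chi> i. case i of Inl j \<Rightarrow> \<mu> $ j | Inr (Inl j) \<Rightarrow> a $ j | Inr (Inr j) \<Rightarrow> b $ j)"

lemma row_low_simps [simp]:
  "row_low Q (Inl i) = - \<infinity>" "row_low Q (Inr (Inl j)) = lowC Q $ j" "row_low Q (Inr (Inr l)) = lowD Q $ l"
  by (simp_all add: row_low_def)

lemma row_upp_simps [simp]:
  "row_upp Q (Inl i) = ereal (vecd Q $ i)" "row_upp Q (Inr (Inl j)) = uppC Q $ j" "row_upp Q (Inr (Inr l)) = uppD Q $ l"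
  by (simp_all add: row_upp_def)

lemma row_mult_simps [simp]:
  "row_mult \<mu> a b $ Inl i = \<mu> $ i" "row_mult \<mu> a b $ Inr (Inl j) = a $ j" "row_mult \<mu> a b $ Inr (Inr l) = b $ l"
  by (simp_all add: row_mult_def)

lemma row_mult_components:
  "row_mult (\<chi> i. w $ Inl i) (\<chi> i. w $ Inr (Inl i)) (\<chi> i. w $ Inr (Inr i)) = w"
  by (simp add: vec_eq_iff split_sum_all)

text \<open>The shift of the residual by \<open>vecd Q\<close> matches the upper bound in
  \<open>row_upp\<close>. These equations take the place of unfolding \<open>brow\<close>, whose
  defining rules leave the simp set right after.\<close>

lemma brow_inner [simp]:
  "brow Q (Inl i) \<bullet> z = resid Q (fst z) (snd z) $ i + vecd Q $ i"
  "brow Q (Inr (Inl j)) \<bullet> z = (matC Q *v fst z) $ j"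
  "brow Q (Inr (Inr l)) \<bullet> z = (matD Q *v snd z) $ l"
  by (simp_all add: inner_prod_def resid_def matrix_vector_mul_component)

declare brow.simps [simp del]

abbreviation "rows_feas Q \<equiv> polyhedron.feas (brow Q) (row_low Q) (row_upp Q)"
abbreviation "rows_act Q \<equiv> polyhedron.act (brow Q) (row_low Q) (row_upp Q)"
abbreviation "rows_mult Q \<equiv> polyhedron.mult (brow Q) (row_low Q) (row_upp Q)"
abbreviation "rows_BT Q \<equiv> polyhedron.BT (brow Q)"
abbreviation "rows_licq Q \<equiv> polyhedron.licq (brow Q) (row_low Q) (row_upp Q)"
abbreviation "rows_curvature Q \<equiv> polyhedron.curvature (brow Q)"

lemma feas_eq_feasible: "rows_feas Q = feasible Q"
  by (auto simp: polyhedron.feas_def feasible_def split_sum_all setX_def setY_def bounded_by_def less_eq_vec_def)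

lemma act_eq_active_rows: "rows_act Q z = active_rows Q z"
  by (auto simp: polyhedron.act_def active_rows_def actS_def actI_def actJ_def act_low_def act_upp_def
      set_eq_iff split_sum_all)

lemma mult_row_mult_iff:
  "rows_mult Q z (row_mult \<mu> a b) \<longleftrightarrow>
     (\<forall>i. 0 \<le> \<mu> $ i \<and> (0 < \<mu> $ i \<longrightarrow> resid Q (fst z) (snd z) $ i = 0)) \<and>
     (\<forall>j. (0 < a $ j \<longrightarrow> ereal ((matC Q *v fst z) $ j) = uppC Q $ j) \<and>
          (a $ j < 0 \<longrightarrow> ereal ((matC Q *v fst z) $ j) = lowC Q $ j)) \<and>
     (\<forall>j. (0 < b $ j \<longrightarrow> ereal ((matD Q *v snd z) $ j) = uppD Q $ j) \<and>
          (b $ j < 0 \<longrightarrow> ereal ((matD Q *v snd z) $ j) = lowD Q $ j))"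
  by (auto simp: polyhedron.mult_def split_sum_all not_less)

lemma BT_row_mult:
  "rows_BT Q (row_mult \<mu> a b) =
     (transpose (matE Q) *v \<mu> + transpose (matC Q) *v a, transpose (matF Q) *v \<mu> + transpose (matD Q) *v b)"
proof -
  have sum_Plus: "(\<Sum>i\<in>UNIV. f i) = (\<Sum>i\<in>UNIV. f (Inl i)) + (\<Sum>i\<in>UNIV. f (Inr i))"
    for f :: "'x::finite + 'y::finite \<Rightarrow> 'z::comm_monoid_add"
    by (simp add: sum.Plus flip: UNIV_Plus_UNIV)
  show ?thesis
    by (simp add: polyhedron.BT_def sum_Plus transpose_mult_eq prod_eq_iff fst_sum snd_sum brow.simps
        del: transpose_matrix_vector)
qed

text \<open>Keeps the iterates feasible, each being a convex combination of the previous iterate and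
  its trial point.\<close>

lemma convex_feas: "convex (rows_feas Q)"
proof -
  have "convex {z. a \<le> ereal (brow Q i \<bullet> z)}" "convex {z. ereal (brow Q i \<bullet> z) \<le> a}" for a i
    by (cases a; simp add: convex_halfspace_ge convex_halfspace_le)+
  moreover have "rows_feas Q = (\<Inter>i. {z. row_low Q i \<le> ereal (brow Q i \<bullet> z)} \<inter> {z. ereal (brow Q i \<bullet> z) \<le> row_upp Q i})"
    by (auto simp: polyhedron.feas_def)
  ultimately show ?thesis by (auto intro!: convex_INT convex_Int)
qed

section \<open>Translation of complementarity conditions\<close>

lemma complementary_positive: "complementary p q \<Longrightarrow> 0 < p $ i \<Longrightarrow> q $ i = 0"
proof -
  assume c: "complementary p q" and p: "0 < p $ i"
  have "(\<Sum>i\<in>UNIV. p $ i * q $ i) = 0" using c by (simp add: complementary_def inner_vec_def)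
  then have "\<forall>i\<in>UNIV. p $ i * q $ i = 0"
    by (subst (asm) sum_nonneg_eq_0_iff) (use c in \<open>auto simp: complementary_def less_eq_vec_def\<close>)
  then have "p $ i = 0 \<or> q $ i = 0" by auto
  then show "q $ i = 0" using p by auto
qed

text \<open>All summands of the two complementarity sums are nonnegative, at infinite bounds because
  the multiplier is zero there, so each summand vanishes. The difference can be positive only where
  \<open>\<gamma>\<close> is, and negative only where \<open>\<alpha>\<close> is.\<close>

lemma box_complementary_active:
  assumes adm: "admissible_bounds l v" and box: "box_complementary C l v x \<alpha> \<gamma>"
  shows "(0 < (\<gamma> - \<alpha>) $ i \<longrightarrow> ereal ((C *v x) $ i) = v $ i) \<and> ((\<gamma> - \<alpha>) $ i < 0 \<longrightarrow> ereal ((C *v x) $ i) = l $ i)"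
proof -
  have \<alpha>0: "\<And>i. 0 \<le> \<alpha> $ i" and \<gamma>0: "\<And>i. 0 \<le> \<gamma> $ i"
    and x: "\<And>i. l $ i \<le> ereal ((C *v x) $ i)" "\<And>i. ereal ((C *v x) $ i) \<le> v $ i"
    and inf: "\<And>i. l $ i = -\<infinity> \<Longrightarrow> \<alpha> $ i = 0" "\<And>i. v $ i = \<infinity> \<Longrightarrow> \<gamma> $ i = 0"
    and s: "(\<Sum>i\<in>UNIV. \<alpha> $ i * ((C *v x) $ i - real_of_ereal (l $ i))) = 0"
      "(\<Sum>i\<in>UNIV. \<gamma> $ i * (real_of_ereal (v $ i) - (C *v x) $ i)) = 0"
    using box by (auto simp: box_complementary_def bounded_by_def less_eq_vec_def)
  have lv: "l $ i \<noteq> \<infinity>" "v $ i \<noteq> - \<infinity>" for i using adm by (auto simp: admissible_bounds_def)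
  have n1: "0 \<le> \<alpha> $ i * ((C *v x) $ i - real_of_ereal (l $ i))" for i
    using \<alpha>0[of i] x(1)[of i] inf(1)[of i] lv(1)[of i] by (cases "l $ i") auto
  have n2: "0 \<le> \<gamma> $ i * (real_of_ereal (v $ i) - (C *v x) $ i)" for i
    using \<gamma>0[of i] x(2)[of i] inf(2)[of i] lv(2)[of i] by (cases "v $ i") auto
  have z1: "\<alpha> $ i * ((C *v x) $ i - real_of_ereal (l $ i)) = 0"
    using s(1) n1 by (subst (asm) sum_nonneg_eq_0_iff) auto
  have z2: "\<gamma> $ i * (real_of_ereal (v $ i) - (C *v x) $ i) = 0"
    using s(2) n2 by (subst (asm) sum_nonneg_eq_0_iff) auto
  have "0 < \<alpha> $ i \<longrightarrow> ereal ((C *v x) $ i) = l $ i"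
    using z1 inf(1)[of i] lv(1)[of i] by (cases "l $ i") auto
  moreover have "0 < \<gamma> $ i \<longrightarrow> ereal ((C *v x) $ i) = v $ i"
    using z2 inf(2)[of i] lv(2)[of i] by (cases "v $ i") auto
  ultimately show ?thesis using \<alpha>0[of i] \<gamma>0[of i] by simp
qed

text \<open>Converse translation: the positive and negative parts of a signed multiplier become the
  multipliers of the upper and the lower bound.\<close>

lemma box_complementary_parts:
  assumes x: "x \<in> bounded_by C l v"
    and a: "\<And>i. (0 < a $ i \<longrightarrow> ereal ((C *v x) $ i) = v $ i) \<and> (a $ i < 0 \<longrightarrow> ereal ((C *v x) $ i) = l $ i)"
  shows "box_complementary C l v x (\<chi> i. max 0 (- a $ i)) (\<chi> i. max 0 (a $ i))"
proof -
  have "max 0 (- a $ i) * ((C *v x) $ i - real_of_ereal (l $ i)) = 0"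
    "max 0 (a $ i) * (real_of_ereal (v $ i) - (C *v x) $ i) = 0"
    "l $ i = - \<infinity> \<Longrightarrow> max 0 (- a $ i) = 0" "v $ i = \<infinity> \<Longrightarrow> max 0 (a $ i) = 0" for i
  proof -
    have "0 < a $ i \<Longrightarrow> v $ i = ereal ((C *v x) $ i)" "a $ i < 0 \<Longrightarrow> l $ i = ereal ((C *v x) $ i)"
      using a[of i] by auto
    then show "max 0 (- a $ i) * ((C *v x) $ i - real_of_ereal (l $ i)) = 0"
      "max 0 (a $ i) * (real_of_ereal (v $ i) - (C *v x) $ i) = 0"
      "l $ i = - \<infinity> \<Longrightarrow> max 0 (- a $ i) = 0" "v $ i = \<infinity> \<Longrightarrow> max 0 (a $ i) = 0"
      by (cases "a $ i" "0 :: real" rule: linorder_cases; simp add: max_def)+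
  qed
  then show ?thesis using x by (auto simp: box_complementary_def less_eq_vec_def intro!: sum.neutral)
qed

section \<open>Smoothness of the separable objective\<close>

text \<open>A ball in the product space projects into balls of the same radius, so the estimates
  hold in each component and the constants add up.\<close>

lemma second_order_at_Pair:
  assumes "second_order_at G1 A1 p1" "second_order_at G2 A2 p2"
  shows "second_order_at (\<lambda>u. (G1 (fst u), G2 (snd u))) (\<lambda>u h. (A1 (fst u) (fst h), A2 (snd u) (snd h))) (p1, p2)"
proof -
  from assms obtain L1 L2 where
    "eventually (\<lambda>r. (\<forall>x\<in>cball p1 r. (G1 has_derivative A1 x) (at x) \<and> (\<forall>h. norm (A1 x h) \<le> L1 * norm h) \<and>
      (\<forall>z\<in>cball p1 r. norm (G1 z - G1 x - A1 x (z - x)) \<le> L1 * (norm (z - x))\<^sup>2))) (at_right 0)"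
    "eventually (\<lambda>r. (\<forall>x\<in>cball p2 r. (G2 has_derivative A2 x) (at x) \<and> (\<forall>h. norm (A2 x h) \<le> L2 * norm h) \<and>
      (\<forall>z\<in>cball p2 r. norm (G2 z - G2 x - A2 x (z - x)) \<le> L2 * (norm (z - x))\<^sup>2))) (at_right 0)"
    unfolding second_order_at_def by blast
  then show ?thesis
    unfolding second_order_at_def
  proof (intro exI[of _ "\<bar>L1\<bar> + \<bar>L2\<bar>"], eventually_elim, intro ballI)
    case (elim r)
    fix x assume x: "x \<in> cball (p1, p2) r"
    have comp: "fst z \<in> cball p1 r" "snd z \<in> cball p2 r" if "z \<in> cball (p1, p2) r" for z
      using that dist_fst_le[of "(p1, p2)" z] dist_snd_le[of "(p1, p2)" z] by auto
    have D1: "(G1 has_derivative A1 (fst x)) (at (fst x))" and D2: "(G2 has_derivative A2 (snd x)) (at (snd x))"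
      and B1: "\<And>h. norm (A1 (fst x) h) \<le> L1 * norm h" and B2: "\<And>h. norm (A2 (snd x) h) \<le> L2 * norm h"
      and T1: "\<And>z. z \<in> cball p1 r \<Longrightarrow> norm (G1 z - G1 (fst x) - A1 (fst x) (z - fst x)) \<le> L1 * (norm (z - fst x))\<^sup>2"
      and T2: "\<And>z. z \<in> cball p2 r \<Longrightarrow> norm (G2 z - G2 (snd x) - A2 (snd x) (z - snd x)) \<le> L2 * (norm (z - snd x))\<^sup>2"
      using elim comp[OF x] by blast+
    have "((\<lambda>u. G1 (fst u)) has_derivative (\<lambda>h. A1 (fst x) (fst h))) (at x)"
      by (rule has_derivative_compose[OF has_derivative_fst[OF has_derivative_ident] D1])
    moreover have "((\<lambda>u. G2 (snd u)) has_derivative (\<lambda>h. A2 (snd x) (snd h))) (at x)"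
      by (rule has_derivative_compose[OF has_derivative_snd[OF has_derivative_ident] D2])
    ultimately have "((\<lambda>u. (G1 (fst u), G2 (snd u))) has_derivative (\<lambda>h. (A1 (fst x) (fst h), A2 (snd x) (snd h)))) (at x)"
      by (rule has_derivative_Pair)
    moreover have "norm (A1 (fst x) (fst h), A2 (snd x) (snd h)) \<le> (\<bar>L1\<bar> + \<bar>L2\<bar>) * norm h" for h
    proof -
      have "L1 * norm (fst h) \<le> \<bar>L1\<bar> * norm h" "L2 * norm (snd h) \<le> \<bar>L2\<bar> * norm h"
        using norm_fst_le[of "fst h" "snd h"] norm_snd_le[of "snd h" "fst h"] by (auto intro: mult_mono)
      then show ?thesis
        using norm_Pair_le[of "A1 (fst x) (fst h)" "A2 (snd x) (snd h)"] B1[of "fst h"] B2[of "snd h"]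
        by (simp add: distrib_right)
    qed
    moreover have "norm ((G1 (fst z), G2 (snd z)) - (G1 (fst x), G2 (snd x)) - (A1 (fst x) (fst (z - x)), A2 (snd x) (snd (z - x))))
        \<le> (\<bar>L1\<bar> + \<bar>L2\<bar>) * (norm (z - x))\<^sup>2" if z: "z \<in> cball (p1, p2) r" for z
    proof -
      let ?a = "G1 (fst z) - G1 (fst x) - A1 (fst x) (fst z - fst x)"
        and ?b = "G2 (snd z) - G2 (snd x) - A2 (snd x) (snd z - snd x)"
      have "norm (fst z - fst x) \<le> norm (z - x)" "norm (snd z - snd x) \<le> norm (z - x)"
        using dist_fst_le[of z x] dist_snd_le[of z x] by (simp_all add: dist_norm)
      then have "L1 * (norm (fst z - fst x))\<^sup>2 \<le> \<bar>L1\<bar> * (norm (z - x))\<^sup>2"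
        "L2 * (norm (snd z - snd x))\<^sup>2 \<le> \<bar>L2\<bar> * (norm (z - x))\<^sup>2"
        by (auto intro!: mult_mono power_mono)
      then have "norm (?a, ?b) \<le> (\<bar>L1\<bar> + \<bar>L2\<bar>) * (norm (z - x))\<^sup>2"
        using norm_Pair_le[of ?a ?b] T1[OF comp(1)[OF z]] T2[OF comp(2)[OF z]]
        by (simp add: distrib_right)
      then show ?thesis by simp
    qed
    ultimately show "((\<lambda>u. (G1 (fst u), G2 (snd u))) has_derivative (\<lambda>h. (A1 (fst x) (fst h), A2 (snd x) (snd h)))) (at x) \<and>
      (\<forall>h. norm (A1 (fst x) (fst h), A2 (snd x) (snd h)) \<le> (\<bar>L1\<bar> + \<bar>L2\<bar>) * norm h) \<and>
      (\<forall>z\<in>cball (p1, p2) r. norm ((G1 (fst z), G2 (snd z)) - (G1 (fst x), G2 (snd x)) - (A1 (fst x) (fst (z - x)), A2 (snd x) (snd (z - x))))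
        \<le> (\<bar>L1\<bar> + \<bar>L2\<bar>) * (norm (z - x))\<^sup>2)"
      by blast
  qed
qed

text \<open>By uniqueness of derivatives, \<open>A\<close> may be replaced near \<open>p\<close> by
  the operator from the definition of \<open>hessian\<close>.\<close>

lemma second_order_at_frechet:
  assumes "second_order_at G A p"
  shows "second_order_at G (\<lambda>x. frechet_derivative G (at x)) p"
proof -
  obtain L where "eventually (\<lambda>r. \<forall>x\<in>cball p r. (G has_derivative A x) (at x) \<and>
      (\<forall>h. norm (A x h) \<le> L * norm h) \<and>
      (\<forall>z\<in>cball p r. norm (G z - G x - A x (z - x)) \<le> L * (norm (z - x))\<^sup>2)) (at_right 0)"
    using assms unfolding second_order_at_def by blast
  then show ?thesis
    unfolding second_order_at_def
  proof (intro exI[of _ L], eventually_elim, intro ballI)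
    case (elim r)
    fix x assume x: "x \<in> cball p r"
    then have "frechet_derivative G (at x) = A x"
      using elim frechet_derivative_at by metis
    with elim x show "(G has_derivative frechet_derivative G (at x)) (at x) \<and>
      (\<forall>h. norm (frechet_derivative G (at x) h) \<le> L * norm h) \<and>
      (\<forall>z\<in>cball p r. norm (G z - G x - frechet_derivative G (at x) (z - x)) \<le> L * (norm (z - x))\<^sup>2)"
      by simp
  qed
qed

lemma
  assumes "well_posed Q"
  shows gradient_\<Phi>: "gradient (\<Phi> Q) u = (gradient (objx Q) (fst u), gradient (objy Q) (snd u))"
    and has_derivative_\<Phi>: "(\<Phi> Q has_derivative (\<lambda>h. gradient (\<Phi> Q) u \<bullet> h)) (at u)"
proof -
  have "objx Q differentiable at (fst u)" "objy Q differentiable at (snd u)"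
    using assms by (auto simp: well_posed_def)
  note D = this[THEN has_derivative_gradient]
  have "((\<lambda>u. objx Q (fst u)) has_derivative (\<lambda>h. gradient (objx Q) (fst u) \<bullet> fst h)) (at u)"
    by (rule has_derivative_compose[OF has_derivative_fst[OF has_derivative_ident] D(1)])
  moreover have "((\<lambda>u. objy Q (snd u)) has_derivative (\<lambda>h. gradient (objy Q) (snd u) \<bullet> snd h)) (at u)"
    by (rule has_derivative_compose[OF has_derivative_snd[OF has_derivative_ident] D(2)])
  ultimately have "((\<lambda>u. objx Q (fst u) + objy Q (snd u)) has_derivative
      (\<lambda>h. gradient (objx Q) (fst u) \<bullet> fst h + gradient (objy Q) (snd u) \<bullet> snd h)) (at u)"
    by (rule has_derivative_add)
  then
  have *: "(\<Phi> Q has_derivative (\<lambda>h. (gradient (objx Q) (fst u), gradient (objy Q) (snd u)) \<bullet> h)) (at u)"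
    by (simp add: \<Phi>_def[abs_def] inner_prod_def)
  show "gradient (\<Phi> Q) u = (gradient (objx Q) (fst u), gradient (objy Q) (snd u))"
    by (rule gradient_eq[OF *])
  with * show "(\<Phi> Q has_derivative (\<lambda>h. gradient (\<Phi> Q) u \<bullet> h)) (at u)" by simp
qed

lemma second_order_at_\<Phi>:
  assumes "well_posed Q" "open U" "open V" "C_k_on 3 (objx Q) U" "C_k_on 3 (objy Q) V" "p \<in> U \<times> V"
  shows "second_order_at (gradient (\<Phi> Q)) (hessian (\<Phi> Q)) p"
proof -
  obtain p1 p2 where p: "p = (p1, p2)" "p1 \<in> U" "p2 \<in> V" using assms(6) by auto
  have "gradient (\<Phi> Q) = (\<lambda>u. (gradient (objx Q) (fst u), gradient (objy Q) (snd u)))"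
    using gradient_\<Phi>[OF assms(1)] by blast
  then show ?thesis
    using second_order_at_frechet[OF second_order_at_Pair[OF
        second_order_at_gradient[OF assms(4,2) p(2)] second_order_at_gradient[OF assms(5,3) p(3)]]]
    by (simp add: hessian_def[abs_def] p)
qed

section \<open>Full row rank and the projection\<close>

text \<open>A dimension equal to the number of rows forces \<open>brow Q\<close> to be injective on
  \<open>R\<close> with independent image, so a vanishing combination has only zero
  coefficients.\<close>

lemma full_row_rank_independent:
  assumes rank: "full_row_rank Q R" and w: "w \<in> supported R" "rows_BT Q w = 0"
  shows "w = 0"
proof -
  have "card R = dim (brow Q ` R)" using rank by (simp add: full_row_rank_def)
  also have "\<dots> \<le> card (brow Q ` R)" by (rule dim_le_card') simp
  finally have card: "card (brow Q ` R) = card R" by (simp add: card_image_le le_antisym)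
  then have inj: "inj_on (brow Q) R" by (intro eq_card_imp_inj_on) auto
  have ind: "independent (brow Q ` R)"
    by (rule card_le_dim_spanning[OF subset_refl span_superset]) (use rank card in \<open>auto simp: full_row_rank_def\<close>)
  have sum0: "(\<Sum>v\<in>brow Q ` R. w $ the_inv_into R (brow Q) v *\<^sub>R v) = 0"
  proof -
    have "(\<Sum>v\<in>brow Q ` R. w $ the_inv_into R (brow Q) v *\<^sub>R v) = (\<Sum>i\<in>R. w $ i *\<^sub>R brow Q i)"
      by (subst sum.reindex[OF inj]) (simp add: the_inv_into_f_f[OF inj])
    also have "\<dots> = rows_BT Q w"
      unfolding polyhedron.BT_def using w(1) by (intro sum.mono_neutral_left) (auto simp: supported_def)
    finally show ?thesis using w(2) by simp
  qed
  have "w $ the_inv_into R (brow Q) (brow Q i) = 0" if "i \<in> R" for i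
    by (rule independentD[OF ind _ _ sum0]) (use that in auto)
  then show "w = 0"
    using w(1) by (auto simp: supported_def vec_eq_iff the_inv_into_f_f[OF inj])
qed

lemma licq_active_rows: "full_row_rank Q (active_rows Q p) \<Longrightarrow> rows_licq Q p"
  unfolding polyhedron.licq_def act_eq_active_rows using full_row_rank_independent by blast

text \<open>For rows of full rank the inverse of \<open>B B\<^sup>T\<close> in the definition of the projection exists.\<close>

lemma proj_decomposition:
  fixes Q :: "('n1::finite, 'n2::finite, 'm::finite, 'c::finite, 'e::finite) problem"
  assumes rank: "full_row_rank Q R"
  shows "\<exists>K. \<forall>z. \<exists>\<nu>\<in>supported R. z - proj Q R z = rows_BT Q \<nu> \<and> norm \<nu> \<le> K * norm z"
proof -
  let ?V = "supported R" and ?BT = "rows_BT Q"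
  let ?M = "\<lambda>w. Bmul Q R (BTmul Q R w)"
  have sub: "subspace ?V" by (rule polyhedron.subspace_supported)
  have lBT: "linear ?BT" by (rule polyhedron.linear_BT)
  have BT_eq: "BTmul Q R w = ?BT w" if "w \<in> ?V" for w
    unfolding BTmul_def polyhedron.BT_def using that
    by (intro sum.mono_neutral_left) (auto simp: supported_def)
  \<comment> \<open>\<open>Bmul\<close> is adjoint to \<open>?BT\<close>; a vector of
    \<open>?V\<close> annihilated by \<open>?M\<close> therefore has image of norm zero under
    \<open>?BT\<close> and is zero by independence.\<close>
  have adj: "w \<bullet> Bmul Q R z = ?BT w \<bullet> z" if "w \<in> ?V" for w z
    unfolding polyhedron.inner_BT inner_vec_def
    by (rule sum.cong) (use that in \<open>auto simp: Bmul_def supported_def\<close>)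
  have BmulV: "Bmul Q R z \<in> ?V" for z by (auto simp: Bmul_def supported_def)
  have lM: "linear ?M"
    by (rule linearI)
      (auto simp: Bmul_def BTmul_def vec_eq_iff inner_add_right inner_sum_right algebra_simps sum.distrib sum_distrib_left)
  have "w = 0" if "w \<in> ?V" "?M w = 0" for w
  proof -
    have "?BT w \<bullet> ?BT w = 0" using adj[OF that(1), of "?BT w"] that BT_eq by simp
    then show ?thesis using full_row_rank_independent[OF rank that(1)] by simp
  qed
  then have inj: "inj_on ?M ?V"
    using linear_inj_on_iff_eq_0[OF lM sub] by blast
  \<comment> \<open>An injective linear map of a finite-dimensional space into itself is onto, so
    the inverse used in \<open>proj\<close> exists at \<open>Bmul Q R z\<close>.\<close>
  have img: "?M ` ?V = ?V"
  proof (rule subspace_dim_equal)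
    show "subspace (?M ` ?V)" by (rule linear_subspace_image[OF lM sub])
    show "dim ?V \<le> dim (?M ` ?V)"
      using dim_image_eq[OF lM, of ?V] inj sub by (simp add: span_eq_iff[THEN iffD2])
    show "?M ` ?V \<subseteq> ?V" by (rule image_subsetI) (rule BmulV)
  qed (rule sub)
  have Bmul_img: "Bmul Q R z \<in> ?M ` ?V" for z unfolding img by (rule BmulV)
  obtain e where e: "e > 0" "\<And>w. w \<in> ?V \<Longrightarrow> e * norm w \<le> norm (?BT w)"
    using injective_imp_isometric[OF closed_subspace[OF sub] sub linear_conv_bounded_linear[THEN iffD1, OF lBT]]
      full_row_rank_independent[OF rank] by blast
  show ?thesis
  proof (intro exI[of _ "1 / e"] allI)
    fix z
    define \<nu> where "\<nu> = the_inv_into ?V ?M (Bmul Q R z)"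
    have \<nu>V: "\<nu> \<in> ?V"
      unfolding \<nu>_def by (rule the_inv_into_into[OF inj Bmul_img subset_refl])
    have M\<nu>: "?M \<nu> = Bmul Q R z"
      unfolding \<nu>_def by (rule f_the_inv_into_f[OF inj Bmul_img])
    \<comment> \<open>\<open>?BT \<nu>\<close> is the orthogonal projection of \<open>z\<close> onto
      the row space and hence no longer than \<open>z\<close>.\<close>
    have "?BT \<nu> \<bullet> ?BT \<nu> = ?BT \<nu> \<bullet> z"
      using adj[OF \<nu>V, of "?BT \<nu>"] adj[OF \<nu>V, of z] M\<nu> BT_eq[OF \<nu>V] by simp
    then have "norm (?BT \<nu>) * norm (?BT \<nu>) \<le> norm z * norm (?BT \<nu>)"
      using norm_cauchy_schwarz[of "?BT \<nu>" z] by (simp add: dot_square_norm power2_eq_square mult.commute)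
    then have "norm (?BT \<nu>) \<le> norm z" by (cases "?BT \<nu> = 0") auto
    with e(2)[OF \<nu>V] have "norm \<nu> \<le> 1 / e * norm z"
      using e(1) by (simp add: field_simps)
    moreover have "z - proj Q R z = ?BT \<nu>"
      using BT_eq[OF \<nu>V] by (simp add: proj_def \<nu>_def)
    ultimately show "\<exists>\<nu>\<in>?V. z - proj Q R z = ?BT \<nu> \<and> norm \<nu> \<le> 1 / e * norm z"
      using \<nu>V by blast
  qed
qed

section \<open>Translation of the hypotheses at accumulation points\<close>

text \<open>Leads back from signed multipliers to those of (Q), so that assumptions about KKT
  multipliers apply to the limits found in row form.\<close>

lemma KKT_of_rows:
  assumes Q: "well_posed Q" and p: "p \<in> feasible Q" and w: "rows_mult Q p w" "gradient (\<Phi> Q) p + rows_BT Q w = 0"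
  shows "KKT Q p (\<chi> i. w $ Inl i) (\<chi> j. max 0 (- w $ Inr (Inl j))) (\<chi> j. max 0 (w $ Inr (Inl j)))
     (\<chi> j. max 0 (- w $ Inr (Inr j))) (\<chi> j. max 0 (w $ Inr (Inr j)))"
proof -
  let ?\<mu> = "\<chi> i. w $ Inl i" and ?a = "\<chi> j. w $ Inr (Inl j)" and ?b = "\<chi> j. w $ Inr (Inr j)"
  have diff: "(\<chi> j. max 0 (w $ Inr (Inl j))) - (\<chi> j. max 0 (- w $ Inr (Inl j))) = ?a"
    "(\<chi> j. max 0 (w $ Inr (Inr j))) - (\<chi> j. max 0 (- w $ Inr (Inr j))) = ?b"
    by (simp_all add: vec_eq_iff max_def)
  have "gradient (\<Phi> Q) p + rows_BT Q (row_mult ?\<mu> ?a ?b) = 0" using w(2) by (simp add: row_mult_components)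
  then have G: "gradient (objx Q) (fst p) + transpose (matE Q) *v ?\<mu> + transpose (matC Q) *v ?a = 0"
    "gradient (objy Q) (snd p) + transpose (matF Q) *v ?\<mu> + transpose (matD Q) *v ?b = 0"
    by (simp_all add: BT_row_mult gradient_\<Phi>[OF Q] prod_eq_iff add.assoc del: transpose_matrix_vector)
  have "rows_mult Q p (row_mult ?\<mu> ?a ?b)" using w(1) by (simp add: row_mult_components)
  note m = this[unfolded mult_row_mult_iff]
  have feas: "fst p \<in> bounded_by (matC Q) (lowC Q) (uppC Q)" "snd p \<in> bounded_by (matD Q) (lowD Q) (uppD Q)"
    "resid Q (fst p) (snd p) \<le> 0"
    using p by (auto simp: feasible_def setX_def setY_def)
  have "w $ Inl i * resid Q (fst p) (snd p) $ i = 0" for i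
    using m by (cases "w $ Inl i = 0") (auto simp: less_le)
  then have "?\<mu> \<bullet> - resid Q (fst p) (snd p) = 0"
    unfolding inner_vec_def by (intro sum.neutral) simp
  then have "complementary ?\<mu> (- resid Q (fst p) (snd p))"
    using m feas(3) by (simp add: complementary_def less_eq_vec_def)
  moreover have "box_complementary (matC Q) (lowC Q) (uppC Q) (fst p)
      (\<chi> j. max 0 (- ?a $ j)) (\<chi> j. max 0 (?a $ j))"
    by (rule box_complementary_parts[OF feas(1)]) (use m in blast)
  moreover have "box_complementary (matD Q) (lowD Q) (uppD Q) (snd p)
      (\<chi> j. max 0 (- ?b $ j)) (\<chi> j. max 0 (?b $ j))"
    by (rule box_complementary_parts[OF feas(2)]) (use m in blast)
  ultimately show ?thesis
    unfolding KKT_def diff using G by simp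
qed

lemma curvature_of_second_order_condition:
  assumes "second_order_condition Q p (\<chi> i. w $ Inl i) (\<chi> j. max 0 (- w $ Inr (Inl j))) (\<chi> j. max 0 (w $ Inr (Inl j)))
     (\<chi> j. max 0 (- w $ Inr (Inr j))) (\<chi> j. max 0 (w $ Inr (Inr j)))"
  shows "rows_curvature Q (hessian (\<Phi> Q) p) w"
  unfolding polyhedron.curvature_def
proof (intro allI impI)
  fix z assume z: "z \<noteq> 0" "\<forall>i. w $ i \<noteq> 0 \<longrightarrow> brow Q i \<bullet> z = 0"
  let ?R = "strongly_active_rows Q p (\<chi> i. w $ Inl i) (\<chi> j. max 0 (- w $ Inr (Inl j))) (\<chi> j. max 0 (w $ Inr (Inl j)))
     (\<chi> j. max 0 (- w $ Inr (Inr j))) (\<chi> j. max 0 (w $ Inr (Inr j)))"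
  have "w $ i \<noteq> 0" if "i \<in> ?R" for i
    using that by (auto simp: strongly_active_rows_def)
  then have "Bmul Q ?R z = 0" using z(2) by (simp add: Bmul_def vec_eq_iff)
  with z(1) assms show "0 < z \<bullet> hessian (\<Phi> Q) p z"
    unfolding second_order_condition_def by blast
qed

lemma nonzero_of_strict_complementarity:
  assumes "strict_complementarity Q p (\<chi> i. w $ Inl i) (\<chi> j. max 0 (- w $ Inr (Inl j))) (\<chi> j. max 0 (w $ Inr (Inl j)))
     (\<chi> j. max 0 (- w $ Inr (Inr j))) (\<chi> j. max 0 (w $ Inr (Inr j)))"
    and "i \<in> active_rows Q p"
  shows "w $ i \<noteq> 0"
  using assms by (fastforce simp: strict_complementarity_def active_rows_def actI_def actJ_def)

section \<open>Properties of the trial points\<close>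

text \<open>The residual is affine in each block. If both relaxed constraints of Step 1 are tight in
  a component, the right hand side there is two halves of the old residual minus the whole, hence
  zero.\<close>

lemma resid_split:
  "resid Q (fst ut) (snd ut) = resid Q (fst ut) (snd u) + resid Q (fst u) (snd ut) - resid Q (fst u) (snd u)"
  by (simp add: resid_def)

lemma trial_rows_active: "trial_rows Q orig u ut \<subseteq> active_rows Q ut"
  by (cases orig)
    (auto simp: trial_rows_def active_rows_def trial_actS_def actS_def resid_split[of Q ut u])

text \<open>Stationarity is tested with \<open>x - x0\<close>. Since \<open>x0\<close> satisfies the
  constraints of the subproblem, and nonzero multipliers sit at active ones, the multiplier terms
  are nonnegative.\<close>

lemma block_qp_descent:
  assumes adm: "admissible_bounds l v" and qp: "block_qp g H x0 A c b C l v x \<mu> \<alpha> \<gamma>"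
    and x0: "x0 \<in> bounded_by C l v" "A *v x0 + c \<le> b"
  shows "g \<bullet> (x - x0) + (x - x0) \<bullet> (H *v (x - x0)) \<le> 0"
proof -
  let ?d = "x - x0"
  have stat: "g + H *v ?d + transpose A *v \<mu> + transpose C *v (\<gamma> - \<alpha>) = 0"
    and comp: "complementary \<mu> (b - (A *v x + c))" and box: "box_complementary C l v x \<alpha> \<gamma>"
    using qp by (auto simp: block_qp_def simp del: transpose_matrix_vector)
  have "0 \<le> \<mu> \<bullet> (A *v ?d)"
    unfolding inner_vec_def
  proof (rule sum_nonneg)
    fix i
    have \<mu>0: "0 \<le> \<mu> $ i" using comp by (simp add: complementary_def less_eq_vec_def)
    show "0 \<le> \<mu> $ i \<bullet> (A *v ?d) $ i"
    proof (cases "\<mu> $ i = 0")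
      case False
      with \<mu>0 have "(b - (A *v x + c)) $ i = 0" by (intro complementary_positive[OF comp]) auto
      moreover have "(A *v x0 + c) $ i \<le> b $ i" using x0(2) by (simp only: less_eq_vec_def)
      ultimately show ?thesis using \<mu>0 by (simp add: matrix_vector_mult_diff_distrib)
    qed simp
  qed
  moreover have "0 \<le> (\<gamma> - \<alpha>) \<bullet> (C *v ?d)"
    unfolding inner_vec_def
  proof (rule sum_nonneg)
    fix i
    note act = box_complementary_active[OF adm box, of i]
    have x0i: "l $ i \<le> ereal ((C *v x0) $ i)" "ereal ((C *v x0) $ i) \<le> v $ i"
      using x0(1) by (auto simp: bounded_by_def)
    consider "(\<gamma> - \<alpha>) $ i = 0" | "(\<gamma> - \<alpha>) $ i > 0" | "(\<gamma> - \<alpha>) $ i < 0" by linarith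
    then show "0 \<le> (\<gamma> - \<alpha>) $ i \<bullet> (C *v ?d) $ i"
    proof cases
      case 2
      then have "ereal ((C *v x0) $ i) \<le> ereal ((C *v x) $ i)" using act x0i by auto
      with 2 show ?thesis by (simp add: matrix_vector_mult_diff_distrib)
    next
      case 3
      then have "ereal ((C *v x) $ i) \<le> ereal ((C *v x0) $ i)" using act x0i by auto
      with 3 show ?thesis by (simp add: matrix_vector_mult_diff_distrib mult_nonpos_nonpos)
    qed (simp del: vector_minus_component)
  qed
  moreover have "(g + H *v ?d + transpose A *v \<mu> + transpose C *v (\<gamma> - \<alpha>)) \<bullet> ?d = 0"
    unfolding stat by simp
  ultimately show ?thesis
    by (simp add: inner_add_left inner_transpose_mult inner_commute[of ?d] del: transpose_matrix_vector)
qed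

lemma norm_min_diff_le:
  fixes a b :: "real ^ 'm"
  shows "norm ((\<chi> i. min (a $ i) (b $ i)) - a) \<le> norm (a - b)"
    "norm ((\<chi> i. min (a $ i) (b $ i)) - b) \<le> norm (a - b)"
  by (auto intro!: norm_le_componentwise_cart)

text \<open>The componentwise minimum of the multipliers \<open>\<mu>x\<close> and \<open>\<mu>y\<close> of Step 1 is positive only where
  both relaxed constraints are active. As the relaxations by half the residual add up, the original
  constraint is then active at the trial point.\<close>

lemma trial_point_step1:
  assumes Q: "well_posed Q" and u: "u \<in> feasible Q"
    and qx: "step1_x Q u Hx (fst ut) \<mu>x \<alpha>x \<gamma>x" and qy: "step1_y Q u Hy (snd ut) \<mu>y \<alpha>y \<gamma>y"
  defines "w \<equiv> row_mult (\<chi> i. min (\<mu>x $ i) (\<mu>y $ i)) (\<gamma>x - \<alpha>x) (\<gamma>y - \<alpha>y)"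
  shows "ut \<in> feasible Q"
    and "gradient (\<Phi> Q) u \<bullet> (ut - u) + (ut - u) \<bullet> block_diag Hx Hy (ut - u) \<le> 0"
    and "rows_mult Q ut w"
    and "\<forall>i. w $ i \<noteq> 0 \<longrightarrow> i \<in> trial_rows Q Step1 u ut"
    and "norm (gradient (\<Phi> Q) u + block_diag Hx Hy (ut - u) + rows_BT Q w)
      \<le> (onorm ((*v) (transpose (matE Q))) + onorm ((*v) (transpose (matF Q)))) * norm (\<mu>x - \<mu>y)"
proof -
  let ?h = "resid Q (fst u) (snd u)"
  let ?m = "\<chi> i. min (\<mu>x $ i) (\<mu>y $ i)"
  have adm: "admissible_bounds (lowC Q) (uppC Q)" "admissible_bounds (lowD Q) (uppD Q)"
    using Q by (auto simp: well_posed_def)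
  have ux: "fst u \<in> bounded_by (matC Q) (lowC Q) (uppC Q)" and uy: "snd u \<in> bounded_by (matD Q) (lowD Q) (uppD Q)"
    and h0: "?h \<le> 0"
    using u by (auto simp: feasible_def setX_def setY_def)
  have rx: "matE Q *v x + (matF Q *v snd u - vecd Q) = resid Q x (snd u)" for x
    by (simp add: resid_def)
  have ry: "matF Q *v y + (matE Q *v fst u - vecd Q) = resid Q (fst u) y" for y
    by (simp add: resid_def)
  \<comment> \<open>A nonpositive residual is at most its own half, so \<open>u\<close> itself
    satisfies both relaxed constraints.\<close>
  have half: "?h \<le> (1 / 2) *\<^sub>R ?h" using h0 by (simp add: less_eq_vec_def)
  note qx' = qx[unfolded step1_x_def] and qy' = qy[unfolded step1_y_def]
  have X: "resid Q (fst ut) (snd u) \<le> (1 / 2) *\<^sub>R ?h"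
    "gradient (objx Q) (fst u) + Hx *v (fst ut - fst u) + transpose (matE Q) *v \<mu>x + transpose (matC Q) *v (\<gamma>x - \<alpha>x) = 0"
    "complementary \<mu>x ((1 / 2) *\<^sub>R ?h - resid Q (fst ut) (snd u))"
    "box_complementary (matC Q) (lowC Q) (uppC Q) (fst ut) \<alpha>x \<gamma>x"
    using qx' unfolding block_qp_def is_arg_min_def rx by blast+
  have Y: "resid Q (fst u) (snd ut) \<le> (1 / 2) *\<^sub>R ?h"
    "gradient (objy Q) (snd u) + Hy *v (snd ut - snd u) + transpose (matF Q) *v \<mu>y + transpose (matD Q) *v (\<gamma>y - \<alpha>y) = 0"
    "complementary \<mu>y ((1 / 2) *\<^sub>R ?h - resid Q (fst u) (snd ut))"
    "box_complementary (matD Q) (lowD Q) (uppD Q) (snd ut) \<alpha>y \<gamma>y"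
    using qy' unfolding block_qp_def is_arg_min_def ry by blast+
  have "resid Q (fst ut) (snd ut) $ i \<le> 0" for i
  proof -
    have "resid Q (fst ut) (snd u) $ i \<le> 1 / 2 * ?h $ i" "resid Q (fst u) (snd ut) $ i \<le> 1 / 2 * ?h $ i"
      using X(1) Y(1) by (auto simp: less_eq_vec_def)
    then show ?thesis by (simp add: resid_split[of Q ut u])
  qed
  then show "ut \<in> feasible Q"
    using X(4) Y(4) by (auto simp: feasible_def setX_def setY_def box_complementary_def less_eq_vec_def case_prod_beta)
  have "gradient (objx Q) (fst u) \<bullet> (fst ut - fst u) + (fst ut - fst u) \<bullet> (Hx *v (fst ut - fst u)) \<le> 0"
    by (rule block_qp_descent[OF adm(1) qx' ux]) (unfold rx, rule half)
  moreover have "gradient (objy Q) (snd u) \<bullet> (snd ut - snd u) + (snd ut - snd u) \<bullet> (Hy *v (snd ut - snd u)) \<le> 0"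
    by (rule block_qp_descent[OF adm(2) qy' uy]) (unfold ry, rule half)
  ultimately show "gradient (\<Phi> Q) u \<bullet> (ut - u) + (ut - u) \<bullet> block_diag Hx Hy (ut - u) \<le> 0"
    by (simp add: gradient_\<Phi>[OF Q] block_diag_def inner_prod_def)
  have \<mu>0: "0 \<le> \<mu>x $ i" "0 \<le> \<mu>y $ i" for i
    using X(3) Y(3) by (auto simp: complementary_def less_eq_vec_def)
  have both: "resid Q (fst ut) (snd u) $ i = 1 / 2 * ?h $ i \<and> resid Q (fst u) (snd ut) $ i = 1 / 2 * ?h $ i"
    if "0 < ?m $ i" for i
    using complementary_positive[OF X(3), of i] complementary_positive[OF Y(3), of i] that by simp
  have bx: "(0 < (\<gamma>x - \<alpha>x) $ i \<longrightarrow> ereal ((matC Q *v fst ut) $ i) = uppC Q $ i) \<and>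
      ((\<gamma>x - \<alpha>x) $ i < 0 \<longrightarrow> ereal ((matC Q *v fst ut) $ i) = lowC Q $ i)" for i
    by (rule box_complementary_active[OF adm(1) X(4)])
  have bz: "(0 < (\<gamma>y - \<alpha>y) $ i \<longrightarrow> ereal ((matD Q *v snd ut) $ i) = uppD Q $ i) \<and>
      ((\<gamma>y - \<alpha>y) $ i < 0 \<longrightarrow> ereal ((matD Q *v snd ut) $ i) = lowD Q $ i)" for i
    by (rule box_complementary_active[OF adm(2) Y(4)])
  show "rows_mult Q ut w"
    unfolding w_def mult_row_mult_iff
  proof (intro conjI allI impI)
    fix i
    show "0 \<le> ?m $ i" using \<mu>0 by simp
    show "resid Q (fst ut) (snd ut) $ i = 0" if "0 < ?m $ i"
      using both[OF that] by (simp add: resid_split[of Q ut u])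
  qed (use bx bz in blast)+
  show "\<forall>i. w $ i \<noteq> 0 \<longrightarrow> i \<in> trial_rows Q Step1 u ut"
  proof (unfold split_sum_all, intro conjI allI impI)
    fix i assume "w $ Inl i \<noteq> 0"
    then have "0 < ?m $ i" using \<mu>0[of i] by (auto simp: w_def min_def split: if_splits)
    then show "Inl i \<in> trial_rows Q Step1 u ut"
      using both by (simp add: trial_rows_def trial_actS_def Plus_def)
  next
    fix j assume "w $ Inr (Inl j) \<noteq> 0"
    then have "(\<gamma>x - \<alpha>x) $ j \<noteq> 0" by (simp only: w_def row_mult_simps) simp
    then have "0 < (\<gamma>x - \<alpha>x) $ j \<or> (\<gamma>x - \<alpha>x) $ j < 0" by linarith
    with bx[of j] show "Inr (Inl j) \<in> trial_rows Q Step1 u ut"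
      by (auto simp: trial_rows_def actI_def act_low_def act_upp_def)
  next
    fix j assume "w $ Inr (Inr j) \<noteq> 0"
    then have "(\<gamma>y - \<alpha>y) $ j \<noteq> 0" by (simp only: w_def row_mult_simps) simp
    then have "0 < (\<gamma>y - \<alpha>y) $ j \<or> (\<gamma>y - \<alpha>y) $ j < 0" by linarith
    with bz[of j] show "Inr (Inr j) \<in> trial_rows Q Step1 u ut"
      by (auto simp: trial_rows_def actJ_def act_low_def act_upp_def)
  qed
  \<comment> \<open>When the multiplier of a block is replaced by the minimum, only the transposed
    matrix applied to the difference remains as stationarity error.\<close>
  have rearrange: "a + b + (p' + q) = p' - p" if "a + b + p + q = 0" for a b p p' q :: "'z::ab_group_add"
  proof -
    have "q = - (a + b + p)" by (rule minus_unique[OF that, symmetric])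
    then show ?thesis by simp
  qed
  have "gradient (objx Q) (fst u) + Hx *v (fst ut - fst u) + (transpose (matE Q) *v ?m + transpose (matC Q) *v (\<gamma>x - \<alpha>x))
      = transpose (matE Q) *v (?m - \<mu>x)"
    unfolding matrix_vector_mult_diff_distrib[of _ ?m] by (rule rearrange[OF X(2)])
  moreover have "gradient (objy Q) (snd u) + Hy *v (snd ut - snd u) + (transpose (matF Q) *v ?m + transpose (matD Q) *v (\<gamma>y - \<alpha>y))
      = transpose (matF Q) *v (?m - \<mu>y)"
    unfolding matrix_vector_mult_diff_distrib[of _ ?m] by (rule rearrange[OF Y(2)])
  ultimately have eq: "gradient (\<Phi> Q) u + block_diag Hx Hy (ut - u) + rows_BT Q w
      = (transpose (matE Q) *v (?m - \<mu>x), transpose (matF Q) *v (?m - \<mu>y))"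
    by (simp add: w_def BT_row_mult gradient_\<Phi>[OF Q] block_diag_def del: transpose_matrix_vector)
  have "norm (transpose (matE Q) *v (?m - \<mu>x)) \<le> onorm ((*v) (transpose (matE Q))) * norm (\<mu>x - \<mu>y)"
    by (rule order_trans[OF onorm[OF matrix_vector_mul_bounded_linear] mult_left_mono])
      (simp_all add: norm_min_diff_le onorm_pos_le matrix_vector_mul_bounded_linear del: transpose_matrix_vector)
  moreover have "norm (transpose (matF Q) *v (?m - \<mu>y)) \<le> onorm ((*v) (transpose (matF Q))) * norm (\<mu>x - \<mu>y)"
    by (rule order_trans[OF onorm[OF matrix_vector_mul_bounded_linear] mult_left_mono])
      (simp_all add: norm_min_diff_le onorm_pos_le matrix_vector_mul_bounded_linear del: transpose_matrix_vector)
  ultimately show "norm (gradient (\<Phi> Q) u + block_diag Hx Hy (ut - u) + rows_BT Q w)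
      \<le> (onorm ((*v) (transpose (matE Q))) + onorm ((*v) (transpose (matF Q)))) * norm (\<mu>x - \<mu>y)"
    unfolding eq distrib_right by (rule order_trans[OF norm_Pair_le add_mono])
qed

text \<open>The joint subproblem has a single multiplier for the coupling constraint, so
  stationarity is exact. Testing it with \<open>ut - u\<close> and using feasibility of
  \<open>u\<close> gives the descent inequality.\<close>

lemma trial_point_step3:
  assumes Q: "well_posed Q" and u: "u \<in> feasible Q"
    and s: "step3 Q u Hx Hy ut \<mu> \<alpha>x \<gamma>x \<alpha>y \<gamma>y"
  defines "w \<equiv> row_mult \<mu> (\<gamma>x - \<alpha>x) (\<gamma>y - \<alpha>y)"
  shows "ut \<in> feasible Q"
    and "gradient (\<Phi> Q) u \<bullet> (ut - u) + (ut - u) \<bullet> block_diag Hx Hy (ut - u) \<le> 0"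
    and "rows_mult Q ut w"
    and "\<forall>i. w $ i \<noteq> 0 \<longrightarrow> i \<in> trial_rows Q Step3 u ut"
    and "gradient (\<Phi> Q) u + block_diag Hx Hy (ut - u) + rows_BT Q w = 0"
proof -
  have adm: "admissible_bounds (lowC Q) (uppC Q)" "admissible_bounds (lowD Q) (uppD Q)"
    using Q by (auto simp: well_posed_def)
  show "ut \<in> feasible Q" using s by (auto simp: step3_def is_arg_min_def)
  have S: "gradient (objx Q) (fst u) + Hx *v (fst ut - fst u) + transpose (matE Q) *v \<mu> + transpose (matC Q) *v (\<gamma>x - \<alpha>x) = 0"
    "gradient (objy Q) (snd u) + Hy *v (snd ut - snd u) + transpose (matF Q) *v \<mu> + transpose (matD Q) *v (\<gamma>y - \<alpha>y) = 0"
    "complementary \<mu> (- resid Q (fst ut) (snd ut))"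
    "box_complementary (matC Q) (lowC Q) (uppC Q) (fst ut) \<alpha>x \<gamma>x"
    "box_complementary (matD Q) (lowD Q) (uppD Q) (snd ut) \<alpha>y \<gamma>y"
    using s unfolding step3_def by blast+
  show eq: "gradient (\<Phi> Q) u + block_diag Hx Hy (ut - u) + rows_BT Q w = 0"
    using S(1,2)
    by (simp add: w_def BT_row_mult gradient_\<Phi>[OF Q] block_diag_def prod_eq_iff add.assoc del: transpose_matrix_vector)
  show m: "rows_mult Q ut w"
    unfolding w_def mult_row_mult_iff
  proof (intro conjI allI impI)
    fix i
    show "0 \<le> \<mu> $ i" using S(3) by (simp add: complementary_def less_eq_vec_def)
    show "resid Q (fst ut) (snd ut) $ i = 0" if "0 < \<mu> $ i"
      using complementary_positive[OF S(3) that] by simp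
  qed (use box_complementary_active[OF adm(1) S(4)] box_complementary_active[OF adm(2) S(5)] in blast)+
  have "active_rows Q ut = trial_rows Q Step3 u ut"
    by (simp add: active_rows_def trial_rows_def trial_actS_def actS_def)
  then show "\<forall>i. w $ i \<noteq> 0 \<longrightarrow> i \<in> trial_rows Q Step3 u ut"
    using polyhedron.mult_supported[OF m] by (auto simp: act_eq_active_rows supported_def)
  have "rows_BT Q w \<bullet> (u - ut) \<le> 0"
    using polyhedron.mult_normal_sum[OF m] u by (simp add: feas_eq_feasible)
  moreover have "(gradient (\<Phi> Q) u + block_diag Hx Hy (ut - u) + rows_BT Q w) \<bullet> (ut - u) = 0"
    unfolding eq by simp
  moreover have "rows_BT Q w \<bullet> (u - ut) = - (rows_BT Q w \<bullet> (ut - u))" by (simp add: inner_diff_right)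
  ultimately show "gradient (\<Phi> Q) u \<bullet> (ut - u) + (ut - u) \<bullet> block_diag Hx Hy (ut - u) \<le> 0"
    by (simp only: inner_add_left inner_commute[of "ut - u" "block_diag Hx Hy (ut - u)"])
qed

text \<open>Joins both origins of the trial point under one constant; the summand 1 keeps it
  positive even if both matrices vanish.\<close>

lemma trial_point_properties:
  assumes Q: "well_posed Q" and u: "u \<in> feasible Q" and "0 < M1" "2 \<le> \<tau>1"
    and tp: "trial_point Q \<tau>1 M M1 u Hx Hy orig ut"
  shows "ut \<in> feasible Q"
    and "gradient (\<Phi> Q) u \<bullet> (ut - u) + (ut - u) \<bullet> block_diag Hx Hy (ut - u) \<le> 0"
    and "\<exists>w. rows_mult Q ut w \<and> (\<forall>i. w $ i \<noteq> 0 \<longrightarrow> i \<in> trial_rows Q orig u ut) \<and>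
      (norm (ut - u) \<le> 1 \<longrightarrow> norm (gradient (\<Phi> Q) u + block_diag Hx Hy (ut - u) + rows_BT Q w)
      \<le> ((onorm ((*v) (transpose (matE Q))) + onorm ((*v) (transpose (matF Q)))) * M1 + 1) * (norm (ut - u))\<^sup>2)"
proof -
  let ?K = "onorm ((*v) (transpose (matE Q))) + onorm ((*v) (transpose (matF Q)))"
  have K0: "?K \<ge> 0"
    by (intro add_nonneg_nonneg onorm_pos_le matrix_vector_mul_bounded_linear)
  consider (1) \<mu>x \<alpha>x \<gamma>x \<mu>y \<alpha>y \<gamma>y where "step1_x Q u Hx (fst ut) \<mu>x \<alpha>x \<gamma>x" "step1_y Q u Hy (snd ut) \<mu>y \<alpha>y \<gamma>y"
      "norm (\<mu>x - \<mu>y) \<le> M1 * norm (ut - u) powr \<tau>1" "orig = Step1"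
    | (3) \<mu> \<alpha>x \<gamma>x \<alpha>y \<gamma>y where "step3 Q u Hx Hy ut \<mu> \<alpha>x \<gamma>x \<alpha>y \<gamma>y" "orig = Step3"
    using tp unfolding trial_point_def by (auto split: if_splits)
  then have "ut \<in> feasible Q \<and> gradient (\<Phi> Q) u \<bullet> (ut - u) + (ut - u) \<bullet> block_diag Hx Hy (ut - u) \<le> 0 \<and>
    (\<exists>w. rows_mult Q ut w \<and> (\<forall>i. w $ i \<noteq> 0 \<longrightarrow> i \<in> trial_rows Q orig u ut) \<and>
      (norm (ut - u) \<le> 1 \<longrightarrow> norm (gradient (\<Phi> Q) u + block_diag Hx Hy (ut - u) + rows_BT Q w)
      \<le> (?K * M1 + 1) * (norm (ut - u))\<^sup>2))"
  proof cases
    case 1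
    note T = trial_point_step1[OF Q u 1(1,2)]
    have "norm (gradient (\<Phi> Q) u + block_diag Hx Hy (ut - u) + rows_BT Q (row_mult (\<chi> i. min (\<mu>x $ i) (\<mu>y $ i)) (\<gamma>x - \<alpha>x) (\<gamma>y - \<alpha>y)))
      \<le> (?K * M1 + 1) * (norm (ut - u))\<^sup>2" if n: "norm (ut - u) \<le> 1"
    proof -
      \<comment> \<open>For a base of at most 1, a larger exponent gives a smaller power; here
        \<open>2 \<le> \<tau>1\<close> and \<open>norm (ut - u) \<le> 1\<close> enter.\<close>
      have "norm (ut - u) powr \<tau>1 \<le> (norm (ut - u))\<^sup>2"
        using powr_mono'[of 2 \<tau>1 "norm (ut - u)"] assms(4) n by simp
      then have "norm (\<mu>x - \<mu>y) \<le> M1 * (norm (ut - u))\<^sup>2"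
        using 1(3) assms(3) by (meson less_imp_le mult_left_mono order_trans)
      then have "?K * norm (\<mu>x - \<mu>y) \<le> ?K * (M1 * (norm (ut - u))\<^sup>2)"
        by (rule mult_left_mono[OF _ K0])
      also have "\<dots> \<le> (?K * M1 + 1) * (norm (ut - u))\<^sup>2"
        unfolding distrib_right mult.assoc by simp
      finally show ?thesis using T(5) by linarith
    qed
    then show ?thesis using T(1-4) 1(4) by blast
  next
    case 3
    note T = trial_point_step3[OF Q u 3(1)]
    have "0 \<le> (?K * M1 + 1) * (norm (ut - u))\<^sup>2" using K0 assms(3) by simp
    then show ?thesis using T 3(2) by (metis norm_zero)
  qed
  then show "ut \<in> feasible Q"
    and "gradient (\<Phi> Q) u \<bullet> (ut - u) + (ut - u) \<bullet> block_diag Hx Hy (ut - u) \<le> 0"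
    and "\<exists>w. rows_mult Q ut w \<and> (\<forall>i. w $ i \<noteq> 0 \<longrightarrow> i \<in> trial_rows Q orig u ut) \<and>
      (norm (ut - u) \<le> 1 \<longrightarrow> norm (gradient (\<Phi> Q) u + block_diag Hx Hy (ut - u) + rows_BT Q w)
      \<le> (?K * M1 + 1) * (norm (ut - u))\<^sup>2)"
    by blast+
qed

section \<open>Quadratic convergence\<close>

theorem theorem4p5:
  fixes Q :: "('n1::finite, 'n2::finite, 'm::finite, 'c::finite, 'e::finite) problem"
    and \<rho> \<sigma> \<tau>1 M M1 \<eta> :: real
    and u ut :: "nat \<Rightarrow> (real ^ 'n1) \<times> (real ^ 'n2)"
    and Hx :: "nat \<Rightarrow> real ^ 'n1 ^ 'n1" and Hy :: "nat \<Rightarrow> real ^ 'n2 ^ 'n2"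
    and orig :: "nat \<Rightarrow> origin"
  defines "Hu \<equiv> \<lambda>k. block_diag (Hx k) (Hy k)"
    and "du \<equiv> \<lambda>k. ut k - u k"
    and "P \<equiv> \<lambda>k. proj Q (trial_rows Q (orig k) (u k) (ut k))"
  assumes problem: "well_posed Q"
    and params: "0 < \<rho>" "\<rho> < 1 / 2" "0 < \<sigma>" "\<sigma> < 1" "2 \<le> \<tau>1" "0 < M" "0 < M1"
    and run: "generates Q \<rho> \<sigma> \<tau>1 M M1 u Hx Hy orig ut"
    and H_lower: "0 < \<eta>" "\<And>k z. \<eta> * (z \<bullet> z) \<le> z \<bullet> Hu k z"
    and H_bounded: "\<And>K :: nat set. infinite K \<Longrightarrow> bounded (u ` K) \<Longrightarrow> \<exists>b. \<forall>k\<in>K. onorm (Hu k) \<le> b"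
    and smooth: "\<exists>U V. open U \<and> open V \<and> feasible Q \<subseteq> U \<times> V \<and>
                   C_k_on 3 (objx Q) U \<and> C_k_on 3 (objy Q) V"
    and u_bounded: "bounded (range u)"
    and regular: "\<And>p. accumulation_point u p \<Longrightarrow> full_row_rank Q (active_rows Q p)"
    and second_order: "\<And>p \<mu> \<alpha>x \<gamma>x \<alpha>y \<gamma>y. accumulation_point u p \<Longrightarrow> KKT Q p \<mu> \<alpha>x \<gamma>x \<alpha>y \<gamma>y \<Longrightarrow>
                   second_order_condition Q p \<mu> \<alpha>x \<gamma>x \<alpha>y \<gamma>y"
    and hessian_approx:
      "(\<lambda>k. norm (Hu k (du k) - hessian (\<Phi> Q) (u k) (du k))) \<in> O(\<lambda>k. (norm (du k))\<^sup>2) \<or>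
       ((\<lambda>k. norm (P k (Hu k (du k) - hessian (\<Phi> Q) (u k) (du k)))) \<in> O(\<lambda>k. (norm (du k))\<^sup>2) \<and>
        (\<forall>p \<mu> \<alpha>x \<gamma>x \<alpha>y \<gamma>y. accumulation_point u p \<longrightarrow> KKT Q p \<mu> \<alpha>x \<gamma>x \<alpha>y \<gamma>y \<longrightarrow>
           strict_complementarity Q p \<mu> \<alpha>x \<gamma>x \<alpha>y \<gamma>y))"
  shows "\<exists>p. u \<longlonglongrightarrow> p \<and>
           (\<lambda>k. norm (u (Suc k) - p)) \<in> O(\<lambda>k. (norm (u k - p))\<^sup>2)"
proof -
  define G where "G = gradient (\<Phi> Q)"
  define A where "A = hessian (\<Phi> Q)"
  define c where "c = (onorm ((*v) (transpose (matE Q))) + onorm ((*v) (transpose (matF Q)))) * M1 + 1"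
  have c0: "0 < c"
    unfolding c_def using params(7)
    by (intro add_nonneg_pos mult_nonneg_nonneg add_nonneg_nonneg onorm_pos_le matrix_vector_mul_bounded_linear) auto
  have u0: "u 0 \<in> feasible Q"
    and trial: "\<And>k. trial_point Q \<tau>1 M M1 (u k) (Hx k) (Hy k) (orig k) (ut k)"
    and ex_t: "\<And>k. \<exists>t \<in> armijo_steps Q \<rho> \<sigma> (u k) (Hx k) (Hy k) (ut k - u k).
             (\<forall>t' \<in> armijo_steps Q \<rho> \<sigma> (u k) (Hx k) (Hy k) (ut k - u k). t' \<le> t) \<and>
             u (Suc k) = u k + t *\<^sub>R (ut k - u k)"
    using run unfolding generates_def by blast+
  from ex_t obtain t where t: "\<And>k. t k \<in> armijo_steps Q \<rho> \<sigma> (u k) (Hx k) (Hy k) (ut k - u k)"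
    and t_max: "\<And>k t'. t' \<in> armijo_steps Q \<rho> \<sigma> (u k) (Hx k) (Hy k) (ut k - u k) \<Longrightarrow> t' \<le> t k"
    and step: "\<And>k. u (Suc k) = u k + t k *\<^sub>R (ut k - u k)"
    by metis
  have t_pow: "\<exists>i. t k = \<sigma> ^ i" for k using t[of k] by (auto simp: armijo_steps_def)
  have t_range: "0 < t k" "t k \<le> 1" for k
    using t_pow[of k] params by (auto simp: power_le_one)
  have trial_feas: "u k \<in> feasible Q \<Longrightarrow> ut k \<in> feasible Q" for k
    by (rule trial_point_properties(1)[OF problem _ params(7,5) trial])
  have feas_u: "u k \<in> feasible Q" for k
  proof (induction k)
    case (Suc k)
    have "(1 - t k) *\<^sub>R u k + t k *\<^sub>R ut k \<in> feasible Q"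
      using convexD_alt[OF convex_feas[of Q], of "u k" "ut k" "t k"] Suc trial_feas[OF Suc] t_range[of k]
      by (simp add: feas_eq_feasible)
    moreover have "(1 - t k) *\<^sub>R u k + t k *\<^sub>R ut k = u (Suc k)"
      unfolding step by (simp add: algebra_simps)
    ultimately show ?case by simp
  qed (rule u0)
  note feas_ut = trial_feas[OF feas_u]
  note tpp = trial_point_properties[OF problem feas_u params(7,5) trial]
  obtain w where w: "\<And>k. rows_mult Q (ut k) (w k)"
    and w_rows: "\<And>k i. w k $ i \<noteq> 0 \<Longrightarrow> i \<in> trial_rows Q (orig k) (u k) (ut k)"
    and w_res: "\<And>k. norm (ut k - u k) \<le> 1 \<Longrightarrow> norm (G (u k) + Hu k (ut k - u k) + rows_BT Q (w k)) \<le> c * (norm (ut k - u k))\<^sup>2"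
    using tpp(3) unfolding G_def c_def Hu_def by metis
  have lin_H: "bounded_linear (Hu k)" for k
    unfolding Hu_def block_diag_def linear_conv_bounded_linear[symmetric]
    by (rule linearI) (simp_all add: matrix_vector_right_distrib matrix_vector_mult_scaleR)
  \<comment> \<open>The whole sequence is bounded, so \<open>H_bounded\<close> may be used with the
    set of all indices.\<close>
  obtain B where B: "\<And>k. onorm (Hu k) \<le> B"
    using H_bounded[of UNIV] u_bounded by auto
  define \<beta> where "\<beta> = \<bar>B\<bar> + 1"
  have H_upper: "norm (Hu k z) \<le> \<beta> * norm z" for k z
  proof -
    have "norm (Hu k z) \<le> onorm (Hu k) * norm z" by (rule onorm[OF lin_H])
    also have "\<dots> \<le> \<beta> * norm z" using B[of k] by (intro mult_right_mono) (auto simp: \<beta>_def)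
    finally show ?thesis .
  qed
  have smooth_at: "second_order_at G A p" if p: "p \<in> feasible Q" for p
  proof -
    from smooth obtain U V where "open U" "open V" "feasible Q \<subseteq> U \<times> V" "C_k_on 3 (objx Q) U" "C_k_on 3 (objy Q) V"
      by blast
    with p show ?thesis unfolding G_def A_def by (intro second_order_at_\<Phi>[OF problem]) auto
  qed
  interpret D: descent_run "brow Q" "row_low Q" "row_upp Q" "\<Phi> Q" G A \<rho> \<sigma> \<eta> \<beta> c u ut t Hu w
  proof
    show "(\<Phi> Q has_derivative (\<lambda>h. G x \<bullet> h)) (at x)" for x
      unfolding G_def by (rule has_derivative_\<Phi>[OF problem])
    show "second_order_at G A p" if "p \<in> rows_feas Q" for p
      using smooth_at that by (simp add: feas_eq_feasible)
    show "0 < \<beta>" by (simp add: \<beta>_def)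
    show "u k \<in> rows_feas Q" "ut k \<in> rows_feas Q" for k
      using feas_u feas_ut by (simp_all add: feas_eq_feasible)
    show "G (u k) \<bullet> (ut k - u k) + (ut k - u k) \<bullet> Hu k (ut k - u k) \<le> 0" for k
      unfolding G_def Hu_def by (rule tpp(2))
    show "\<Phi> Q (u (Suc k)) \<le> \<Phi> Q (u k) - \<rho> * t k * ((ut k - u k) \<bullet> Hu k (ut k - u k))" for k
      using t[of k] step[of k] by (simp add: armijo_steps_def Hu_def)
    show "\<Phi> Q (u k) - \<rho> * (t k / \<sigma>) * ((ut k - u k) \<bullet> Hu k (ut k - u k)) < \<Phi> Q (u k + (t k / \<sigma>) *\<^sub>R (ut k - u k))"
      if "t k \<noteq> 1" for k
    proof -
      \<comment> \<open>A step length other than 1 is a positive power of \<open>\<sigma>\<close>,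
        so \<open>t k / \<sigma>\<close> is again a candidate. It exceeds the largest accepted one
        and must fail the test.\<close>
      obtain i where i: "t k = \<sigma> ^ i" using t_pow by blast
      with that have "i \<noteq> 0" by (intro notI) simp
      then have "t k / \<sigma> = \<sigma> ^ (i - 1)" using i params by (simp add: power_eq_if)
      moreover have "t k < t k / \<sigma>" using t_range(1)[of k] params by (simp add: field_simps)
      then have "t k / \<sigma> \<notin> armijo_steps Q \<rho> \<sigma> (u k) (Hx k) (Hy k) (ut k - u k)"
        using t_max[of "t k / \<sigma>" k] by auto
      ultimately show ?thesis by (simp add: armijo_steps_def Hu_def)
    qed
    show "t k = 1" if "\<Phi> Q (ut k) \<le> \<Phi> Q (u k) - \<rho> * ((ut k - u k) \<bullet> Hu k (ut k - u k))" for k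
    proof -
      have "1 \<in> armijo_steps Q \<rho> \<sigma> (u k) (Hx k) (Hy k) (ut k - u k)"
        using that by (auto simp: armijo_steps_def Hu_def intro!: image_eqI[of _ _ 0])
      then show ?thesis using t_max t_range(2)[of k] by (meson antisym)
    qed
    show "rows_licq Q p" if "accumulation_point u p" for p
      by (rule licq_active_rows[OF regular[OF that]])
    show "rows_curvature Q (A p) v"
      if acc: "accumulation_point u p" and v: "rows_mult Q p v" "G p + rows_BT Q v = 0" for p v
    proof -
      have "closed (feasible Q)" using polyhedron.closed_feas by (simp flip: feas_eq_feasible)
      then have p: "p \<in> feasible Q"
        using acc feas_u unfolding accumulation_point_def by (auto elim!: closed_sequentially[rotated 2])
      show ?thesis
        unfolding A_def
        by (rule curvature_of_second_order_condition[OF second_order[OF acc KKT_of_rows[OF problem p v[unfolded G_def]]]])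
    qed
  qed (use params H_lower H_upper c0 step t_range w w_res u_bounded in auto)
  obtain p where lim: "u \<longlonglongrightarrow> p" and acc: "accumulation_point u p" using D.u_convergent by blast
  obtain w' where w': "w \<longlonglongrightarrow> w'" "rows_mult Q p w'" "G p + rows_BT Q w' = 0"
    using D.w_convergent[OF lim] by blast
  have p: "p \<in> feasible Q" using D.accumulation_feas[OF acc] by (simp add: feas_eq_feasible)
  let ?W = "\<lambda>k. Hu k (du k) - A (u k) (du k)"
  \<comment> \<open>Both alternatives take this common form: up to second order, the Hessian error
    lies in the span of the rows with nonzero \<open>w'\<close>.\<close>
  have "\<exists>\<nu> e. eventually (\<lambda>k. norm (?W k - rows_BT Q (\<nu> k)) \<le> e * (norm (du k))\<^sup>2 \<and>
          norm (\<nu> k) \<le> e * norm (du k) \<and> (\<forall>i. \<nu> k $ i \<noteq> 0 \<longrightarrow> w' $ i \<noteq> 0)) sequentially"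
    using hessian_approx
  proof
    assume "(\<lambda>k. norm (Hu k (du k) - hessian (\<Phi> Q) (u k) (du k))) \<in> O(\<lambda>k. (norm (du k))\<^sup>2)"
    then obtain e where e: "e > 0" "eventually (\<lambda>k. norm (?W k) \<le> e * (norm (du k))\<^sup>2) sequentially"
      by (auto simp: A_def elim!: landau_o.bigE)
    from e(2) show ?thesis
      by (intro exI[of _ "\<lambda>_. 0"] exI[of _ e], elim eventually_mono)
        (use e(1) in \<open>simp add: linear_0[OF polyhedron.linear_BT]\<close>)
  next
    assume *: "(\<lambda>k. norm (P k (Hu k (du k) - hessian (\<Phi> Q) (u k) (du k)))) \<in> O(\<lambda>k. (norm (du k))\<^sup>2) \<and>
        (\<forall>p \<mu> \<alpha>x \<gamma>x \<alpha>y \<gamma>y. accumulation_point u p \<longrightarrow> KKT Q p \<mu> \<alpha>x \<gamma>x \<alpha>y \<gamma>y \<longrightarrow>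
           strict_complementarity Q p \<mu> \<alpha>x \<gamma>x \<alpha>y \<gamma>y)"
    then obtain e where e: "e > 0" "eventually (\<lambda>k. norm (P k (?W k)) \<le> e * (norm (du k))\<^sup>2) sequentially"
      by (auto simp: A_def elim!: landau_o.bigE)
    let ?R = "active_rows Q p"
    \<comment> \<open>Strict complementarity makes every row that is active at \<open>p\<close>
      strongly active.\<close>
    have nz: "w' $ i \<noteq> 0" if "i \<in> ?R" for i
      by (rule nonzero_of_strict_complementarity[OF _ that])
        (use * acc KKT_of_rows[OF problem p w'(2,3)[unfolded G_def]] in blast)
    have "eventually (\<lambda>k. w k $ i \<noteq> 0) sequentially" if "i \<in> ?R" for i
      by (rule tendsto_imp_eventually_ne[OF tendsto_vec_nth[OF w'(1)] nz[OF that]])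
    then have "eventually (\<lambda>k. \<forall>i\<in>?R. w k $ i \<noteq> 0) sequentially"
      by (subst eventually_ball_finite_distrib) auto
    moreover have "ut \<longlonglongrightarrow> p" using tendsto_add[OF lim D.d_tendsto_0] by (simp add: D.d_def)
    then have "eventually (\<lambda>k. rows_act Q (ut k) \<subseteq> rows_act Q p) sequentially"
      by (rule eventually_compose_filterlim[OF polyhedron.eventually_act])
    \<comment> \<open>The projection is eventually a fixed one: rows with nonzero \<open>w k\<close>
      are trial rows, and trial rows are active at \<open>ut k\<close>, hence at \<open>p\<close>
      for late \<open>k\<close>.\<close>
    ultimately have rows: "eventually (\<lambda>k. trial_rows Q (orig k) (u k) (ut k) = ?R) sequentially"
    proof eventually_elim
      case (elim k)
      then show ?case
        using w_rows[of k] trial_rows_active[of Q "orig k" "u k" "ut k"]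
        unfolding act_eq_active_rows by blast
    qed
    obtain K where "\<forall>z. \<exists>\<nu>. \<nu> \<in> supported ?R \<and> z - proj Q ?R z = rows_BT Q \<nu> \<and> norm \<nu> \<le> K * norm z"
      using proj_decomposition[OF regular[OF acc]] by blast
    then obtain n where n: "\<And>z. n z \<in> supported ?R" "\<And>z. z - proj Q ?R z = rows_BT Q (n z)"
      "\<And>z. norm (n z) \<le> K * norm z" by metis
    obtain L where "eventually (\<lambda>x. \<forall>h. norm (A x h) \<le> L * norm h) (nhds p)"
      using second_order_at_bound[OF smooth_at[OF p]] by blast
    then have A_bound: "eventually (\<lambda>k. \<forall>h. norm (A (u k) h) \<le> L * norm h) sequentially"
      by (rule eventually_compose_filterlim[OF _ lim])
    \<comment> \<open>One constant has to serve both estimates: \<open>e\<close> bounds the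
      projected error, the other entry bounds the multiplier vector through
      \<open>norm (?W k)\<close>.\<close>
    define e' where "e' = max e (\<bar>K\<bar> * (\<beta> + L))"
    have "eventually (\<lambda>k. norm (?W k - rows_BT Q (n (?W k))) \<le> e' * (norm (du k))\<^sup>2 \<and>
          norm (n (?W k)) \<le> e' * norm (du k) \<and> (\<forall>i. n (?W k) $ i \<noteq> 0 \<longrightarrow> w' $ i \<noteq> 0)) sequentially"
      using e(2) rows A_bound
    proof eventually_elim
      case (elim k)
      have "?W k - rows_BT Q (n (?W k)) = P k (?W k)"
        using n(2)[of "?W k"] elim(2) by (simp add: P_def algebra_simps)
      then have "norm (?W k - rows_BT Q (n (?W k))) \<le> e * (norm (du k))\<^sup>2" using elim(1) by simp
      also have "\<dots> \<le> e' * (norm (du k))\<^sup>2" by (simp add: e'_def mult_right_mono)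
      finally have 1: "norm (?W k - rows_BT Q (n (?W k))) \<le> e' * (norm (du k))\<^sup>2" .
      have "norm (?W k) \<le> norm (Hu k (du k)) + norm (A (u k) (du k))" by (rule norm_triangle_ineq4)
      also have "\<dots> \<le> (\<beta> + L) * norm (du k)"
        unfolding distrib_right by (intro add_mono H_upper elim(3)[rule_format])
      finally have W: "norm (?W k) \<le> (\<beta> + L) * norm (du k)" .
      have "norm (n (?W k)) \<le> \<bar>K\<bar> * norm (?W k)"
        by (rule order_trans[OF n(3)]) (simp add: mult_right_mono)
      also have "\<dots> \<le> \<bar>K\<bar> * ((\<beta> + L) * norm (du k))" by (rule mult_left_mono[OF W]) simp
      also have "\<dots> = (\<bar>K\<bar> * (\<beta> + L)) * norm (du k)" by (simp only: mult.assoc)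
      also have "\<dots> \<le> e' * norm (du k)" by (rule mult_right_mono) (simp_all add: e'_def)
      finally have 2: "norm (n (?W k)) \<le> e' * norm (du k)" .
      show ?case using 1 2 n(1)[of "?W k"] nz by (auto simp: supported_def)
    qed
    then show ?thesis by (intro exI[of _ "\<lambda>k. n (?W k)"] exI[of _ e'])
  qed
  then obtain \<nu> e where "eventually (\<lambda>k. norm (?W k - rows_BT Q (\<nu> k)) \<le> e * (norm (du k))\<^sup>2 \<and>
          norm (\<nu> k) \<le> e * norm (du k) \<and> (\<forall>i. \<nu> k $ i \<noteq> 0 \<longrightarrow> w' $ i \<noteq> 0)) sequentially"
    by blast
  then have "(\<lambda>k. norm (u (Suc k) - p)) \<in> O(\<lambda>k. (norm (u k - p))\<^sup>2)"
    unfolding du_def D.d_def[symmetric] by (rule D.quadratic_convergence[OF lim w'(1)])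
  with lim show ?thesis by blast
qed

end
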